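(* Let $G$ be a tame $\ell_c$-group and fix $\pi\in\widehat{G}$. The functor from the category of complex vector spaces to $\mathcal{R}(G)$ which sends $V\mapsto V_G\otimes_{\mathbb{C}}\pi$, where $V_G$ denotes the trivial representation of $G$ on $V$, is an equivalence onto the full subcategory $\mathcal{R}(G)_{\pi}$ of smooth representations of $G$ with support contained in $\{\pi\}$.
   Context: An $\ell$-group is a Hausdorff, locally compact, totally disconnected topological group. An $\ell_c$-group is an $\ell$-group which is a filtered union of its compact open subgroups (every element lies in a compact open subgroup, and any two compact open subgroups are contained in a third). A complex representation $(\pi,V)$ of an $\ell$-group $G$ is smooth if every vector of $V$ has open stabilizer in $G$; it is admissible if in addition $V^K$ is finite-dimensional for every compact open subgroup $K \subset G$. An $\ell$-group is tame if all its irreducible smooth representations are admissible. $\mathcal{R}(G)$ is the category of smooth representations of $G$, and $\widehat{G}$ is the set of isomorphism classes of irreducible smooth representations of $G$. The support of $M\in\mathcal{R}(G)$ is $\operatorname{Supp} M=\{\pi\in\widehat{G} \mid \operatorname{Hom}_G(M,\pi)\neq 0\}$. *)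

theory Defs
  imports "HOL-Analysis.Analysis" "HOL-Algebra.Module"
begin

section \<open>Categories, functors, equivalences\<close>

text \<open>\<open>Cmp C X Y Z g f\<close> is the composite of \<open>f : X \<rightarrow> Y\<close> with \<open>g : Y \<rightarrow> Z\<close>. The objects are
  recorded because set-theoretic maps with carriers do not determine their codomain.\<close>

record ('o, 'a) cat =
  Ob  :: "'o set"
  Mor :: "'o \<Rightarrow> 'o \<Rightarrow> 'a set"
  Idn :: "'o \<Rightarrow> 'a"
  Cmp :: "'o \<Rightarrow> 'o \<Rightarrow> 'o \<Rightarrow> 'a \<Rightarrow> 'a \<Rightarrow> 'a"

definition is_category :: "('o, 'a) cat \<Rightarrow> bool" where
  "is_category C \<longleftrightarrow>
     (\<forall>X\<in>Ob C. Idn C X \<in> Mor C X X) \<and>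
     (\<forall>X\<in>Ob C. \<forall>Y\<in>Ob C. \<forall>Z\<in>Ob C. \<forall>f\<in>Mor C X Y. \<forall>g\<in>Mor C Y Z. Cmp C X Y Z g f \<in> Mor C X Z) \<and>
     (\<forall>X\<in>Ob C. \<forall>Y\<in>Ob C. \<forall>f\<in>Mor C X Y.
        Cmp C X X Y f (Idn C X) = f \<and> Cmp C X Y Y (Idn C Y) f = f) \<and>
     (\<forall>W\<in>Ob C. \<forall>X\<in>Ob C. \<forall>Y\<in>Ob C. \<forall>Z\<in>Ob C. \<forall>f\<in>Mor C W X. \<forall>g\<in>Mor C X Y. \<forall>h\<in>Mor C Y Z.
        Cmp C W Y Z h (Cmp C W X Y g f) = Cmp C W X Z (Cmp C X Y Z h g) f)"

definition full_subcategory :: "('o, 'a) cat \<Rightarrow> ('o \<Rightarrow> bool) \<Rightarrow> ('o, 'a) cat" where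
  "full_subcategory C P = C\<lparr>Ob := {X \<in> Ob C. P X}\<rparr>"

definition is_functor ::
  "('o, 'a) cat \<Rightarrow> ('p, 'b) cat \<Rightarrow> ('o \<Rightarrow> 'p) \<Rightarrow> ('o \<Rightarrow> 'o \<Rightarrow> 'a \<Rightarrow> 'b) \<Rightarrow> bool" where
  "is_functor C D Fo Fm \<longleftrightarrow>
     is_category C \<and> is_category D \<and>
     (\<forall>X\<in>Ob C. Fo X \<in> Ob D) \<and>
     (\<forall>X\<in>Ob C. \<forall>Y\<in>Ob C. \<forall>f\<in>Mor C X Y. Fm X Y f \<in> Mor D (Fo X) (Fo Y)) \<and>
     (\<forall>X\<in>Ob C. Fm X X (Idn C X) = Idn D (Fo X)) \<and>
     (\<forall>X\<in>Ob C. \<forall>Y\<in>Ob C. \<forall>Z\<in>Ob C. \<forall>f\<in>Mor C X Y. \<forall>g\<in>Mor C Y Z.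
        Fm X Z (Cmp C X Y Z g f) = Cmp D (Fo X) (Fo Y) (Fo Z) (Fm Y Z g) (Fm X Y f))"

definition is_iso :: "('o, 'a) cat \<Rightarrow> 'o \<Rightarrow> 'o \<Rightarrow> 'a \<Rightarrow> bool" where
  "is_iso C X Y f \<longleftrightarrow> f \<in> Mor C X Y \<and>
     (\<exists>g\<in>Mor C Y X. Cmp C X Y X g f = Idn C X \<and> Cmp C Y X Y f g = Idn C Y)"

definition naturally_isomorphic ::
  "('o, 'a) cat \<Rightarrow> ('p, 'b) cat \<Rightarrow> ('o \<Rightarrow> 'p) \<Rightarrow> ('o \<Rightarrow> 'o \<Rightarrow> 'a \<Rightarrow> 'b)
     \<Rightarrow> ('o \<Rightarrow> 'p) \<Rightarrow> ('o \<Rightarrow> 'o \<Rightarrow> 'a \<Rightarrow> 'b) \<Rightarrow> bool" where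
  "naturally_isomorphic C D Fo Fm Ho Hm \<longleftrightarrow>
     (\<exists>\<eta>. (\<forall>X\<in>Ob C. is_iso D (Fo X) (Ho X) (\<eta> X)) \<and>
          (\<forall>X\<in>Ob C. \<forall>Y\<in>Ob C. \<forall>f\<in>Mor C X Y.
             Cmp D (Fo X) (Fo Y) (Ho Y) (\<eta> Y) (Fm X Y f) =
             Cmp D (Fo X) (Ho X) (Ho Y) (Hm X Y f) (\<eta> X)))"

definition is_equivalence ::
  "('o, 'a) cat \<Rightarrow> ('p, 'b) cat \<Rightarrow> ('o \<Rightarrow> 'p) \<Rightarrow> ('o \<Rightarrow> 'o \<Rightarrow> 'a \<Rightarrow> 'b) \<Rightarrow> bool" where
  "is_equivalence C D Fo Fm \<longleftrightarrow>
     is_functor C D Fo Fm \<and>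
     (\<exists>Ho Hm. is_functor D C Ho Hm \<and>
        naturally_isomorphic C C (\<lambda>X. X) (\<lambda>X Y f. f)
          (\<lambda>X. Ho (Fo X)) (\<lambda>X Y f. Hm (Fo X) (Fo Y) (Fm X Y f)) \<and>
        naturally_isomorphic D D (\<lambda>X. Fo (Ho X)) (\<lambda>X Y f. Fm (Ho X) (Ho Y) (Hm X Y f))
          (\<lambda>X. X) (\<lambda>X Y f. f))"

section \<open>Complex vector spaces and tensor products\<close>

definition complex_ring :: "complex ring" where
  "complex_ring = \<lparr>carrier = UNIV, mult = (*), one = 1, zero = 0, add = (+)\<rparr>"

abbreviation cvector_space :: "(complex, 'u, 'm) module_scheme \<Rightarrow> bool" where
  "cvector_space V \<equiv> Module.module complex_ring V"

definition clinear_on ::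
  "(complex, 'u, 'm) module_scheme \<Rightarrow> (complex, 'w, 'n) module_scheme \<Rightarrow> ('u \<Rightarrow> 'w) \<Rightarrow> bool" where
  "clinear_on V W f \<longleftrightarrow>
     f \<in> carrier V \<rightarrow> carrier W \<and>
     (\<forall>x\<in>carrier V. \<forall>y\<in>carrier V. f (x \<oplus>\<^bsub>V\<^esub> y) = f x \<oplus>\<^bsub>W\<^esub> f y) \<and>
     (\<forall>c. \<forall>x\<in>carrier V. f (c \<odot>\<^bsub>V\<^esub> x) = c \<odot>\<^bsub>W\<^esub> f x)"

text \<open>Morphisms are taken \<^const>\<open>extensional\<close>, so that equality of functions is equality of maps
  on the carrier.\<close>

definition linear_maps ::
  "(complex, 'u, 'm) module_scheme \<Rightarrow> (complex, 'w, 'n) module_scheme \<Rightarrow> ('u \<Rightarrow> 'w) set" where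
  "linear_maps V W = {f \<in> extensional (carrier V). clinear_on V W f}"

definition Vec :: "((complex, 'u) module, 'u \<Rightarrow> 'u) cat" where
  "Vec = \<lparr>Ob = {V. cvector_space V}, Mor = linear_maps,
          Idn = (\<lambda>V. \<lambda>x\<in>carrier V. x), Cmp = (\<lambda>U V W g f. compose (carrier U) g f)\<rparr>"

definition finite_dimensional :: "(complex, 'u, 'm) module_scheme \<Rightarrow> 'u set \<Rightarrow> bool" where
  "finite_dimensional V S \<longleftrightarrow>
     (\<exists>B. finite B \<and> B \<subseteq> S \<and> (\<forall>x\<in>S. \<exists>c. x = (\<Oplus>\<^bsub>V\<^esub>b\<in>B. c b \<odot>\<^bsub>V\<^esub> b)))"

definition bilinear_on ::
  "(complex, 'u, 'm) module_scheme \<Rightarrow> (complex, 'u, 'n) module_scheme \<Rightarrow>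
   (complex, 'u, 'k) module_scheme \<Rightarrow> ('u \<Rightarrow> 'u \<Rightarrow> 'u) \<Rightarrow> bool" where
  "bilinear_on V W X b \<longleftrightarrow>
     (\<forall>v\<in>carrier V. clinear_on W X (b v)) \<and>
     (\<forall>w\<in>carrier W. clinear_on V X (\<lambda>v. b v w))"

text \<open>The universal property of the tensor product. Everything lives in one universe: the vector
  spaces whose carrier is a set of elements of the type \<open>'u\<close>.\<close>

definition is_tensor_product ::
  "(complex, 'u, 'm) module_scheme \<Rightarrow> (complex, 'u, 'n) module_scheme \<Rightarrow>
   (complex, 'u) module \<Rightarrow> ('u \<Rightarrow> 'u \<Rightarrow> 'u) \<Rightarrow> bool" where
  "is_tensor_product V W P t \<longleftrightarrow>
     cvector_space P \<and> bilinear_on V W P t \<and>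
     (\<forall>X :: (complex, 'u) module. \<forall>b. cvector_space X \<and> bilinear_on V W X b \<longrightarrow>
        (\<exists>!h. h \<in> linear_maps P X \<and>
              (\<forall>v\<in>carrier V. \<forall>w\<in>carrier W. h (t v w) = b v w)))"

text \<open>A fixed choice of tensor product. It exists within \<open>'u\<close>: if either factor is zero, the zero
  space will do; otherwise \<open>'u\<close> is at least as large as the complex numbers, and the
  tensor product of two spaces with carriers in \<open>'u\<close> is no larger than \<open>'u\<close>.\<close>

definition tensor_choice ::
  "(complex, 'u, 'm) module_scheme \<Rightarrow> (complex, 'u, 'n) module_scheme \<Rightarrow>
   (complex, 'u) module \<times> ('u \<Rightarrow> 'u \<Rightarrow> 'u)" where
  "tensor_choice V W = (SOME Pt. is_tensor_product V W (fst Pt) (snd Pt))"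

definition tensor_space ::
  "(complex, 'u, 'm) module_scheme \<Rightarrow> (complex, 'u, 'n) module_scheme \<Rightarrow> (complex, 'u) module" where
  "tensor_space V W = fst (tensor_choice V W)"

definition pure_tensor ::
  "(complex, 'u, 'm) module_scheme \<Rightarrow> (complex, 'u, 'n) module_scheme \<Rightarrow> 'u \<Rightarrow> 'u \<Rightarrow> 'u" where
  "pure_tensor V W = snd (tensor_choice V W)"

text \<open>The map \<open>f \<otimes> g : V \<otimes> W \<rightarrow> V' \<otimes> W'\<close>.\<close>

definition tensor_map ::
  "(complex, 'u, 'm) module_scheme \<Rightarrow> (complex, 'u, 'n) module_scheme \<Rightarrow>
   (complex, 'u, 'm) module_scheme \<Rightarrow> (complex, 'u, 'n) module_scheme \<Rightarrow>
   ('u \<Rightarrow> 'u) \<Rightarrow> ('u \<Rightarrow> 'u) \<Rightarrow> 'u \<Rightarrow> 'u" where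
  "tensor_map V W V' W' f g =
     (THE h. h \<in> linear_maps (tensor_space V W) (tensor_space V' W') \<and>
        (\<forall>v\<in>carrier V. \<forall>w\<in>carrier W.
           h (pure_tensor V W v w) = pure_tensor V' W' (f v) (g w)))"

section \<open>The groups\<close>

definition topological_group :: "('g, 'b) monoid_scheme \<Rightarrow> 'g topology \<Rightarrow> bool" where
  "topological_group G T \<longleftrightarrow>
     group G \<and> topspace T = carrier G \<and>
     continuous_map (prod_topology T T) T (\<lambda>(x, y). x \<otimes>\<^bsub>G\<^esub> y) \<and>
     continuous_map T T (\<lambda>x. inv\<^bsub>G\<^esub> x)"

definition totally_disconnected_space :: "'g topology \<Rightarrow> bool" where
  "totally_disconnected_space T \<longleftrightarrow> (\<forall>x\<in>topspace T. connected_component_of_set T x = {x})"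

definition l_group :: "('g, 'b) monoid_scheme \<Rightarrow> 'g topology \<Rightarrow> bool" where
  "l_group G T \<longleftrightarrow> topological_group G T \<and>
     Hausdorff_space T \<and> locally_compact_space T \<and> totally_disconnected_space T"

definition compact_open_subgroup :: "('g, 'b) monoid_scheme \<Rightarrow> 'g topology \<Rightarrow> 'g set \<Rightarrow> bool" where
  "compact_open_subgroup G T K \<longleftrightarrow> subgroup K G \<and> compactin T K \<and> openin T K"

definition lc_group :: "('g, 'b) monoid_scheme \<Rightarrow> 'g topology \<Rightarrow> bool" where
  "lc_group G T \<longleftrightarrow> l_group G T \<and>
     (\<forall>g\<in>carrier G. \<exists>K. compact_open_subgroup G T K \<and> g \<in> K) \<and>
     (\<forall>K L. compact_open_subgroup G T K \<and> compact_open_subgroup G T L \<longrightarrow>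
        (\<exists>N. compact_open_subgroup G T N \<and> K \<subseteq> N \<and> L \<subseteq> N))"

section \<open>Representations\<close>

record ('g, 'u) rep = "(complex, 'u) module" +
  act :: "'g \<Rightarrow> 'u \<Rightarrow> 'u"

definition representation :: "('g, 'b) monoid_scheme \<Rightarrow> ('g, 'u) rep \<Rightarrow> bool" where
  "representation G M \<longleftrightarrow>
     cvector_space M \<and>
     (\<forall>g\<in>carrier G. clinear_on M M (act M g)) \<and>
     (\<forall>x\<in>carrier M. act M \<one>\<^bsub>G\<^esub> x = x) \<and>
     (\<forall>g\<in>carrier G. \<forall>h\<in>carrier G. \<forall>x\<in>carrier M. act M (g \<otimes>\<^bsub>G\<^esub> h) x = act M g (act M h x))"

definition smooth_rep :: "('g, 'b) monoid_scheme \<Rightarrow> 'g topology \<Rightarrow> ('g, 'u) rep \<Rightarrow> bool" where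
  "smooth_rep G T M \<longleftrightarrow> representation G M \<and>
     (\<forall>x\<in>carrier M. openin T {g \<in> carrier G. act M g x = x})"

definition invariants :: "('g, 'u) rep \<Rightarrow> 'g set \<Rightarrow> 'u set" where
  "invariants M K = {x \<in> carrier M. \<forall>k\<in>K. act M k x = x}"

definition admissible_rep :: "('g, 'b) monoid_scheme \<Rightarrow> 'g topology \<Rightarrow> ('g, 'u) rep \<Rightarrow> bool" where
  "admissible_rep G T M \<longleftrightarrow> smooth_rep G T M \<and>
     (\<forall>K. compact_open_subgroup G T K \<longrightarrow> finite_dimensional M (invariants M K))"

definition irreducible_rep :: "('g, 'b) monoid_scheme \<Rightarrow> ('g, 'u) rep \<Rightarrow> bool" where
  "irreducible_rep G M \<longleftrightarrow> representation G M \<and> carrier M \<noteq> {\<zero>\<^bsub>M\<^esub>} \<and>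
     (\<forall>N. submodule N complex_ring M \<and> (\<forall>g\<in>carrier G. \<forall>x\<in>N. act M g x \<in> N) \<longrightarrow>
        N = {\<zero>\<^bsub>M\<^esub>} \<or> N = carrier M)"

definition intertwiners ::
  "('g, 'b) monoid_scheme \<Rightarrow> ('g, 'u) rep \<Rightarrow> ('g, 'w) rep \<Rightarrow> ('u \<Rightarrow> 'w) set" where
  "intertwiners G M N =
     {f \<in> linear_maps M N. \<forall>g\<in>carrier G. \<forall>x\<in>carrier M. f (act M g x) = act N g (f x)}"

text \<open>\<open>\<R>(G)\<close>, restricted to the universe \<open>'u\<close>.\<close>

definition Rep :: "('g, 'b) monoid_scheme \<Rightarrow> 'g topology \<Rightarrow> (('g, 'u) rep, 'u \<Rightarrow> 'u) cat" where
  "Rep G T = \<lparr>Ob = {M. smooth_rep G T M}, Mor = intertwiners G,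
              Idn = (\<lambda>M. \<lambda>x\<in>carrier M. x), Cmp = (\<lambda>L M N g f. compose (carrier L) g f)\<rparr>"

definition irreps :: "('g, 'b) monoid_scheme \<Rightarrow> 'g topology \<Rightarrow> ('g, 'u) rep set" where
  "irreps G T = {\<sigma>. smooth_rep G T \<sigma> \<and> irreducible_rep G \<sigma>}"

definition rep_isomorphic ::
  "('g, 'b) monoid_scheme \<Rightarrow> ('g, 'u) rep \<Rightarrow> ('g, 'w) rep \<Rightarrow> bool" where
  "rep_isomorphic G M N \<longleftrightarrow> (\<exists>f\<in>intertwiners G M N. bij_betw f (carrier M) (carrier N))"

definition rep_class ::
  "('g, 'b) monoid_scheme \<Rightarrow> 'g topology \<Rightarrow> ('g, 'u) rep \<Rightarrow> ('g, 'u) rep set" where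
  "rep_class G T \<sigma> = {\<tau> \<in> irreps G T. rep_isomorphic G \<sigma> \<tau>}"

text \<open>The set of isomorphism classes of irreducible smooth representations (with carrier in
  \<open>'u\<close>).\<close>

definition dual :: "('g, 'b) monoid_scheme \<Rightarrow> 'g topology \<Rightarrow> ('g, 'u) rep set set" where
  "dual G T = rep_class G T ` irreps G T"

text \<open>For supports the restriction to the universe \<open>'u\<close> is immaterial: an irreducible \<open>\<sigma>\<close> with a
  nonzero map from \<open>M\<close> is a quotient of \<open>M\<close>, hence isomorphic to a representation whose carrier
  is a set of coset representatives in \<open>M\<close>.\<close>

definition Supp ::
  "('g, 'b) monoid_scheme \<Rightarrow> 'g topology \<Rightarrow> ('g, 'u) rep \<Rightarrow> ('g, 'u) rep set set" where
  "Supp G T M = {c \<in> dual G T. \<exists>\<sigma>\<in>c. \<exists>f\<in>intertwiners G M \<sigma>. \<exists>x\<in>carrier M. f x \<noteq> \<zero>\<^bsub>\<sigma>\<^esub>}"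

text \<open>As a hypothesis, tameness tested only on representations with carrier in \<open>'u\<close> is implied by
  (and, for large \<open>'u\<close>, equivalent to) tameness tested on all of them.\<close>

definition tame :: "'u itself \<Rightarrow> ('g, 'b) monoid_scheme \<Rightarrow> 'g topology \<Rightarrow> bool" where
  "tame U G T \<longleftrightarrow> (\<forall>\<sigma> \<in> (irreps G T :: ('g, 'u) rep set). admissible_rep G T \<sigma>)"

section \<open>The functor \<open>V \<mapsto> V\<^sub>G \<otimes> \<pi>\<close>\<close>

definition with_action :: "(complex, 'u) module \<Rightarrow> ('g \<Rightarrow> 'u \<Rightarrow> 'u) \<Rightarrow> ('g, 'u) rep" where
  "with_action V \<rho> = module.extend V (rep.fields \<rho>)"

definition trivial_rep :: "(complex, 'u) module \<Rightarrow> ('g, 'u) rep" where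
  "trivial_rep V = with_action V (\<lambda>g x. x)"

definition tensor_rep :: "('g, 'u) rep \<Rightarrow> ('g, 'u) rep \<Rightarrow> ('g, 'u) rep" where
  "tensor_rep M N =
     with_action (tensor_space M N) (\<lambda>g. tensor_map M N M N (act M g) (act N g))"

definition isotypic_obj :: "('g, 'u) rep \<Rightarrow> (complex, 'u) module \<Rightarrow> ('g, 'u) rep" where
  "isotypic_obj \<pi> V = tensor_rep (trivial_rep V) \<pi>"

definition isotypic_mor ::
  "('g, 'u) rep \<Rightarrow> (complex, 'u) module \<Rightarrow> (complex, 'u) module \<Rightarrow> ('u \<Rightarrow> 'u) \<Rightarrow> 'u \<Rightarrow> 'u" where
  "isotypic_mor \<pi> V W f =
     tensor_map (trivial_rep V :: ('g, 'u) rep) \<pi> (trivial_rep W :: ('g, 'u) rep) \<pi> f (\<lambda>x. x)"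

definition Rep_supp ::
  "('g, 'b) monoid_scheme \<Rightarrow> 'g topology \<Rightarrow> ('g, 'u) rep set \<Rightarrow> (('g, 'u) rep, 'u \<Rightarrow> 'u) cat" where
  "Rep_supp G T c = full_subcategory (Rep G T) (\<lambda>M. Supp G T M \<subseteq> {c})"

end

theory Submission
  imports Defs "HOL-Computational_Algebra.Fundamental_Theorem_Algebra"
begin

text \<open>
  The heart of the matter is that tameness makes irreducible representations behave like injective
  objects: every nonzero vector \<open>z\<close> of a smooth \<open>M\<close> survives in some irreducible quotient. By Zorn one
  may assume that \<open>z\<close> lies in every nonzero subrepresentation; then \<open>S = \<langle>z\<rangle>\<close> is irreducible, and one
  has to show \<open>M = S\<close>. Let \<open>x \<in> M\<^sup>K\<close>. If \<open>a\<close> in the group algebra kills \<open>S\<^sup>K\<close> but not \<open>x\<close>, then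
  \<open>z = b a x\<close> for some \<open>b\<close>; as \<open>G\<close> is a filtered union of compact open subgroups, \<open>a\<close>, \<open>b\<close> and \<open>K\<close> live in
  one of them, and averaging a linear projection onto \<open>S\<close> over it gives \<open>z = b a q(x) = 0\<close>. So the
  annihilator of \<open>S\<^sup>K\<close> kills \<open>x\<close>, and since \<open>S\<^sup>K\<close> is finite-dimensional (tameness), the density theorem
  writes \<open>x\<close> as a sum of images of vectors of \<open>S\<^sup>K\<close> under homomorphisms \<open>S \<rightarrow> M\<close>.

  If \<open>M\<close> is supported at \<open>\<pi>\<close>, its irreducible quotients are all isomorphic to \<open>\<pi>\<close>, so the annihilator of
  \<open>\<pi>\<^sup>K\<close> kills \<open>M\<^sup>K\<close> and \<open>M\<close> is, again by density, the sum of the images of all homomorphisms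
  \<open>\<pi> \<rightarrow> M\<close>. Since \<open>End \<pi>\<close> consists of scalars (Schur), evaluation \<open>Hom(\<pi>, M) \<otimes> \<pi> \<rightarrow> M\<close> is an isomorphism.
  To stay inside the universe \<open>'u\<close>, \<open>Hom(\<pi>, M)\<close> is realised as the space of all \<open>\<theta> v0 \<in> M\<close> for a fixed
  nonzero \<open>v0 \<in> \<pi>\<close>.
\<close>

section \<open>Complex vector spaces\<close>

text \<open>The obstacle is that \<open>S\<close> need not visibly be a direct summand of
  \<open>M\<close> over \<open>G\<close>: each compact open subgroup \<open>L\<close> admits an
  equivariant projection, but the projections for different \<open>L\<close> need not be compatible.
  So the argument may use only one \<open>L\<close> at a time, and the equation
  \<open>z = b a x\<close> is suited to this because it involves finitely many group elements. For
  this reason the group algebra is a type of finite expressions. Averaging over \<open>L\<close> is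
  a finite sum and not an integral, since the \<open>L\<close>-orbit of \<open>x\<close> is finite;
  the resulting projection is adapted to this one \<open>x\<close>.

  Tameness has a second use: an endomorphism of \<pi> preserves the finite-dimensional space
  \<open>\<pi>^K\<close> and therefore has an eigenvector, which yields Schur's lemma in place of
  the usual countability argument. Density and Schur's lemma together separate linearly independent
  vectors of \<pi>. Applied to the second factors of a sum of pure tensors, this gives both fullness
  of the functor and injectivity of evaluation, without choosing bases.\<close>

lemma complex_ring_simps [simp]:
  "carrier complex_ring = UNIV" "\<zero>\<^bsub>complex_ring\<^esub> = 0" "\<one>\<^bsub>complex_ring\<^esub> = 1"
  "x \<oplus>\<^bsub>complex_ring\<^esub> y = x + y" "x \<otimes>\<^bsub>complex_ring\<^esub> y = x * y"
  by (simp_all add: complex_ring_def)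

lemma cring_complex_ring: "cring complex_ring"
proof (rule cringI)
  show "abelian_group complex_ring"
  proof (rule abelian_groupI)
    fix x assume "x \<in> carrier complex_ring"
    show "\<exists>y\<in>carrier complex_ring. y \<oplus>\<^bsub>complex_ring\<^esub> x = \<zero>\<^bsub>complex_ring\<^esub>"
      by (rule bexI[of _ "- x"]) auto
  qed auto
  show "comm_monoid complex_ring"
    by (rule comm_monoidI) auto
qed (auto simp: algebra_simps)

lemma complex_ring_minus [simp]: "\<ominus>\<^bsub>complex_ring\<^esub> x = - x"
proof -
  interpret cring complex_ring by (rule cring_complex_ring)
  show ?thesis by (rule minus_equality) auto
qed

lemma cvector_spaceI:
  assumes "abelian_group V"
    and "\<And>a x. x \<in> carrier V \<Longrightarrow> a \<odot>\<^bsub>V\<^esub> x \<in> carrier V"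
    and "\<And>a b x. x \<in> carrier V \<Longrightarrow> (a + b) \<odot>\<^bsub>V\<^esub> x = a \<odot>\<^bsub>V\<^esub> x \<oplus>\<^bsub>V\<^esub> b \<odot>\<^bsub>V\<^esub> x"
    and "\<And>a x y. x \<in> carrier V \<Longrightarrow> y \<in> carrier V \<Longrightarrow> a \<odot>\<^bsub>V\<^esub> (x \<oplus>\<^bsub>V\<^esub> y) = a \<odot>\<^bsub>V\<^esub> x \<oplus>\<^bsub>V\<^esub> a \<odot>\<^bsub>V\<^esub> y"
    and "\<And>a b x. x \<in> carrier V \<Longrightarrow> (a * b) \<odot>\<^bsub>V\<^esub> x = a \<odot>\<^bsub>V\<^esub> (b \<odot>\<^bsub>V\<^esub> x)"
    and "\<And>x. x \<in> carrier V \<Longrightarrow> 1 \<odot>\<^bsub>V\<^esub> x = x"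
  shows "cvector_space V"
  using assms by (intro moduleI cring_complex_ring) auto

text \<open>Specialises \<open>Module.module\<close> to the scalars \<open>complex_ring\<close>:
  since its carrier is \<open>UNIV\<close>, the membership premises on scalars disappear and zero,
  one and minus one become ordinary complex numbers.\<close>

locale cspace =
  fixes V :: "(complex, 'u, 'm) module_scheme" (structure)
  assumes cvector_space: "cvector_space V"

sublocale cspace \<subseteq> module complex_ring V
  by (rule cvector_space)

context cspace
begin

lemma csmult_closed [simp, intro]: "x \<in> carrier V \<Longrightarrow> c \<odot> x \<in> carrier V"
  using smult_closed by simp

lemma csmult_simps [simp]:
  "x \<in> carrier V \<Longrightarrow> 0 \<odot> x = \<zero>\<^bsub>V\<^esub>" "c \<odot> \<zero>\<^bsub>V\<^esub> = \<zero>\<^bsub>V\<^esub>" "x \<in> carrier V \<Longrightarrow> 1 \<odot> x = x"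
  using smult_l_null smult_r_null smult_one by auto

lemma csmult_add_left: "x \<in> carrier V \<Longrightarrow> (c + d) \<odot> x = c \<odot> x \<oplus>\<^bsub>V\<^esub> d \<odot> x"
  using smult_l_distr by simp

lemma csmult_add_right:
  "x \<in> carrier V \<Longrightarrow> y \<in> carrier V \<Longrightarrow> c \<odot> (x \<oplus>\<^bsub>V\<^esub> y) = c \<odot> x \<oplus>\<^bsub>V\<^esub> c \<odot> y"
  using smult_r_distr by simp

lemma csmult_assoc: "x \<in> carrier V \<Longrightarrow> c \<odot> (d \<odot> x) = (c * d) \<odot> x"
  using smult_assoc1 by simp

lemma csmult_minus_one: "x \<in> carrier V \<Longrightarrow> (- 1) \<odot> x = \<ominus>\<^bsub>V\<^esub> x"
  using smult_l_minus[of 1 x] by simp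

lemma csmult_eq_zero:
  assumes "x \<in> carrier V" "c \<odot> x = \<zero>\<^bsub>V\<^esub>" "c \<noteq> 0" shows "x = \<zero>\<^bsub>V\<^esub>"
  using csmult_assoc[of x "inverse c" c] assms by simp

lemma add_minus_cancel: "x \<in> carrier V \<Longrightarrow> y \<in> carrier V \<Longrightarrow> (x \<oplus>\<^bsub>V\<^esub> (- 1) \<odot> y) \<oplus>\<^bsub>V\<^esub> y = x"
  by (simp add: csmult_minus_one M.a_assoc M.l_neg)

lemma add_minus_self [simp]: "x \<in> carrier V \<Longrightarrow> x \<oplus>\<^bsub>V\<^esub> (- 1) \<odot> x = \<zero>\<^bsub>V\<^esub>"
  by (simp add: csmult_minus_one M.r_neg)

lemma add_minus_eq_zero: "x \<in> carrier V \<Longrightarrow> y \<in> carrier V \<Longrightarrow> x \<oplus>\<^bsub>V\<^esub> (- 1) \<odot> y = \<zero>\<^bsub>V\<^esub> \<Longrightarrow> x = y"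
  using add_minus_cancel[of x y] by simp

end

text \<open>Closure under negation is left to scaling by \<open>- 1\<close>.\<close>

definition csubspace :: "(complex, 'u, 'm) module_scheme \<Rightarrow> 'u set \<Rightarrow> bool" where
  "csubspace V Q \<longleftrightarrow> Q \<subseteq> carrier V \<and> \<zero>\<^bsub>V\<^esub> \<in> Q \<and>
     (\<forall>x\<in>Q. \<forall>y\<in>Q. x \<oplus>\<^bsub>V\<^esub> y \<in> Q) \<and> (\<forall>c. \<forall>x\<in>Q. c \<odot>\<^bsub>V\<^esub> x \<in> Q)"

lemma csubspaceI:
  assumes "Q \<subseteq> carrier V" "\<zero>\<^bsub>V\<^esub> \<in> Q" "\<And>x y. x \<in> Q \<Longrightarrow> y \<in> Q \<Longrightarrow> x \<oplus>\<^bsub>V\<^esub> y \<in> Q"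
    "\<And>c x. x \<in> Q \<Longrightarrow> c \<odot>\<^bsub>V\<^esub> x \<in> Q"
  shows "csubspace V Q"
  using assms by (auto simp: csubspace_def)

lemma csubspaceD:
  assumes "csubspace V Q"
  shows "Q \<subseteq> carrier V" "\<zero>\<^bsub>V\<^esub> \<in> Q" "\<And>x y. x \<in> Q \<Longrightarrow> y \<in> Q \<Longrightarrow> x \<oplus>\<^bsub>V\<^esub> y \<in> Q"
    "\<And>c x. x \<in> Q \<Longrightarrow> c \<odot>\<^bsub>V\<^esub> x \<in> Q" "\<And>x. x \<in> Q \<Longrightarrow> x \<in> carrier V"
  using assms by (auto simp: csubspace_def)

lemma (in cspace) submodule_iff_csubspace: "submodule Q complex_ring V \<longleftrightarrow> csubspace V Q"
proof
  assume Q: "submodule Q complex_ring V"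
  note Q = submoduleE[OF Q]
  have "\<zero>\<^bsub>V\<^esub> \<in> Q"
  proof -
    obtain x where "x \<in> Q" using Q(2) by blast
    then show ?thesis using Q(1) Q(4)[of 0 x] csmult_simps(1)[of x] by auto
  qed
  then show "csubspace V Q" using Q by (intro csubspaceI) auto
next
  assume Q: "csubspace V Q"
  note Q = csubspaceD[OF Q]
  show "submodule Q complex_ring V"
  proof (rule submoduleI)
    fix x assume "x \<in> Q"
    then show "\<ominus>\<^bsub>V\<^esub> x \<in> Q" using Q(4)[of x "- 1"] Q(5) csmult_minus_one by simp
  qed (use Q in auto)
qed

lemma (in cspace) cvector_space_csubspace:
  assumes "csubspace V Q" shows "cvector_space (V\<lparr>carrier := Q\<rparr>)"
  using assms submodule.submodule_is_module[OF _ cvector_space] submodule_iff_csubspace by blast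

lemma clinear_onI:
  assumes "\<And>x. x \<in> carrier V \<Longrightarrow> f x \<in> carrier W"
    "\<And>x y. x \<in> carrier V \<Longrightarrow> y \<in> carrier V \<Longrightarrow> f (x \<oplus>\<^bsub>V\<^esub> y) = f x \<oplus>\<^bsub>W\<^esub> f y"
    "\<And>c x. x \<in> carrier V \<Longrightarrow> f (c \<odot>\<^bsub>V\<^esub> x) = c \<odot>\<^bsub>W\<^esub> f x"
  shows "clinear_on V W f"
  using assms by (auto simp: clinear_on_def)

lemma clinear_onD:
  assumes "clinear_on V W f"
  shows "\<And>x. x \<in> carrier V \<Longrightarrow> f x \<in> carrier W"
    "\<And>x y. x \<in> carrier V \<Longrightarrow> y \<in> carrier V \<Longrightarrow> f (x \<oplus>\<^bsub>V\<^esub> y) = f x \<oplus>\<^bsub>W\<^esub> f y"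
    "\<And>c x. x \<in> carrier V \<Longrightarrow> f (c \<odot>\<^bsub>V\<^esub> x) = c \<odot>\<^bsub>W\<^esub> f x"
  using assms by (auto simp: clinear_on_def)

lemma clinear_on_zero:
  assumes "cvector_space V" "cvector_space W" "clinear_on V W f"
  shows "f \<zero>\<^bsub>V\<^esub> = \<zero>\<^bsub>W\<^esub>"
proof -
  interpret V: cspace V by (rule cspace.intro) fact
  interpret W: cspace W by (rule cspace.intro) fact
  have "f (0 \<odot>\<^bsub>V\<^esub> \<zero>\<^bsub>V\<^esub>) = 0 \<odot>\<^bsub>W\<^esub> f \<zero>\<^bsub>V\<^esub>"
    using clinear_onD(3)[OF assms(3)] by blast
  then show ?thesis using clinear_onD(1)[OF assms(3)] by simp
qed

lemma clinear_on_inj: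
  assumes "cvector_space V" "cvector_space W" "clinear_on V W f"
    "\<And>x. x \<in> carrier V \<Longrightarrow> f x = \<zero>\<^bsub>W\<^esub> \<Longrightarrow> x = \<zero>\<^bsub>V\<^esub>"
  shows "inj_on f (carrier V)"
proof (rule inj_onI)
  interpret V: cspace V by (rule cspace.intro) fact
  interpret W: cspace W by (rule cspace.intro) fact
  fix x y assume xy: "x \<in> carrier V" "y \<in> carrier V" "f x = f y"
  have "f (x \<oplus>\<^bsub>V\<^esub> (- 1) \<odot>\<^bsub>V\<^esub> y) = f x \<oplus>\<^bsub>W\<^esub> (- 1) \<odot>\<^bsub>W\<^esub> f y"
    using xy clinear_onD[OF assms(3)] by simp
  also have "\<dots> = \<zero>\<^bsub>W\<^esub>" using xy clinear_onD(1)[OF assms(3)] by simp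
  finally show "x = y" using assms(4) xy V.add_minus_eq_zero by simp
qed

text \<open>Adjoining one vector: this serves the Zorn argument for complements as well as the
  recursion in \<open>lspan\<close>.\<close>

lemma (in cspace) subspace_line_sum:
  assumes C: "csubspace V C" and x: "x \<in> carrier V"
  shows "csubspace V {y \<oplus> c \<odot> x | y c. y \<in> C}" (is "csubspace V ?D")
proof (rule csubspaceI)
  note C = csubspaceD[OF C]
  show "?D \<subseteq> carrier V" using C x by auto
  have "\<zero> = \<zero> \<oplus> 0 \<odot> x" using x by simp
  then show "\<zero> \<in> ?D" using C(2) by blast
  fix a b assume "a \<in> ?D" "b \<in> ?D"
  then obtain y c z d where *: "a = y \<oplus> c \<odot> x" "y \<in> C" "b = z \<oplus> d \<odot> x" "z \<in> C" by blast
  have "a \<oplus> b = (y \<oplus> z) \<oplus> (c + d) \<odot> x"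
    using * C(5) x by (simp add: csmult_add_left M.a_ac)
  then show "a \<oplus> b \<in> ?D" using C(3) * by blast
next
  note C = csubspaceD[OF C]
  fix e a assume "a \<in> ?D"
  then obtain y c where *: "a = y \<oplus> c \<odot> x" "y \<in> C" by blast
  have "e \<odot> a = e \<odot> y \<oplus> (e * c) \<odot> x"
    using * C(5) x by (simp add: csmult_add_right csmult_assoc)
  then show "e \<odot> a \<in> ?D" using C(4) * by blast
qed

lemma (in cspace) csubspace_Union_chain:
  assumes "\<C> \<noteq> {}" "\<And>C. C \<in> \<C> \<Longrightarrow> csubspace V C"
    "\<And>C D. C \<in> \<C> \<Longrightarrow> D \<in> \<C> \<Longrightarrow> C \<subseteq> D \<or> D \<subseteq> C"
  shows "csubspace V (\<Union>\<C>)"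
proof (rule csubspaceI)
  fix x y assume "x \<in> \<Union>\<C>" "y \<in> \<Union>\<C>"
  then obtain C D where "x \<in> C" "C \<in> \<C>" "y \<in> D" "D \<in> \<C>" by blast
  then show "x \<oplus> y \<in> \<Union>\<C>"
    using assms(2,3)[of C] assms(2,3)[of D] csubspaceD(3)[of V C x y] csubspaceD(3)[of V D x y] by blast
next
  show "\<Union>\<C> \<subseteq> carrier V" using assms(2) csubspaceD(1)[of V] by blast
  show "\<zero> \<in> \<Union>\<C>" using assms(1,2) csubspaceD(2)[of V] by blast
  show "c \<odot> x \<in> \<Union>\<C>" if "x \<in> \<Union>\<C>" for c x using that assms(2) csubspaceD(4)[of V] by blast
qed

text \<open>By Zorn there is a maximal subspace \<open>C\<close> meeting \<open>Q\<close> only in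
  zero. For \<open>x\<close> outside \<open>C + Q\<close> the sum of \<open>C\<close> and the line
  of \<open>x\<close> would again meet \<open>Q\<close> only in zero.\<close>

lemma (in cspace) subspace_complement:
  assumes Q: "csubspace V Q"
  obtains C where "csubspace V C" "C \<inter> Q = {\<zero>}" "\<And>x. x \<in> carrier V \<Longrightarrow> \<exists>y\<in>C. \<exists>z\<in>Q. x = y \<oplus> z"
proof -
  note Q = csubspaceD[OF Q]
  let ?A = "{C. csubspace V C \<and> C \<inter> Q = {\<zero>}}"
  have max: "\<exists>C\<in>?A. \<forall>X\<in>?A. C \<subseteq> X \<longrightarrow> X = C"
  proof (rule subset_Zorn_nonempty)
    have "{\<zero>} \<in> ?A" using Q by (auto intro!: csubspaceI)
    then show "?A \<noteq> {}" by blast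
    fix \<C> assume \<C>: "\<C> \<noteq> {}" "subset.chain ?A \<C>"
    then have *: "csubspace V C" "C \<inter> Q = {\<zero>}" if "C \<in> \<C>" for C
      using that by (auto simp: subset_chain_def)
    have "csubspace V (\<Union>\<C>)"
      using \<C> * by (intro csubspace_Union_chain) (auto simp: subset_chain_def)
    then show "\<Union>\<C> \<in> ?A" using \<C>(1) * by fastforce
  qed
  obtain C where "C \<in> ?A" and max: "\<forall>X\<in>?A. C \<subseteq> X \<longrightarrow> X = C"
    using max by (rule bexE)
  then have C: "csubspace V C" "C \<inter> Q = {\<zero>}" by auto
  note C' = csubspaceD[OF C(1)]
  show thesis
  proof (rule that[OF C])
    fix x assume x: "x \<in> carrier V"
    let ?D = "{y \<oplus> c \<odot> x | y c. y \<in> C}"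
    have D: "csubspace V ?D" using C(1) x by (rule subspace_line_sum)
    have sub: "C \<subseteq> ?D"
    proof
      fix y assume "y \<in> C"
      then have "y = y \<oplus> 0 \<odot> x" using x C'(5) by simp
      then show "y \<in> ?D" using \<open>y \<in> C\<close> by blast
    qed
    show "\<exists>y\<in>C. \<exists>z\<in>Q. x = y \<oplus> z"
    proof (cases "?D \<inter> Q = {\<zero>}")
      case True
      then have "?D = C" using bspec[OF max, of ?D] D sub by simp
      moreover have "x = \<zero> \<oplus> 1 \<odot> x" using x by simp
      ultimately have "x \<in> C" using C'(2) by blast
      then show ?thesis using Q(2) x by (intro bexI[of _ x] bexI[of _ \<zero>]) auto
    next
      case False
      then obtain z where "z \<in> ?D" "z \<in> Q" "z \<noteq> \<zero>"
        using csubspaceD(2)[OF D] Q(2) by blast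
      then obtain y c where y: "z = y \<oplus> c \<odot> x" "y \<in> C" by blast
      \<comment> \<open>With \<open>c = 0\<close> the nonzero vector \<open>z\<close> would lie in
        both \<open>C\<close> and \<open>Q\<close>; so \<open>z = y + c x\<close> can be solved for
        \<open>x\<close>.\<close>
      have "c \<noteq> 0"
      proof
        assume "c = 0"
        then have "z = y" using y x C'(5) by simp
        then show False using y \<open>z \<in> Q\<close> \<open>z \<noteq> \<zero>\<close> C(2) by blast
      qed
      have yV: "y \<in> carrier V" using y C' by blast
      have "z \<oplus> (- 1) \<odot> y = \<ominus> y \<oplus> (y \<oplus> c \<odot> x)"
        using y x yV by (simp add: csmult_minus_one M.a_comm)
      also have "\<dots> = c \<odot> x" using x yV by (simp add: M.r_neg1)
      finally have "z \<oplus> (- 1) \<odot> y = c \<odot> x" .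
      then have "inverse c \<odot> (z \<oplus> (- 1) \<odot> y) = x"
        using x \<open>c \<noteq> 0\<close> by (simp add: csmult_assoc)
      then have "x = ((- inverse c) \<odot> y) \<oplus> inverse c \<odot> z"
        using yV \<open>z \<in> Q\<close> Q(5) by (simp add: csmult_add_right csmult_assoc M.a_comm)
      then show ?thesis using C'(4)[OF y(2)] Q(4)[OF \<open>z \<in> Q\<close>] by auto
    qed
  qed
qed

text \<open>The projection along a complement. It is averaged over compact groups, realises
  quotients on a complement, yields linear functionals, and shows that pure tensors
  generate.\<close>

lemma (in cspace) linear_projection:
  assumes Q: "csubspace V Q"
  obtains p where "clinear_on V V p" "\<And>x. x \<in> carrier V \<Longrightarrow> p x \<in> Q" "\<And>x. x \<in> Q \<Longrightarrow> p x = x"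
proof -
  obtain C where C: "csubspace V C" "C \<inter> Q = {\<zero>}"
    and ex: "\<And>x. x \<in> carrier V \<Longrightarrow> \<exists>y\<in>C. \<exists>z\<in>Q. x = y \<oplus> z"
    using subspace_complement[OF Q] by blast
  note Q = csubspaceD[OF Q] and C' = csubspaceD[OF C(1)]
  have uniq: "z = z'" if "y \<in> C" "z \<in> Q" "y' \<in> C" "z' \<in> Q" "y \<oplus> z = y' \<oplus> z'" for y z y' z'
  proof -
    have c: "y \<in> carrier V" "z \<in> carrier V" "y' \<in> carrier V" "z' \<in> carrier V"
      using that Q(5) C'(5) by auto
    have "z = \<ominus> y \<oplus> (y \<oplus> z)" using c by (simp add: M.r_neg1)
    also have "\<dots> = (y' \<oplus> \<ominus> y) \<oplus> z'" using c by (simp add: that(5) M.a_ac)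
    finally have "z \<oplus> \<ominus> z' = (y' \<oplus> \<ominus> y) \<oplus> (z' \<oplus> \<ominus> z')"
      using c by (simp add: M.a_assoc)
    then have *: "z \<oplus> (- 1) \<odot> z' = y' \<oplus> (- 1) \<odot> y"
      using c by (simp add: csmult_minus_one M.r_neg)
    have "z \<oplus> (- 1) \<odot> z' \<in> Q" using Q(3,4) that by simp
    moreover have "y' \<oplus> (- 1) \<odot> y \<in> C" using C'(3,4) that by simp
    ultimately have "z \<oplus> (- 1) \<odot> z' = \<zero>" using * C(2) by auto
    then show ?thesis using c add_minus_eq_zero by blast
  qed
  \<comment> \<open>The \<open>Q\<close>-component is picked by choice; by \<open>uniq\<close> any
    decomposition computes it, and this makes \<open>p\<close> linear.\<close>
  define p where "p x = (SOME z. z \<in> Q \<and> (\<exists>y\<in>C. x = y \<oplus> z))" for x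
  have p: "p x \<in> Q \<and> (\<exists>y\<in>C. x = y \<oplus> p x)" if "x \<in> carrier V" for x
    unfolding p_def by (rule someI_ex) (use ex[OF that] in blast)
  have pI: "p x = z" if "x = y \<oplus> z" "y \<in> C" "z \<in> Q" for x y z
  proof -
    have "x \<in> carrier V" using that Q(5) C'(5) by simp
    then obtain y' where "y' \<in> C" "x = y' \<oplus> p x" "p x \<in> Q" using p by blast
    then show ?thesis using uniq[of y' "p x" y z] that by simp
  qed
  show thesis
  proof (rule that)
    show "p x \<in> Q" if "x \<in> carrier V" for x using p that by blast
    show "p x = x" if "x \<in> Q" for x
      using pI[of x \<zero> x] that C'(2) Q(5) by simp
    show "clinear_on V V p"
    proof (rule clinear_onI)
      show "p x \<in> carrier V" if "x \<in> carrier V" for x using p that Q by blast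
    next
      fix x y assume xy: "x \<in> carrier V" "y \<in> carrier V"
      obtain a b where ab: "a \<in> C" "x = a \<oplus> p x" "b \<in> C" "y = b \<oplus> p y" using p[OF xy(1)] p[OF xy(2)] by blast
      have pc: "p x \<in> carrier V" "p y \<in> carrier V" "a \<in> carrier V" "b \<in> carrier V"
        using p[OF xy(1)] p[OF xy(2)] Q(5) C'(5) ab(1,3) by simp_all
      have "x \<oplus> y = (a \<oplus> p x) \<oplus> (b \<oplus> p y)" by (rule arg_cong2[OF ab(2,4)])
      also have "\<dots> = (a \<oplus> b) \<oplus> (p x \<oplus> p y)" using pc by (simp add: M.a_ac)
      finally show "p (x \<oplus> y) = p x \<oplus> p y"
        by (rule pI[OF _ C'(3)[OF ab(1,3)] Q(3)]) (use p[OF xy(1)] p[OF xy(2)] in auto)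
    next
      fix c x assume x: "x \<in> carrier V"
      obtain a where a: "a \<in> C" "x = a \<oplus> p x" using p[OF x] by blast
      have "c \<odot> x = c \<odot> (a \<oplus> p x)" by (rule arg_cong[OF a(2)])
      also have "\<dots> = c \<odot> a \<oplus> c \<odot> p x"
        using C'(5)[OF a(1)] Q(5) p[OF x] by (intro csmult_add_right) auto
      finally show "p (c \<odot> x) = c \<odot> p x" 
        by (rule pI[OF _ C'(4)[OF a(1)] Q(4)]) (use p[OF x] in auto)
    qed
  qed
qed

section \<open>Representations and the group algebra\<close>

lemma representationI:
  assumes "cvector_space M" "\<And>g. g \<in> carrier G \<Longrightarrow> clinear_on M M (act M g)"
    "\<And>x. x \<in> carrier M \<Longrightarrow> act M \<one>\<^bsub>G\<^esub> x = x"
    "\<And>g h x. g \<in> carrier G \<Longrightarrow> h \<in> carrier G \<Longrightarrow> x \<in> carrier M \<Longrightarrow>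
      act M (g \<otimes>\<^bsub>G\<^esub> h) x = act M g (act M h x)"
  shows "representation G M"
  using assms by (simp add: representation_def)

lemma representationD:
  assumes "representation G M"
  shows "cvector_space M" "\<And>g. g \<in> carrier G \<Longrightarrow> clinear_on M M (act M g)"
    "\<And>x. x \<in> carrier M \<Longrightarrow> act M \<one>\<^bsub>G\<^esub> x = x"
    "\<And>g h x. g \<in> carrier G \<Longrightarrow> h \<in> carrier G \<Longrightarrow> x \<in> carrier M \<Longrightarrow>
      act M (g \<otimes>\<^bsub>G\<^esub> h) x = act M g (act M h x)"
    "\<And>g x. g \<in> carrier G \<Longrightarrow> x \<in> carrier M \<Longrightarrow> act M g x \<in> carrier M"
    "cspace M"
  using assms by (auto simp: representation_def cspace_def clinear_on_def)

lemma smooth_representation: "smooth_rep G T M \<Longrightarrow> representation G M"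
  by (simp add: smooth_rep_def)

section \<open>Subrepresentations and homomorphisms of representations\<close>

definition subrep :: "('g, 'b) monoid_scheme \<Rightarrow> ('g, 'u) rep \<Rightarrow> 'u set \<Rightarrow> bool" where
  "subrep G M Q \<longleftrightarrow> csubspace M Q \<and> (\<forall>g\<in>carrier G. \<forall>x\<in>Q. act M g x \<in> Q)"

lemma subrepD:
  assumes "subrep G M Q"
  shows "csubspace M Q" "\<And>g x. g \<in> carrier G \<Longrightarrow> x \<in> Q \<Longrightarrow> act M g x \<in> Q"
  using assms by (auto simp: subrep_def)

lemma irreducible_rep_iff:
  "irreducible_rep G M \<longleftrightarrow> representation G M \<and> carrier M \<noteq> {\<zero>\<^bsub>M\<^esub>} \<and>
     (\<forall>N. subrep G M N \<longrightarrow> N = {\<zero>\<^bsub>M\<^esub>} \<or> N = carrier M)"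
proof (cases "representation G M")
  case True
  interpret cspace M using True by (rule representationD)
  show ?thesis unfolding irreducible_rep_def subrep_def submodule_iff_csubspace ..
qed (auto simp: irreducible_rep_def)

lemma restrict_rep:
  assumes M: "representation G M" and Q: "subrep G M Q"
  shows "representation G (M\<lparr>carrier := Q\<rparr>)"
proof (rule representationI)
  interpret cspace M using M by (rule representationD)
  note M = representationD[OF M] and Q' = subrepD[OF Q] and Q = csubspaceD[OF subrepD(1)[OF Q]]
  show "cvector_space (M\<lparr>carrier := Q\<rparr>)" by (rule cvector_space_csubspace) fact
  show "clinear_on (M\<lparr>carrier := Q\<rparr>) (M\<lparr>carrier := Q\<rparr>) (act (M\<lparr>carrier := Q\<rparr>) g)"
    if g: "g \<in> carrier G" for g
    by (rule clinear_onI) (use clinear_onD[OF M(2)[OF g]] Q' Q g in auto)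
qed (use representationD[OF M] csubspaceD(5)[OF subrepD(1)[OF Q]] in auto)

lemma restrict_smooth:
  assumes M: "smooth_rep G T M" and Q: "subrep G M Q"
  shows "smooth_rep G T (M\<lparr>carrier := Q\<rparr>)"
  using M restrict_rep[OF smooth_representation[OF M] Q] csubspaceD(5)[OF subrepD(1)[OF Q]]
  by (auto simp: smooth_rep_def)

lemma intertwinersI:
  assumes "\<And>x. x \<in> carrier M \<Longrightarrow> f x \<in> carrier N"
    "\<And>x y. x \<in> carrier M \<Longrightarrow> y \<in> carrier M \<Longrightarrow> f (x \<oplus>\<^bsub>M\<^esub> y) = f x \<oplus>\<^bsub>N\<^esub> f y"
    "\<And>c x. x \<in> carrier M \<Longrightarrow> f (c \<odot>\<^bsub>M\<^esub> x) = c \<odot>\<^bsub>N\<^esub> f x"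
    "f \<in> extensional (carrier M)"
    "\<And>g x. g \<in> carrier G \<Longrightarrow> x \<in> carrier M \<Longrightarrow> f (act M g x) = act N g (f x)"
  shows "f \<in> intertwiners G M N"
  using assms by (auto simp: intertwiners_def linear_maps_def intro!: clinear_onI)

lemma intertwiners_restrictI:
  assumes "representation G M" "\<And>x. x \<in> carrier M \<Longrightarrow> f x \<in> carrier N"
    "\<And>x y. x \<in> carrier M \<Longrightarrow> y \<in> carrier M \<Longrightarrow> f (x \<oplus>\<^bsub>M\<^esub> y) = f x \<oplus>\<^bsub>N\<^esub> f y"
    "\<And>c x. x \<in> carrier M \<Longrightarrow> f (c \<odot>\<^bsub>M\<^esub> x) = c \<odot>\<^bsub>N\<^esub> f x"
    "\<And>g x. g \<in> carrier G \<Longrightarrow> x \<in> carrier M \<Longrightarrow> f (act M g x) = act N g (f x)"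
  shows "restrict f (carrier M) \<in> intertwiners G M N"
proof -
  interpret cspace M using assms(1) by (rule representationD)
  show ?thesis
    by (rule intertwinersI) (use assms representationD[OF assms(1)] in auto)
qed

lemma intertwinersD:
  assumes "f \<in> intertwiners G M N"
  shows "\<And>x. x \<in> carrier M \<Longrightarrow> f x \<in> carrier N"
    "\<And>x y. x \<in> carrier M \<Longrightarrow> y \<in> carrier M \<Longrightarrow> f (x \<oplus>\<^bsub>M\<^esub> y) = f x \<oplus>\<^bsub>N\<^esub> f y"
    "\<And>c x. x \<in> carrier M \<Longrightarrow> f (c \<odot>\<^bsub>M\<^esub> x) = c \<odot>\<^bsub>N\<^esub> f x"
    "f \<in> extensional (carrier M)"
    "\<And>g x. g \<in> carrier G \<Longrightarrow> x \<in> carrier M \<Longrightarrow> f (act M g x) = act N g (f x)"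
    "clinear_on M N f"
  using assms by (auto simp: intertwiners_def linear_maps_def clinear_on_def)

lemma intertwiners_zero:
  assumes "representation G M" "representation G N" "f \<in> intertwiners G M N"
  shows "f \<zero>\<^bsub>M\<^esub> = \<zero>\<^bsub>N\<^esub>"
  by (rule clinear_on_zero[OF representationD(1)[OF assms(1)] representationD(1)[OF assms(2)]
        intertwinersD(6)[OF assms(3)]])

lemma intertwiners_compose:
  assumes "representation G L" "f \<in> intertwiners G L M" "h \<in> intertwiners G M N"
  shows "compose (carrier L) h f \<in> intertwiners G L N"
proof -
  interpret L: cspace L using assms(1) by (rule representationD)
  show ?thesis
    by (rule intertwinersI)
      (use intertwinersD[OF assms(2)] intertwinersD[OF assms(3)] representationD[OF assms(1)]
        in \<open>auto simp: compose_def\<close>)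
qed

lemma intertwiners_id:
  assumes "representation G M" shows "(\<lambda>x\<in>carrier M. x) \<in> intertwiners G M M"
  by (rule intertwiners_restrictI) (use assms in auto)

lemma intertwiners_const_zero:
  assumes "representation G M" "representation G N"
  shows "(\<lambda>x\<in>carrier M. \<zero>\<^bsub>N\<^esub>) \<in> intertwiners G M N"
proof -
  interpret N: cspace N using assms(2) by (rule representationD)
  have "act N g \<zero>\<^bsub>N\<^esub> = \<zero>\<^bsub>N\<^esub>" if "g \<in> carrier G" for g
    using clinear_on_zero[OF N.cvector_space N.cvector_space representationD(2)[OF assms(2) that]] .
  then show ?thesis
    by (intro intertwiners_restrictI assms) auto
qed

lemma intertwiners_inverse:
  assumes "representation G M" "representation G N" "f \<in> intertwiners G M N"
    "bij_betw f (carrier M) (carrier N)"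
  shows "restrict (inv_into (carrier M) f) (carrier N) \<in> intertwiners G N M"
proof -
  interpret M: cspace M using assms(1) by (rule representationD)
  note f = intertwinersD[OF assms(3)] and M = representationD[OF assms(1)]
  let ?i = "inv_into (carrier M) f"
  have i: "?i y \<in> carrier M" "f (?i y) = y" if "y \<in> carrier N" for y
    using that assms(4) by (auto simp: bij_betw_def f_inv_into_f inv_into_into)
  have eq: "?i y = x" if "x \<in> carrier M" "f x = y" for x y
    using that assms(4) by (auto simp: bij_betw_def)
  show ?thesis
  proof (rule intertwiners_restrictI)
    show "?i (x \<oplus>\<^bsub>N\<^esub> y) = ?i x \<oplus>\<^bsub>M\<^esub> ?i y" if "x \<in> carrier N" "y \<in> carrier N" for x y
      by (rule eq) (use that i f in auto)
    show "?i (c \<odot>\<^bsub>N\<^esub> x) = c \<odot>\<^bsub>M\<^esub> ?i x" if "x \<in> carrier N" for c x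
      by (rule eq) (use that i f in auto)
    show "?i (act N g x) = act M g (?i x)" if "g \<in> carrier G" "x \<in> carrier N" for g x
      by (rule eq) (use that i f M in auto)
  qed (use i assms in auto)
qed

lemma subrep_kernel:
  assumes "representation G M" "representation G N" "f \<in> intertwiners G M N"
  shows "subrep G M {x \<in> carrier M. f x = \<zero>\<^bsub>N\<^esub>}"
proof -
  interpret M: cspace M using assms(1) by (rule representationD)
  interpret N: cspace N using assms(2) by (rule representationD)
  note f = intertwinersD[OF assms(3)]
  have "act N g \<zero>\<^bsub>N\<^esub> = \<zero>\<^bsub>N\<^esub>" if "g \<in> carrier G" for g
    using clinear_on_zero[OF N.cvector_space N.cvector_space representationD(2)[OF assms(2) that]] .
  then show ?thesis
    unfolding subrep_def using assms(1) f intertwiners_zero[OF assms]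
    by (auto intro!: csubspaceI simp: representationD(5)[OF assms(1)])
qed

lemma subrep_vimage:
  assumes "representation G M" "representation G N" "f \<in> intertwiners G M N" "subrep G N Q"
  shows "subrep G M {x \<in> carrier M. f x \<in> Q}"
proof -
  interpret M: cspace M using assms(1) by (rule representationD)
  note f = intertwinersD[OF assms(3)] and Q = csubspaceD[OF subrepD(1)[OF assms(4)]]
  show ?thesis
    unfolding subrep_def
  proof (intro conjI csubspaceI ballI)
    show "act M g x \<in> {x \<in> carrier M. f x \<in> Q}"
      if "g \<in> carrier G" "x \<in> {x \<in> carrier M. f x \<in> Q}" for g x
      using that f(5) subrepD(2)[OF assms(4)] representationD(5)[OF assms(1)] by simp
  qed (use f(2,3) Q(2-4) intertwiners_zero[OF assms(1-3)] in auto)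
qed

lemma subrep_image:
  assumes "representation G M" "representation G N" "f \<in> intertwiners G M N"
  shows "subrep G N (f ` carrier M)"
proof -
  interpret M: cspace M using assms(1) by (rule representationD)
  note f = intertwinersD[OF assms(3)] and M = representationD[OF assms(1)]
  show ?thesis unfolding subrep_def
  proof (intro conjI csubspaceI ballI)
    show "\<zero>\<^bsub>N\<^esub> \<in> f ` carrier M"
      by (rule image_eqI[of _ _ "\<zero>\<^bsub>M\<^esub>"]) (use intertwiners_zero[OF assms] in auto)
    show "f ` carrier M \<subseteq> carrier N" using f(1) by blast
  next
    fix u v assume "u \<in> f ` carrier M" "v \<in> f ` carrier M"
    then obtain x y where "x \<in> carrier M" "u = f x" "y \<in> carrier M" "v = f y" by blast
    then show "u \<oplus>\<^bsub>N\<^esub> v \<in> f ` carrier M"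
      using f(2) by (intro image_eqI[of _ _ "x \<oplus>\<^bsub>M\<^esub> y"]) simp_all
  next
    fix c u assume "u \<in> f ` carrier M"
    then obtain x where "x \<in> carrier M" "u = f x" by blast
    then show "c \<odot>\<^bsub>N\<^esub> u \<in> f ` carrier M"
      using f(3) by (intro image_eqI[of _ _ "c \<odot>\<^bsub>M\<^esub> x"]) simp_all
  next
    fix g u assume "g \<in> carrier G" "u \<in> f ` carrier M"
    then obtain x where "x \<in> carrier M" "u = f x" by blast
    then show "act N g u \<in> f ` carrier M"
      using f(5) M(5) \<open>g \<in> carrier G\<close> by (intro image_eqI[of _ _ "act M g x"]) simp_all
  qed
qed

text \<open>Formal expressions for elements of the group algebra. Different expressions may denote
  the same element; only the action matters, and it is defined by recursion. \<open>gset\<close>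
  collects the finitely many group elements that occur.\<close>

datatype (gset: 'g) galg =
  Single 'g | Scale complex "'g galg" | Add "'g galg" "'g galg" | Mult "'g galg" "'g galg"

primrec gact :: "('g, 'u) rep \<Rightarrow> 'g galg \<Rightarrow> 'u \<Rightarrow> 'u" where
  "gact M (Single g) x = act M g x"
| "gact M (Scale c a) x = c \<odot>\<^bsub>M\<^esub> gact M a x"
| "gact M (Add a b) x = gact M a x \<oplus>\<^bsub>M\<^esub> gact M b x"
| "gact M (Mult a b) x = gact M a (gact M b x)"

lemma finite_gset: "finite (gset a)"
  by (induction a) auto

lemma gact_restrict [simp]: "gact (M\<lparr>carrier := Q\<rparr>) a x = gact M a x"
  by (induction a arbitrary: x) auto

lemma clinear_on_gact:
  assumes "representation G M" "gset a \<subseteq> carrier G"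
  shows "clinear_on M M (gact M a)"
  using assms(2)
proof (induction a)
  case (Single g)
  then show ?case using representationD(2)[OF assms(1), of g] by (simp add: clinear_on_def)
next
  case (Scale c a)
  interpret cspace M using assms(1) by (rule representationD)
  have a: "clinear_on M M (gact M a)" using Scale by simp
  show ?case
    by (rule clinear_onI) (use clinear_onD[OF a] in \<open>auto simp: csmult_add_right csmult_assoc mult.commute\<close>)
next
  case (Add a b)
  interpret cspace M using assms(1) by (rule representationD)
  have a: "clinear_on M M (gact M a)" and b: "clinear_on M M (gact M b)" using Add by auto
  show ?case
    by (rule clinear_onI)
      (use clinear_onD[OF a] clinear_onD[OF b] in \<open>auto simp: csmult_add_right M.a_ac\<close>)
next
  case (Mult a b)
  have a: "clinear_on M M (gact M a)" and b: "clinear_on M M (gact M b)" using Mult by auto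
  show ?case by (rule clinear_onI) (use clinear_onD[OF a] clinear_onD[OF b] in auto)
qed

lemma gact_closed:
  assumes "representation G M" "gset a \<subseteq> carrier G" "x \<in> carrier M"
  shows "gact M a x \<in> carrier M"
  by (rule clinear_onD(1)[OF clinear_on_gact[OF assms(1,2)] assms(3)])

lemma gact_zero:
  assumes "representation G M" "gset a \<subseteq> carrier G"
  shows "gact M a \<zero>\<^bsub>M\<^esub> = \<zero>\<^bsub>M\<^esub>"
  by (rule clinear_on_zero[OF representationD(1)[OF assms(1)] representationD(1)[OF assms(1)] clinear_on_gact[OF assms]])

text \<open>\<open>Z\<close> need not be all of \<open>M\<close>: the averaged projections below are equivariant only on the
  span of one orbit of a compact subgroup.\<close>

lemma gact_commute:
  assumes Z: "csubspace M Z" and f: "clinear_on M N f"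
    and "\<And>g z. g \<in> gset a \<Longrightarrow> z \<in> Z \<Longrightarrow> act M g z \<in> Z"
    and "\<And>g z. g \<in> gset a \<Longrightarrow> z \<in> Z \<Longrightarrow> f (act M g z) = act N g (f z)" and "x \<in> Z"
  shows "gact M a x \<in> Z \<and> f (gact M a x) = gact N a (f x)"
  using assms(3-5)
  by (induction a arbitrary: x) (use clinear_onD(2,3)[OF f] csubspaceD(3-5)[OF Z] in auto)

lemma gact_intertwiner:
  assumes "representation G M" "gset a \<subseteq> carrier G" "x \<in> carrier M" "f \<in> intertwiners G M N"
  shows "f (gact M a x) = gact N a (f x)"
proof -
  interpret cspace M using assms(1) by (rule representationD)
  have "csubspace M (carrier M)" by (rule csubspaceI) auto
  then show ?thesis
    using gact_commute[of M "carrier M" N f a x] intertwinersD(5,6)[OF assms(4)]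
      representationD(5)[OF assms(1)] assms(2,3) by blast
qed

lemma gact_subrep:
  assumes "subrep G M Q" "gset a \<subseteq> carrier G" "x \<in> Q"
  shows "gact M a x \<in> Q"
  using assms(2,3)
  by (induction a arbitrary: x) (use subrepD[OF assms(1)] csubspaceD[OF subrepD(1)[OF assms(1)]] in auto)

text \<open>Multiplication by single group elements suffices, since the images of an ideal only have
  to be closed under \<open>act\<close>. All closure conditions refer to expressions and not to
  classes of them.\<close>

definition left_ideal :: "('g, 'b) monoid_scheme \<Rightarrow> 'g galg set \<Rightarrow> bool" where
  "left_ideal G I \<longleftrightarrow> (\<forall>a\<in>I. gset a \<subseteq> carrier G) \<and> I \<noteq> {} \<and>
     (\<forall>a\<in>I. \<forall>b\<in>I. Add a b \<in> I) \<and> (\<forall>c. \<forall>a\<in>I. Scale c a \<in> I) \<and>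
     (\<forall>g\<in>carrier G. \<forall>a\<in>I. Mult (Single g) a \<in> I)"

text \<open>The orbit map of \<open>x\<close> carries the formal operations \<open>Add\<close>,
  \<open>Scale\<close> and \<open>Mult (Single g)\<close> to the operations of
  \<open>M\<close>.\<close>

lemma subrep_left_ideal:
  assumes M: "representation G M" and I: "left_ideal G I" and x: "x \<in> carrier M"
  shows "subrep G M ((\<lambda>a. gact M a x) ` I)"
proof -
  interpret cspace M using M by (rule representationD)
  have c: "gact M a x \<in> carrier M" if "a \<in> I" for a
    using that gact_closed[OF M _ x] I by (auto simp: left_ideal_def)
  show ?thesis unfolding subrep_def
  proof (intro conjI csubspaceI ballI)
    obtain a where "a \<in> I" using I by (auto simp: left_ideal_def)
    then have "Scale 0 a \<in> I" "gact M (Scale 0 a) x = \<zero>\<^bsub>M\<^esub>" using c I by (auto simp: left_ideal_def)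
    then show "\<zero>\<^bsub>M\<^esub> \<in> (\<lambda>a. gact M a x) ` I" by (metis imageI)
  next
    fix u v assume "u \<in> (\<lambda>a. gact M a x) ` I" "v \<in> (\<lambda>a. gact M a x) ` I"
    then obtain a b where "a \<in> I" "b \<in> I" "u = gact M a x" "v = gact M b x" by auto
    then show "u \<oplus>\<^bsub>M\<^esub> v \<in> (\<lambda>a. gact M a x) ` I"
      using I by (intro image_eqI[of _ _ "Add a b"]) (auto simp: left_ideal_def)
  next
    fix e u assume "u \<in> (\<lambda>a. gact M a x) ` I"
    then obtain a where "a \<in> I" "u = gact M a x" by auto
    then show "e \<odot>\<^bsub>M\<^esub> u \<in> (\<lambda>a. gact M a x) ` I"
      using I by (intro image_eqI[of _ _ "Scale e a"]) (auto simp: left_ideal_def)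
  next
    fix g u assume "g \<in> carrier G" "u \<in> (\<lambda>a. gact M a x) ` I"
    then obtain a where "a \<in> I" "u = gact M a x" by auto
    then show "act M g u \<in> (\<lambda>a. gact M a x) ` I"
      using I \<open>g \<in> carrier G\<close>
      by (intro image_eqI[of _ _ "Mult (Single g) a"]) (auto simp: left_ideal_def)
  qed (use c in auto)
qed

definition ann :: "('g, 'b) monoid_scheme \<Rightarrow> ('g, 'u) rep \<Rightarrow> 'u list \<Rightarrow> 'g galg set" where
  "ann G M ys = {a. gset a \<subseteq> carrier G \<and> (\<forall>y\<in>set ys. gact M a y = \<zero>\<^bsub>M\<^esub>)}"

lemma annD: "a \<in> ann G M ys \<Longrightarrow> gset a \<subseteq> carrier G" "a \<in> ann G M ys \<Longrightarrow> y \<in> set ys \<Longrightarrow> gact M a y = \<zero>\<^bsub>M\<^esub>"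
  by (auto simp: ann_def)

lemma left_ideal_ann:
  assumes "group G" "representation G M" "set ys \<subseteq> carrier M"
  shows "left_ideal G (ann G M ys)"
proof -
  interpret cspace M using assms(2) by (rule representationD)
  interpret group G by fact
  have 0: "act M g \<zero>\<^bsub>M\<^esub> = \<zero>\<^bsub>M\<^esub>" if "g \<in> carrier G" for g
    using gact_zero[OF assms(2), of "Single g"] that by simp
  have "Scale 0 (Single \<one>\<^bsub>G\<^esub>) \<in> ann G M ys"
    using assms representationD(3)[OF assms(2)] by (auto simp: ann_def)
  then have "ann G M ys \<noteq> {}" by blast
  then show ?thesis using 0 by (auto simp: left_ideal_def ann_def)
qed

lemma subrep_cyclic:
  assumes "group G" "representation G M" "x \<in> carrier M"
  shows "subrep G M {gact M a x | a. gset a \<subseteq> carrier G}" (is ?A)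
    and "x \<in> {gact M a x | a. gset a \<subseteq> carrier G}" (is ?B)
proof -
  interpret group G by fact
  \<comment> \<open>The annihilator of the empty list consists of all expressions over
    \<open>G\<close>.\<close>
  show ?A using subrep_left_ideal[OF assms(2) left_ideal_ann[OF assms(1,2), of "[]"] assms(3)]
    by (simp add: ann_def setcompr_eq_image)
  show ?B using representationD(3)[OF assms(2,3)]
    by (intro CollectI exI[of _ "Single \<one>\<^bsub>G\<^esub>"]) auto
qed

lemma irreducible_cyclic:
  assumes "group G" "irreducible_rep G M" "x \<in> carrier M" "x \<noteq> \<zero>\<^bsub>M\<^esub>" "y \<in> carrier M"
  obtains a where "gset a \<subseteq> carrier G" "y = gact M a x"
proof -
  have M: "representation G M" using assms by (simp add: irreducible_rep_iff)
  have "{gact M a x | a. gset a \<subseteq> carrier G} = carrier M"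
    using subrep_cyclic[OF assms(1) M assms(3)] assms(2,4) unfolding irreducible_rep_iff by blast
  then show thesis using that assms(5) by blast
qed

text \<open>The easy part of Schur's lemma: the kernel is a subrepresentation and not everything,
  hence zero.\<close>

lemma irreducible_inj:
  assumes "irreducible_rep G M" "representation G N" "f \<in> intertwiners G M N"
    "x \<in> carrier M" "f x \<noteq> \<zero>\<^bsub>N\<^esub>"
  shows "\<And>y. y \<in> carrier M \<Longrightarrow> f y = \<zero>\<^bsub>N\<^esub> \<Longrightarrow> y = \<zero>\<^bsub>M\<^esub>" "inj_on f (carrier M)"
proof -
  have M: "representation G M" using assms by (simp add: irreducible_rep_iff)
  have "{x \<in> carrier M. f x = \<zero>\<^bsub>N\<^esub>} = {\<zero>\<^bsub>M\<^esub>}"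
    using subrep_kernel[OF M assms(2,3)] assms(1,4,5) unfolding irreducible_rep_iff by blast
  then show *: "\<And>y. y \<in> carrier M \<Longrightarrow> f y = \<zero>\<^bsub>N\<^esub> \<Longrightarrow> y = \<zero>\<^bsub>M\<^esub>" by blast
  show "inj_on f (carrier M)"
    by (rule clinear_on_inj[OF representationD(1)[OF M] representationD(1)[OF assms(2)]
          intertwinersD(6)[OF assms(3)] *])
qed

lemma irreducible_bij:
  assumes "irreducible_rep G M" "irreducible_rep G N" "f \<in> intertwiners G M N"
    "x \<in> carrier M" "f x \<noteq> \<zero>\<^bsub>N\<^esub>"
  shows "bij_betw f (carrier M) (carrier N)"
proof -
  have M: "representation G M" and N: "representation G N"
    using assms by (simp_all add: irreducible_rep_iff)
  have "f ` carrier M = carrier N"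
    using subrep_image[OF M N assms(3)] assms(2,4,5) unfolding irreducible_rep_iff by blast
  then show ?thesis using irreducible_inj(2)[OF assms(1) N assms(3-5)] by (simp add: bij_betw_def)
qed

section \<open>Annihilators and sums of homomorphic images\<close>

text \<open>Spans are built one generator at a time, so that spans, sums of homomorphic images and
  annihilators of lists can be compared by the same induction.\<close>

primrec lspan :: "(complex, 'u, 'm) module_scheme \<Rightarrow> 'u list \<Rightarrow> 'u set" where
  "lspan V [] = {\<zero>\<^bsub>V\<^esub>}"
| "lspan V (y # ys) = {z \<oplus>\<^bsub>V\<^esub> c \<odot>\<^bsub>V\<^esub> y | z c. z \<in> lspan V ys}"

text \<open>All sums \<open>\<theta>_1 y_1 + ... + \<theta>_n y_n\<close> with homomorphisms
  \<open>\<theta>_i\<close> from \<open>S\<close> to \<open>M\<close>.\<close>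

primrec hsum :: "('g, 'b) monoid_scheme \<Rightarrow> ('g, 'u) rep \<Rightarrow> ('g, 'u) rep \<Rightarrow> 'u list \<Rightarrow> 'u set" where
  "hsum G S M [] = {\<zero>\<^bsub>M\<^esub>}"
| "hsum G S M (y # ys) = {z \<oplus>\<^bsub>M\<^esub> \<theta> y | z \<theta>. z \<in> hsum G S M ys \<and> \<theta> \<in> intertwiners G S M}"

lemma (in cspace) csubspace_lspan:
  assumes "set ys \<subseteq> carrier V" shows "csubspace V (lspan V ys)"
  using assms
proof (induction ys)
  case Nil
  then show ?case by (auto intro!: csubspaceI)
next
  case (Cons y ys)
  show ?case unfolding lspan.simps by (rule subspace_line_sum) (use Cons in auto)
qed

lemma clinear_on_lspan_zero:
  assumes V: "cvector_space V" and W: "cvector_space W" and f: "clinear_on V W f"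
    and ys: "set ys \<subseteq> carrier V" "\<And>y. y \<in> set ys \<Longrightarrow> f y = \<zero>\<^bsub>W\<^esub>" and "x \<in> lspan V ys"
  shows "f x = \<zero>\<^bsub>W\<^esub>"
  using ys assms(6)
proof (induction ys arbitrary: x)
  case Nil
  then show ?case using clinear_on_zero[OF V W f] by simp
next
  case (Cons y ys)
  interpret V: cspace V using V by (rule cspace.intro)
  interpret W: cspace W using W by (rule cspace.intro)
  obtain c z where cz: "x = z \<oplus>\<^bsub>V\<^esub> c \<odot>\<^bsub>V\<^esub> y" "z \<in> lspan V ys" using Cons.prems(3) by auto
  have z: "z \<in> carrier V"
    using csubspaceD(5)[OF V.csubspace_lspan cz(2)] Cons.prems(1) by auto
  have "f z = \<zero>\<^bsub>W\<^esub>" using Cons.IH[OF _ _ cz(2)] Cons.prems by auto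
  then show ?case using Cons.prems(1,2) z clinear_onD[OF f] by (simp add: cz)
qed

text \<open>The list is chosen before the coefficients, so that one list serves all vectors of a
  finite-dimensional space.\<close>

lemma finsum_in_lspan:
  assumes V: "cvector_space V" and "finite B" "B \<subseteq> carrier V"
  shows "\<exists>bs. set bs = B \<and> (\<forall>c. (\<Oplus>\<^bsub>V\<^esub>b\<in>B. c b \<odot>\<^bsub>V\<^esub> b) \<in> lspan V bs)"
  using assms(2,3)
proof (induction B)
  case empty
  interpret cspace V using V by (rule cspace.intro)
  show ?case by (rule exI[of _ "[]"]) simp
next
  case (insert b B)
  interpret cspace V using V by (rule cspace.intro)
  obtain bs where bs: "set bs = B" "\<And>c. (\<Oplus>\<^bsub>V\<^esub>b\<in>B. c b \<odot>\<^bsub>V\<^esub> b) \<in> lspan V bs"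
    using insert by auto
  have "(\<Oplus>\<^bsub>V\<^esub>b\<in>insert b B. c b \<odot>\<^bsub>V\<^esub> b) \<in> lspan V (b # bs)" for c
  proof -
    have "(\<Oplus>\<^bsub>V\<^esub>b\<in>insert b B. c b \<odot>\<^bsub>V\<^esub> b) = c b \<odot>\<^bsub>V\<^esub> b \<oplus>\<^bsub>V\<^esub> (\<Oplus>\<^bsub>V\<^esub>b\<in>B. c b \<odot>\<^bsub>V\<^esub> b)"
      using insert by (intro M.finsum_insert) auto
    also have "\<dots> = (\<Oplus>\<^bsub>V\<^esub>b\<in>B. c b \<odot>\<^bsub>V\<^esub> b) \<oplus>\<^bsub>V\<^esub> c b \<odot>\<^bsub>V\<^esub> b"
      using insert by (intro M.a_comm M.finsum_closed) auto
    finally show ?thesis using bs(2)[of c] by auto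
  qed
  then show ?case using bs(1) by (intro exI[of _ "b # bs"]) simp
qed

lemma finite_dimensional_lspan:
  assumes "cvector_space V" "finite_dimensional V S" "S \<subseteq> carrier V"
  obtains bs where "set bs \<subseteq> S" "S \<subseteq> lspan V bs"
proof -
  obtain B where B: "finite B" "B \<subseteq> S" "\<And>x. x \<in> S \<Longrightarrow> \<exists>c. x = (\<Oplus>\<^bsub>V\<^esub>b\<in>B. c b \<odot>\<^bsub>V\<^esub> b)"
    using assms(2) unfolding finite_dimensional_def by auto
  obtain bs where "set bs = B" "\<And>c. (\<Oplus>\<^bsub>V\<^esub>b\<in>B. c b \<odot>\<^bsub>V\<^esub> b) \<in> lspan V bs"
    using finsum_in_lspan[OF assms(1) B(1)] B(2) assms(3) by auto
  then show thesis using that[of bs] B(2,3) by fastforce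
qed

text \<open>Density theorem for maps out of a simple module: the assumption on annihilators says that \<open>(y\<^sub>1, \<dots>, y\<^sub>n) \<mapsto> x\<close> extends
  to a homomorphism from the submodule of \<open>S\<^sup>n\<close> generated by that tuple.\<close>

theorem ann_imp_hsum:
  assumes G: "group G" and S: "irreducible_rep G S" and M: "representation G M"
    and "set ys \<subseteq> carrier S" "x \<in> carrier M"
    and "\<And>a. a \<in> ann G S ys \<Longrightarrow> gact M a x = \<zero>\<^bsub>M\<^esub>"
  shows "x \<in> hsum G S M ys"
  using assms(4-)
proof (induction ys arbitrary: x)
  case Nil
  interpret group G by fact
  have "gact M (Single \<one>\<^bsub>G\<^esub>) x = \<zero>\<^bsub>M\<^esub>" by (rule Nil(3)) (auto simp: ann_def)
  then show ?case using representationD(3)[OF M] Nil by simp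
next
  case (Cons y ys)
  have rS: "representation G S" using S by (simp add: irreducible_rep_iff)
  interpret S: cspace S using rS by (rule representationD)
  interpret M: cspace M using M by (rule representationD)
  let ?I = "ann G S ys"
  have y: "y \<in> carrier S" and ys: "set ys \<subseteq> carrier S" using Cons.prems by auto
  have I: "left_ideal G ?I" using G rS ys by (rule left_ideal_ann)
  \<comment> \<open>The set \<open>I y\<close> is a subrepresentation of the irreducible
    \<open>S\<close>, so it is zero or everything; the proof splits accordingly.\<close>
  have sub: "subrep G S ((\<lambda>a. gact S a y) ` ?I)" using rS I y by (rule subrep_left_ideal)
  have annC: "a \<in> ann G S (y # ys)" if "a \<in> ?I" "gact S a y = \<zero>\<^bsub>S\<^esub>" for a
    using that by (auto simp: ann_def)
  show ?case
  proof (cases "(\<lambda>a. gact S a y) ` ?I = {\<zero>\<^bsub>S\<^esub>}")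
    case True
    \<comment> \<open>If the ideal kills \<open>y\<close>, it already annihilates the longer list,
      and \<open>y\<close> contributes the zero homomorphism.\<close>
    have "x \<in> hsum G S M ys"
    proof (rule Cons.IH[OF ys Cons.prems(2)])
      show "gact M a x = \<zero>\<^bsub>M\<^esub>" if "a \<in> ?I" for a
        using Cons.prems(3) annC[OF that] True that by blast
    qed
    moreover have "x = x \<oplus>\<^bsub>M\<^esub> (\<lambda>x\<in>carrier S. \<zero>\<^bsub>M\<^esub>) y" using y Cons.prems(2) by simp
    ultimately show ?thesis
      unfolding hsum.simps using intertwiners_const_zero[OF rS M] by blast
  next
    case False
    then have all: "(\<lambda>a. gact S a y) ` ?I = carrier S"
      using sub S unfolding irreducible_rep_iff by blast
    have clS: "gact S a y \<in> carrier S" and clM: "gact M a x \<in> carrier M" if "a \<in> ?I" for a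
      using gact_closed[OF rS annD(1)[OF that] y] gact_closed[OF M annD(1)[OF that] Cons.prems(2)] by auto
    \<comment> \<open>The difference of \<open>a\<close> and \<open>b\<close> kills \<open>y\<close>
      and all of \<open>ys\<close>, hence also \<open>x\<close> by assumption; so
      \<open>a y \<mapsto> a x\<close> is well defined.\<close>
    have wd: "gact M a x = gact M b x" if "a \<in> ?I" "b \<in> ?I" "gact S a y = gact S b y" for a b
    proof -
      have "Add a (Scale (- 1) b) \<in> ?I" using that I unfolding left_ideal_def by blast
      then have "Add a (Scale (- 1) b) \<in> ann G S (y # ys)"
        by (rule annC) (use that clS in simp)
      from Cons.prems(3)[OF this] show ?thesis
        using M.add_minus_eq_zero clM that by simp
    qed
    define \<theta> where "\<theta> u = gact M (SOME a. a \<in> ?I \<and> gact S a y = u) x" for u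
    have \<theta>: "\<theta> (gact S a y) = gact M a x" if "a \<in> ?I" for a
    proof -
      have "(SOME b. b \<in> ?I \<and> gact S b y = gact S a y) \<in> ?I \<and>
          gact S (SOME b. b \<in> ?I \<and> gact S b y = gact S a y) y = gact S a y"
        by (rule someI[of _ a]) (use that in simp)
      then show ?thesis unfolding \<theta>_def using wd that by blast
    qed
    have ex: "\<exists>a\<in>?I. u = gact S a y" if "u \<in> carrier S" for u using all that by auto
    have \<theta>i: "restrict \<theta> (carrier S) \<in> intertwiners G S M"
    proof (rule intertwiners_restrictI[OF rS])
      show "\<theta> u \<in> carrier M" if u: "u \<in> carrier S" for u
        using ex[OF u] \<theta> clM by auto
    next
      fix u v assume "u \<in> carrier S" "v \<in> carrier S"
      then obtain a b where ab: "a \<in> ?I" "u = gact S a y" "b \<in> ?I" "v = gact S b y"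
        using ex by blast
      have "Add a b \<in> ?I" using ab I unfolding left_ideal_def by blast
      from \<theta>[OF this] show "\<theta> (u \<oplus>\<^bsub>S\<^esub> v) = \<theta> u \<oplus>\<^bsub>M\<^esub> \<theta> v" using ab \<theta> by simp
    next
      fix c u assume "u \<in> carrier S"
      then obtain a where ab: "a \<in> ?I" "u = gact S a y" using ex by blast
      have "Scale c a \<in> ?I" using ab I unfolding left_ideal_def by blast
      from \<theta>[OF this] show "\<theta> (c \<odot>\<^bsub>S\<^esub> u) = c \<odot>\<^bsub>M\<^esub> \<theta> u" using ab \<theta> by simp
    next
      fix g u assume g: "g \<in> carrier G" and "u \<in> carrier S"
      then obtain a where ab: "a \<in> ?I" "u = gact S a y" using ex by blast
      have "Mult (Single g) a \<in> ?I" using ab I g unfolding left_ideal_def by blast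
      from \<theta>[OF this] show "\<theta> (act S g u) = act M g (\<theta> u)" using ab \<theta> by simp
    qed
    \<comment> \<open>Subtracting \<open>\<theta> y\<close> leaves a vector killed by the ideal,
      because \<open>a (\<theta> y) = \<theta> (a y) = a x\<close>; induction expresses it through
      \<open>ys\<close>.\<close>
    let ?x = "x \<oplus>\<^bsub>M\<^esub> (- 1) \<odot>\<^bsub>M\<^esub> \<theta> y"
    have \<theta>y: "\<theta> y \<in> carrier M" using intertwinersD(1)[OF \<theta>i y] y by simp
    have "?x \<in> hsum G S M ys"
    proof (rule Cons.IH[OF ys])
      show "?x \<in> carrier M" using \<theta>y Cons.prems(2) by simp
      fix a assume a: "a \<in> ?I"
      note lin = clinear_onD[OF clinear_on_gact[OF M annD(1)[OF a]]]
      have "gact M a (\<theta> y) = \<theta> (gact S a y)"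
        using gact_intertwiner[OF rS annD(1)[OF a] y \<theta>i] y clS[OF a] by simp
      also have "\<dots> = gact M a x" using \<theta>[OF a] .
      finally show "gact M a ?x = \<zero>\<^bsub>M\<^esub>"
        using lin Cons.prems(2) \<theta>y clM[OF a] by simp
    qed
    moreover have "x = ?x \<oplus>\<^bsub>M\<^esub> restrict \<theta> (carrier S) y"
      using M.add_minus_cancel[OF Cons.prems(2) \<theta>y] y by simp
    ultimately show ?thesis unfolding hsum.simps using \<theta>i by blast
  qed
qed

text \<open>Project onto the line through \<open>w\<close> and read off the coefficient.\<close>

lemma (in cspace) exists_functional:
  assumes "w \<in> carrier V" "w \<noteq> \<zero>"
  obtains \<phi> where "\<phi> w = 1" "\<And>x y. x \<in> carrier V \<Longrightarrow> y \<in> carrier V \<Longrightarrow> \<phi> (x \<oplus> y) = \<phi> x + \<phi> y"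
    "\<And>c x. x \<in> carrier V \<Longrightarrow> \<phi> (c \<odot> x) = c * \<phi> x"
proof -
  have Q: "csubspace V (lspan V [w])" using assms by (intro csubspace_lspan) auto
  obtain p where p: "clinear_on V V p" "\<And>x. x \<in> carrier V \<Longrightarrow> p x \<in> lspan V [w]"
    "\<And>x. x \<in> lspan V [w] \<Longrightarrow> p x = x" using linear_projection[OF Q] by blast
  have L: "lspan V [w] = range (\<lambda>c. c \<odot> w)" using assms(1) by auto
  have inj: "c = d" if "c \<odot> w = d \<odot> w" for c d
  proof (rule ccontr)
    assume "c \<noteq> d"
    have "(c + - d) \<odot> w = c \<odot> w \<oplus> (- 1) \<odot> (d \<odot> w)"
      unfolding csmult_add_left[OF assms(1)] using assms(1) by (simp add: csmult_assoc)
    also have "\<dots> = \<zero>" unfolding that using assms(1) by simp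
    finally show False using csmult_eq_zero[OF assms(1), of "c + - d"] \<open>c \<noteq> d\<close> assms(2) by simp
  qed
  have "\<exists>c. p x = c \<odot> w" if "x \<in> carrier V" for x using p(2)[OF that] unfolding L by blast
  then obtain \<phi> where \<phi>: "\<And>x. x \<in> carrier V \<Longrightarrow> p x = \<phi> x \<odot> w" by metis
  show thesis
  proof (rule that[of \<phi>])
    have "w \<in> lspan V [w]" unfolding L using assms(1) by (intro image_eqI[of _ _ 1]) auto
    then show "\<phi> w = 1" using \<phi>[OF assms(1)] p(3) inj[of "\<phi> w" 1] assms(1) by simp
    show "\<phi> (x \<oplus> y) = \<phi> x + \<phi> y" if "x \<in> carrier V" "y \<in> carrier V" for x y
    proof (rule inj)
      have "\<phi> (x \<oplus> y) \<odot> w = p x \<oplus> p y" using \<phi>[of "x \<oplus> y"] clinear_onD(2)[OF p(1)] that by simp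
      then show "\<phi> (x \<oplus> y) \<odot> w = (\<phi> x + \<phi> y) \<odot> w"
        using \<phi> that assms(1) by (simp add: csmult_add_left)
    qed
    show "\<phi> (c \<odot> x) = c * \<phi> x" if "x \<in> carrier V" for c x
    proof (rule inj)
      have "\<phi> (c \<odot> x) \<odot> w = c \<odot> p x" using \<phi>[of "c \<odot> x"] clinear_onD(3)[OF p(1)] that by simp
      then show "\<phi> (c \<odot> x) \<odot> w = (c * \<phi> x) \<odot> w"
        using \<phi> that assms(1) by (simp add: csmult_assoc)
    qed
  qed
qed

section \<open>Averaging over compact open subgroups\<close>

lemma topological_groupD:
  fixes G (structure)
  assumes "topological_group G T"
  shows "group G" "topspace T = carrier G"
    "continuous_map (prod_topology T T) T (\<lambda>(x, y). x \<otimes> y)"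
  using assms by (auto simp: topological_group_def)

lemma open_translate:
  fixes G (structure)
  assumes "topological_group G T" "g \<in> carrier G" "openin T U"
  shows "openin T {x \<in> carrier G. g \<otimes> x \<in> U}"
proof -
  note T = topological_groupD[OF assms(1)]
  have "continuous_map T (prod_topology T T) (\<lambda>x. (g, x))"
    using assms(2) T(2) by (simp add: continuous_map_paired)
  from continuous_map_compose[OF this T(3)] have "continuous_map T T (\<lambda>x. g \<otimes> x)"
    by (simp add: comp_def)
  from openin_continuous_map_preimage[OF this assms(3)] show ?thesis using T(2) by simp
qed

text \<open>The open translates \<open>r U\<close> with \<open>r\<close> in \<open>L\<close> cover
  \<open>L\<close>, and compactness leaves finitely many. For \<open>U\<close> the stabilizer of a
  vector this bounds an orbit, for \<open>U\<close> an open subgroup it bounds the number of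
  cosets.\<close>

lemma finite_translates_cover:
  fixes G (structure)
  assumes T: "topological_group G T" and L: "compactin T L" and U: "openin T U" "\<one> \<in> U"
  obtains R where "finite R" "R \<subseteq> L" "\<And>g. g \<in> L \<Longrightarrow> \<exists>r\<in>R. inv r \<otimes> g \<in> U"
proof -
  interpret group G using T by (rule topological_groupD)
  have LG: "L \<subseteq> carrier G" using compactin_subset_topspace[OF L] topological_groupD(2)[OF T] by simp
  define W where "W r = {x \<in> carrier G. inv r \<otimes> x \<in> U}" for r
  have "openin T V" if "V \<in> W ` L" for V
    using that LG unfolding W_def by (auto intro!: open_translate[OF T] U)
  moreover have "L \<subseteq> \<Union>(W ` L)"
  proof
    fix x assume "x \<in> L"
    then have "x \<in> W x" using LG U(2) unfolding W_def by auto
    then show "x \<in> \<Union>(W ` L)" using \<open>x \<in> L\<close> by blast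
  qed
  ultimately obtain \<F> where \<F>: "finite \<F>" "\<F> \<subseteq> W ` L" "L \<subseteq> \<Union>\<F>"
    using L unfolding compactin_def by meson
  then obtain R where R: "finite R" "R \<subseteq> L" "\<F> = W ` R" by (metis finite_subset_image)
  then show thesis using that[of R] \<F>(3) by (auto simp: W_def)
qed

lemma stabilizer_subgroup:
  fixes G (structure)
  assumes "group G" "representation G M" "X \<subseteq> carrier M" "subgroup L G"
  shows "subgroup {g \<in> L. \<forall>x\<in>X. act M g x = x} G"
proof -
  interpret group G by fact
  interpret L: subgroup L G by fact
  note M = representationD[OF assms(2)]
  show ?thesis
  proof (rule subgroupI)
    show "{g \<in> L. \<forall>x\<in>X. act M g x = x} \<noteq> {}" using M(3) assms(3) L.one_closed by blast
    fix g assume g: "g \<in> {g \<in> L. \<forall>x\<in>X. act M g x = x}"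
    have "act M (inv g) x = x" if x: "x \<in> X" for x
    proof -
      have "act M (inv g) x = act M (inv g) (act M g x)" using g x by simp
      also have "\<dots> = act M (inv g \<otimes> g) x"
        using g x assms(3) L.subset by (intro M(4)[symmetric]) auto
      also have "\<dots> = x" using g x assms(3) L.subset M(3) by auto
      finally show ?thesis .
    qed
    then show "inv g \<in> {g \<in> L. \<forall>x\<in>X. act M g x = x}" using g by simp
  next
    fix g h assume g: "g \<in> {g \<in> L. \<forall>x\<in>X. act M g x = x}" and h: "h \<in> {g \<in> L. \<forall>x\<in>X. act M g x = x}"
    have "act M (g \<otimes> h) x = x" if x: "x \<in> X" for x
      using M(4)[of g h x] g h x assms(3) L.subset by auto
    then show "g \<otimes> h \<in> {g \<in> L. \<forall>x\<in>X. act M g x = x}" using g h by simp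
  qed (use L.subset in auto)
qed

lemma stabilizer_open:
  fixes G (structure)
  assumes T: "topological_group G T" and M: "smooth_rep G T M" and X: "finite X" "X \<subseteq> carrier M"
    and L: "openin T L"
  shows "openin T {g \<in> L. \<forall>x\<in>X. act M g x = x}"
  using X
proof (induction X)
  case empty
  then show ?case using L by simp
next
  case (insert x X)
  have "{g \<in> L. \<forall>y\<in>insert x X. act M g y = y} =
      {g \<in> L. \<forall>y\<in>X. act M g y = y} \<inter> {g \<in> carrier G. act M g x = x}"
    using openin_subset[OF L] topological_groupD(2)[OF T] by auto
  then show ?case using insert M by (auto simp: smooth_rep_def)
qed

text \<open>The complement is a union of cosets: for \<open>g\<close> outside \<open>S\<close> the
  open coset \<open>g S\<close> avoids \<open>S\<close>.\<close>

lemma open_subgroup_closed: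
  fixes G (structure)
  assumes T: "topological_group G T" and S: "subgroup S G" "openin T S"
  shows "closedin T S"
proof -
  note TG = topological_groupD[OF T]
  interpret group G by (rule TG)
  note sub = subgroup.mem_carrier[OF S(1)]
  have "openin T (topspace T - S)"
  proof (subst openin_subopen, intro ballI)
    fix g assume g: "g \<in> topspace T - S"
    then have gG: "g \<in> carrier G" using TG(2) by simp
    let ?V = "{y \<in> carrier G. inv g \<otimes> y \<in> S}"
    have "openin T ?V" by (rule open_translate[OF T inv_closed[OF gG] S(2)])
    moreover have "g \<in> ?V" using gG subgroup.one_closed[OF S(1)] by simp
    moreover have "?V \<subseteq> topspace T - S"
    proof
      fix y assume y: "y \<in> ?V"
      have "y \<notin> S"
      proof
        assume yS: "y \<in> S"
        have "y \<otimes> inv (inv g \<otimes> y) \<in> S"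
          by (rule subgroup.m_closed[OF S(1) yS subgroup.m_inv_closed[OF S(1)]]) (use y in simp)
        moreover have "y \<otimes> inv (inv g \<otimes> y) = g"
          using gG sub[OF yS] by (simp add: inv_mult_group flip: m_assoc)
        ultimately show False using g by simp
      qed
      then show "y \<in> topspace T - S" using y TG(2) by simp
    qed
    ultimately show "\<exists>V. openin T V \<and> g \<in> V \<and> V \<subseteq> topspace T - S" by (intro exI conjI)
  qed
  moreover have "S \<subseteq> topspace T" using sub TG(2) by auto
  ultimately show ?thesis by (simp add: closedin_def)
qed

text \<open>The stabilizer in \<open>K\<close> is an open and hence closed subgroup, and a closed
  subset of the compact \<open>K\<close> is compact.\<close>

lemma compact_stabilizer:
  fixes G (structure)
  assumes T: "topological_group G T" and M: "smooth_rep G T M" and x: "x \<in> carrier M"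
    and K: "compact_open_subgroup G T K"
  shows "compact_open_subgroup G T {g \<in> K. \<forall>y\<in>{x}. act M g y = y}" (is "compact_open_subgroup G T ?S")
proof -
  note TG = topological_groupD[OF T]
  have K: "subgroup K G" "compactin T K" "openin T K" using K by (auto simp: compact_open_subgroup_def)
  have sub: "subgroup ?S G"
    by (rule stabilizer_subgroup) (use TG smooth_representation[OF M] x K in auto)
  have op: "openin T ?S" by (rule stabilizer_open[OF T M]) (use x K in auto)
  have "compactin T (K \<inter> ?S)"
    by (rule compact_Int_closedin[OF K(2) open_subgroup_closed[OF T sub op]])
  moreover have eq: "K \<inter> ?S = ?S" by blast
  ultimately have "compactin T ?S" by (simp only: eq)
  then show ?thesis unfolding compact_open_subgroup_def using sub op by simp
qed

section \<open>Finite sums of vectors\<close>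

lemma clinear_on_finsum:
  assumes V: "cvector_space V" and W: "cvector_space W" and f: "clinear_on V W f"
    and "finite A" "\<And>i. i \<in> A \<Longrightarrow> u i \<in> carrier V"
  shows "f (\<Oplus>\<^bsub>V\<^esub>i\<in>A. u i) = (\<Oplus>\<^bsub>W\<^esub>i\<in>A. f (u i))"
  using assms(4,5)
proof (induction A)
  interpret V: cspace V using V by (rule cspace.intro)
  interpret W: cspace W using W by (rule cspace.intro)
  {
    case empty
    then show ?case using clinear_on_zero[OF V W f] by simp
  next
    case (insert i A)
    have u: "u \<in> A \<rightarrow> carrier V" "u i \<in> carrier V" using insert.prems by auto
    have fu: "(\<lambda>i. f (u i)) \<in> A \<rightarrow> carrier W" "f (u i) \<in> carrier W"
      using insert.prems clinear_onD(1)[OF f] by auto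
    have "f (\<Oplus>\<^bsub>V\<^esub>i\<in>insert i A. u i) = f (u i \<oplus>\<^bsub>V\<^esub> (\<Oplus>\<^bsub>V\<^esub>i\<in>A. u i))"
      using V.M.finsum_insert[OF insert.hyps u] by simp
    also have "\<dots> = f (u i) \<oplus>\<^bsub>W\<^esub> f (\<Oplus>\<^bsub>V\<^esub>i\<in>A. u i)"
      using clinear_onD(2)[OF f] u V.M.finsum_closed by blast
    also have "\<dots> = (\<Oplus>\<^bsub>W\<^esub>i\<in>insert i A. f (u i))"
      using W.M.finsum_insert[OF insert.hyps fu] insert.IH insert.prems by simp
    finally show ?case .
  }
qed

lemma (in cspace) finsum_constant:
  assumes "finite A" "x \<in> carrier V"
  shows "(\<Oplus>\<^bsub>V\<^esub>i\<in>A. x) = of_nat (card A) \<odot> x"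
  using assms(1)
proof (induction A)
  case empty
  then show ?case using assms(2) by simp
next
  case (insert i A)
  have "(\<Oplus>\<^bsub>V\<^esub>i\<in>insert i A. x) = x \<oplus> of_nat (card A) \<odot> x"
    using insert assms(2) by (simp add: M.finsum_insert)
  also have "\<dots> = (1 + of_nat (card A)) \<odot> x"
    unfolding csmult_add_left[OF assms(2)] using assms(2) by simp
  finally show ?case using insert by simp
qed

lemma csubspace_finsum:
  assumes V: "cvector_space V" and Q: "csubspace V Q"
    and "finite A" "\<And>i. i \<in> A \<Longrightarrow> u i \<in> Q"
  shows "(\<Oplus>\<^bsub>V\<^esub>i\<in>A. u i) \<in> Q"
  using assms(3,4)
proof (induction A)
  interpret V: cspace V using V by (rule cspace.intro)
  note Q = csubspaceD[OF Q]
  {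
    case empty
    then show ?case using Q(2) by simp
  next
    case (insert i A)
    have u: "u \<in> A \<rightarrow> carrier V" "u i \<in> carrier V" using insert.prems Q(5) by auto
    show ?case using V.M.finsum_insert[OF insert.hyps u] insert Q(3) by simp
  }
qed

text \<open>For a linear projection \<open>p\<close> onto \<open>S\<close>, average the conjugates
  \<open>g p (inv g)\<close> over the cosets in \<open>L\<close> of an open subgroup
  \<open>H\<close>. All \<open>L\<close>-translates of \<open>x\<close> and their images under
  \<open>p\<close> are fixed by \<open>H\<close>, so on these vectors a conjugate depends only on
  the coset. Equivariance is obtained at \<open>x\<close> and not claimed on all of
  \<open>M\<close>.\<close>

lemma averaged_projection:
  fixes G (structure)
  assumes T: "topological_group G T" and M: "smooth_rep G T M" and S: "subrep G M S"
    and L: "compact_open_subgroup G T L" and x: "x \<in> carrier M"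
  obtains q where "clinear_on M M q" "\<And>z. z \<in> carrier M \<Longrightarrow> q z \<in> S" "\<And>z. z \<in> S \<Longrightarrow> q z = z"
    "\<And>a. gset a \<subseteq> L \<Longrightarrow> q (gact M a x) = gact M a (q x)"
proof -
  note TG = topological_groupD[OF T] and sM = smooth_representation[OF M]
  note MD = representationD[OF sM] and SD = subrepD[OF S]
  interpret group G by (rule TG)
  interpret M: cspace M using sM by (rule representationD)
  have cancel: "a \<otimes> (inv a \<otimes> b) = b" "inv a \<otimes> (a \<otimes> b) = b"
    if "a \<in> carrier G" "b \<in> carrier G" for a b using that by (simp_all flip: m_assoc)
  have L: "subgroup L G" "compactin T L" "openin T L" using L by (auto simp: compact_open_subgroup_def)
  note LG = subgroup.mem_carrier[OF L(1)]
  obtain p where p: "clinear_on M M p" "\<And>x. x \<in> carrier M \<Longrightarrow> p x \<in> S" "\<And>x. x \<in> S \<Longrightarrow> p x = x"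
    using M.linear_projection[OF SD(1)] by blast
  note pl = clinear_onD[OF p(1)]
  let ?O = "(\<lambda>g. act M g x) ` L"
  have OM: "?O \<subseteq> carrier M" using MD(5) LG x by blast
  \<comment> \<open>Finitely many translates of the open stabilizer of \<open>x\<close> cover
    \<open>L\<close>, so the orbit is finite.\<close>
  have finO: "finite ?O"
  proof -
    let ?H = "{g \<in> L. \<forall>y\<in>{x}. act M g y = y}"
    have "openin T ?H" by (rule stabilizer_open[OF T M]) (use x L in auto)
    moreover have "\<one> \<in> ?H" using subgroup.one_closed[OF L(1)] MD(3) x by simp
    ultimately obtain R where R: "finite R" "R \<subseteq> L"
      "\<And>g. g \<in> L \<Longrightarrow> \<exists>r\<in>R. inv r \<otimes> g \<in> ?H"
      by (rule finite_translates_cover[OF T L(2)]) (rule that)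
    have "?O \<subseteq> (\<lambda>g. act M g x) ` R"
    proof
      fix u assume "u \<in> ?O"
      then obtain g where g: "g \<in> L" "u = act M g x" by blast
      obtain r where r: "r \<in> R" "inv r \<otimes> g \<in> ?H" using R(3)[OF g(1)] by blast
      have rG: "r \<in> carrier G" "g \<in> carrier G" using r R(2) g LG by auto
      have "act M r (act M (inv r \<otimes> g) x) = act M (r \<otimes> (inv r \<otimes> g)) x"
        using rG x by (intro MD(4)[symmetric]) auto
      moreover have "r \<otimes> (inv r \<otimes> g) = g" using rG by (simp flip: m_assoc)
      ultimately have "u = act M r x" using r(2) g(2) by simp
      then show "u \<in> (\<lambda>g. act M g x) ` R" using r(1) by blast
    qed
    then show ?thesis using R(1) finite_surj by blast
  qed
  \<comment> \<open>The images under \<open>p\<close> are included because a conjugate of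
    \<open>p\<close> involves both a translate of \<open>x\<close> and the image of that
    translate.\<close>
  define Y where "Y = ?O \<union> p ` ?O"
  have Y: "finite Y" "Y \<subseteq> carrier M" using finO OM pl(1) by (auto simp: Y_def)
  define H where "H = {g \<in> L. \<forall>y\<in>Y. act M g y = y}"
  have H: "subgroup H G" "openin T H"
    unfolding H_def using stabilizer_subgroup[OF TG(1) sM Y(2) L(1)] stabilizer_open[OF T M Y L(3)] .
  have HL: "h \<in> L" if "h \<in> H" for h using that by (simp add: H_def)
  \<comment> \<open>The left coset \<open>g H\<close> as a set. Indexing the average by cosets turns
    left translation into a permutation of the index set.\<close>
  define \<kappa> where "\<kappa> g = {y \<in> L. inv g \<otimes> y \<in> H}" for g
  have \<kappa>_eq: "\<kappa> g = \<kappa> g' \<longleftrightarrow> inv g \<otimes> g' \<in> H" if g: "g \<in> L" "g' \<in> L" for g g'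
  proof
    have gG: "g \<in> carrier G" "g' \<in> carrier G" using g LG by auto
    {
      assume eq: "\<kappa> g = \<kappa> g'"
      have "g' \<in> \<kappa> g'" using g gG subgroup.one_closed[OF H(1)] by (simp add: \<kappa>_def)
      then have "g' \<in> \<kappa> g" using eq by simp
      then show "inv g \<otimes> g' \<in> H" by (simp add: \<kappa>_def)
    next
      assume h: "inv g \<otimes> g' \<in> H"
      have "inv g \<otimes> y \<in> H \<longleftrightarrow> inv g' \<otimes> y \<in> H" if "y \<in> L" for y
      proof
        have yG: "y \<in> carrier G" using that LG by simp
        assume a: "inv g \<otimes> y \<in> H"
        have "inv (inv g \<otimes> g') \<otimes> (inv g \<otimes> y) = inv g' \<otimes> y"
          using gG yG by (simp add: inv_mult_group m_assoc cancel)
        then show "inv g' \<otimes> y \<in> H"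
          using subgroup.m_closed[OF H(1) subgroup.m_inv_closed[OF H(1) h] a] by simp
      next
        have yG: "y \<in> carrier G" using that LG by simp
        assume a: "inv g' \<otimes> y \<in> H"
        have "(inv g \<otimes> g') \<otimes> (inv g' \<otimes> y) = inv g \<otimes> y"
          using gG yG by (simp add: m_assoc cancel)
        then show "inv g \<otimes> y \<in> H"
          using subgroup.m_closed[OF H(1) h a] by simp
      qed
      then show "\<kappa> g = \<kappa> g'" by (auto simp: \<kappa>_def)
    }
  qed
  define C where "C = \<kappa> ` L"
  have finC: "finite C"
  proof -
    obtain R where R: "finite R" "R \<subseteq> L" "\<And>g. g \<in> L \<Longrightarrow> \<exists>r\<in>R. inv r \<otimes> g \<in> H"
      by (rule finite_translates_cover[OF T L(2) H(2) subgroup.one_closed[OF H(1)]]) (rule that)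
    have "C \<subseteq> \<kappa> ` R"
    proof
      fix c assume "c \<in> C"
      then obtain g where g: "g \<in> L" "c = \<kappa> g" by (auto simp: C_def)
      obtain r where "r \<in> R" "inv r \<otimes> g \<in> H" using R(3)[OF g(1)] by blast
      then have "\<kappa> r = c" using \<kappa>_eq[of r g] R(2) g by auto
      then show "c \<in> \<kappa> ` R" using \<open>r \<in> R\<close> by blast
    qed
    then show ?thesis using R(1) finite_surj by blast
  qed
  have Cne: "C \<noteq> {}" using subgroup.one_closed[OF L(1)] by (auto simp: C_def)
  define n where "n = (of_nat (card C) :: complex)"
  have n: "n \<noteq> 0" using finC Cne by (simp add: n_def)
  \<comment> \<open>For arbitrary vectors the average below may depend on these representatives, but
    its linearity and its being a projection onto \<open>S\<close> hold for any choice.\<close>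
  define r where "r c = (SOME g. g \<in> L \<and> \<kappa> g = c)" for c
  have r: "r c \<in> L" "\<kappa> (r c) = c" if "c \<in> C" for c
  proof -
    have "\<exists>g. g \<in> L \<and> \<kappa> g = c" using that by (auto simp: C_def)
    from someI_ex[OF this] show "r c \<in> L" "\<kappa> (r c) = c" by (simp_all add: r_def)
  qed
  define \<phi> where "\<phi> z g = act M g (p (act M (inv g) z))" for z g
  have \<phi>S: "\<phi> z g \<in> S" if "z \<in> carrier M" "g \<in> L" for z g
    unfolding \<phi>_def by (intro SD(2) p(2) MD(5)) (use that LG in auto)
  have \<phi>M: "\<phi> z g \<in> carrier M" if "z \<in> carrier M" "g \<in> L" for z g
    using csubspaceD(5)[OF SD(1) \<phi>S[OF that]] .
  have \<phi>lin: "\<phi> (y \<oplus>\<^bsub>M\<^esub> z) g = \<phi> y g \<oplus>\<^bsub>M\<^esub> \<phi> z g" "\<phi> (c \<odot>\<^bsub>M\<^esub> y) g = c \<odot>\<^bsub>M\<^esub> \<phi> y g"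
    if "y \<in> carrier M" "z \<in> carrier M" "g \<in> L" for y z g c
    using that LG[OF that(3)] pl MD(5) clinear_onD[OF MD(2)] by (simp_all add: \<phi>_def)
  define q where "q z = inverse n \<odot>\<^bsub>M\<^esub> (\<Oplus>\<^bsub>M\<^esub>c\<in>C. \<phi> z (r c))" for z
  have \<phi>r: "(\<lambda>c. \<phi> z (r c)) \<in> C \<rightarrow> carrier M" if "z \<in> carrier M" for z
    using \<phi>M r that by blast
  have q_lin: "clinear_on M M q"
  proof (rule clinear_onI)
    show "q z \<in> carrier M" if "z \<in> carrier M" for z
      unfolding q_def using \<phi>r[OF that] by (intro M.csmult_closed M.M.finsum_closed)
  next
    fix y z assume yz: "y \<in> carrier M" "z \<in> carrier M"
    have "(\<Oplus>\<^bsub>M\<^esub>c\<in>C. \<phi> (y \<oplus>\<^bsub>M\<^esub> z) (r c)) = (\<Oplus>\<^bsub>M\<^esub>c\<in>C. \<phi> y (r c) \<oplus>\<^bsub>M\<^esub> \<phi> z (r c))"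
      using yz r \<phi>lin \<phi>M by (intro M.M.finsum_cong') auto
    also have "\<dots> = (\<Oplus>\<^bsub>M\<^esub>c\<in>C. \<phi> y (r c)) \<oplus>\<^bsub>M\<^esub> (\<Oplus>\<^bsub>M\<^esub>c\<in>C. \<phi> z (r c))"
      by (rule M.M.finsum_addf[OF \<phi>r[OF yz(1)] \<phi>r[OF yz(2)]])
    finally show "q (y \<oplus>\<^bsub>M\<^esub> z) = q y \<oplus>\<^bsub>M\<^esub> q z"
      unfolding q_def using M.M.finsum_closed[OF \<phi>r[OF yz(1)]] M.M.finsum_closed[OF \<phi>r[OF yz(2)]]
      by (simp add: M.csmult_add_right)
  next
    fix c y assume y: "y \<in> carrier M"
    have "(\<Oplus>\<^bsub>M\<^esub>d\<in>C. \<phi> (c \<odot>\<^bsub>M\<^esub> y) (r d)) = (\<Oplus>\<^bsub>M\<^esub>d\<in>C. c \<odot>\<^bsub>M\<^esub> \<phi> y (r d))"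
      using y r \<phi>lin \<phi>M by (intro M.M.finsum_cong') auto
    also have "\<dots> = c \<odot>\<^bsub>M\<^esub> (\<Oplus>\<^bsub>M\<^esub>d\<in>C. \<phi> y (r d))"
      by (rule M.finsum_smult_ldistr[symmetric, OF finC _ \<phi>r[OF y]]) simp
    finally show "q (c \<odot>\<^bsub>M\<^esub> y) = c \<odot>\<^bsub>M\<^esub> q y"
      unfolding q_def using M.M.finsum_closed[OF \<phi>r[OF y]] by (simp add: M.csmult_assoc mult.commute)
  qed
  have q_S: "q z \<in> S" if "z \<in> carrier M" for z
    unfolding q_def
    by (intro csubspaceD(4)[OF SD(1)] csubspace_finsum[OF M.cvector_space SD(1) finC] \<phi>S that r)
  have q_id: "q z = z" if z: "z \<in> S" for z
  proof -
    have zM: "z \<in> carrier M" using csubspaceD(5)[OF SD(1) z] .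
    have "\<phi> z g = z" if g: "g \<in> L" for g
    proof -
      have "\<phi> z g = act M g (act M (inv g) z)"
        unfolding \<phi>_def using p(3) SD(2)[OF inv_closed[OF LG[OF g]] z] by simp
      also have "\<dots> = act M (g \<otimes> inv g) z"
        using MD(4)[OF LG[OF g] inv_closed[OF LG[OF g]] zM] by simp
      finally show ?thesis using LG[OF g] MD(3)[OF zM] by simp
    qed
    then have "(\<Oplus>\<^bsub>M\<^esub>c\<in>C. \<phi> z (r c)) = (\<Oplus>\<^bsub>M\<^esub>c\<in>C. z)"
      using r zM by (intro M.M.finsum_cong') auto
    also have "\<dots> = n \<odot>\<^bsub>M\<^esub> z" unfolding n_def by (rule M.finsum_constant[OF finC zM])
    finally show ?thesis unfolding q_def using n zM by (simp add: M.csmult_assoc)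
  qed
  \<comment> \<open>The subspace on which the conjugates depend only on cosets. It contains
    \<open>x\<close> and is stable under \<open>L\<close>, so \<open>gact M a x\<close> stays inside
    it for every expression \<open>a\<close> over \<open>L\<close>.\<close>
  define Z where "Z = {z \<in> carrier M. \<forall>h\<in>H. \<forall>g\<in>L. act M h (act M g z) = act M g z \<and>
      act M h (p (act M g z)) = p (act M g z)}"
  have Zsub: "csubspace M Z"
  proof (rule csubspaceI)
    show "\<zero>\<^bsub>M\<^esub> \<in> Z"
      using clinear_on_zero[OF M.cvector_space M.cvector_space MD(2)] LG HL
        clinear_on_zero[OF M.cvector_space M.cvector_space p(1)] by (simp add: Z_def)
    show "y \<oplus>\<^bsub>M\<^esub> z \<in> Z" if "y \<in> Z" "z \<in> Z" for y z
      using that LG HL pl MD(5) clinear_onD[OF MD(2)] by (simp add: Z_def)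
    show "c \<odot>\<^bsub>M\<^esub> z \<in> Z" if "z \<in> Z" for c z
      using that LG HL pl MD(5) clinear_onD[OF MD(2)] by (simp add: Z_def)
  qed (auto simp: Z_def)
  have Zact: "act M k z \<in> Z" if k: "k \<in> L" and z: "z \<in> Z" for k z
  proof -
    have zM: "z \<in> carrier M" using z by (simp add: Z_def)
    have "act M g (act M k z) = act M (g \<otimes> k) z" if "g \<in> L" for g
      using MD(4)[OF LG[OF that] LG[OF k] zM] by simp
    then show ?thesis
      using z MD(5)[OF LG[OF k] zM] subgroup.m_closed[OF L(1) _ k] by (simp add: Z_def)
  qed
  have xZ: "x \<in> Z"
    using x by (auto simp: Z_def H_def Y_def)
  \<comment> \<open>Replacing \<open>g\<close> by \<open>g h\<close> changes nothing:
    \<open>inv h\<close> fixes the vector \<open>inv g z\<close>, and \<open>h\<close> fixes its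
    image under \<open>p\<close>.\<close>
  have \<phi>const: "\<phi> z g = \<phi> z g'" if z: "z \<in> Z" and g: "g \<in> L" "g' \<in> L" and eq: "\<kappa> g = \<kappa> g'" for z g g'
  proof -
    define h where "h = inv g \<otimes> g'"
    have h: "h \<in> H" using \<kappa>_eq[OF g] eq by (simp add: h_def)
    have gG: "g \<in> carrier G" "g' \<in> carrier G" "h \<in> carrier G" using g LG HL[OF h] by auto
    have g': "g' = g \<otimes> h" using gG by (simp add: h_def cancel)
    have zM: "z \<in> carrier M" using z by (simp add: Z_def)
    let ?u = "act M (inv g) z"
    have u: "?u \<in> carrier M" using MD(5) gG zM by simp
    have inv: "inv h \<in> H" "inv g \<in> L"
      using subgroup.m_inv_closed[OF H(1) h] subgroup.m_inv_closed[OF L(1) g(1)] by auto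
    have "act M (inv g') z = act M (inv h) ?u"
      unfolding g' using gG zM by (simp add: inv_mult_group MD(4))
    also have "\<dots> = ?u" using z inv by (simp add: Z_def)
    finally have *: "act M (inv g') z = ?u" .
    have "\<phi> z g' = act M g' (p ?u)" unfolding \<phi>_def * ..
    also have "\<dots> = act M g (act M h (p ?u))" unfolding g' using MD(4)[OF gG(1,3) pl(1)[OF u]] .
    also have "act M h (p ?u) = p ?u" using z inv(2) h by (simp add: Z_def)
    finally show ?thesis by (simp add: \<phi>_def)
  qed
  have q_act: "q (act M k z) = act M k (q z)" if k: "k \<in> L" and z: "z \<in> Z" for k z
  proof -
    have zM: "z \<in> carrier M" using z by (simp add: Z_def)
    have kG: "k \<in> carrier G" "inv k \<in> carrier G" using LG[OF k] by auto
    have ik: "inv k \<in> L" using subgroup.m_inv_closed[OF L(1) k] .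
    \<comment> \<open>Writing a representative \<open>r\<close> as \<open>k (inv k r)\<close> pulls
      \<open>k\<close> out of the corresponding summand and moves the index by \<open>inv k\<close>,
      which permutes the cosets.\<close>
    define \<sigma> where "\<sigma> c = \<kappa> (inv k \<otimes> r c)" for c
    have kr: "inv k \<otimes> r c \<in> L" if "c \<in> C" for c
      using subgroup.m_closed[OF L(1) ik r(1)[OF that]] .
    have \<sigma>C: "\<sigma> c \<in> C" if "c \<in> C" for c using kr[OF that] by (auto simp: C_def \<sigma>_def)
    have inj: "inj_on \<sigma> C"
    proof (rule inj_onI)
      fix c d assume cd: "c \<in> C" "d \<in> C" "\<sigma> c = \<sigma> d"
      have rG: "r c \<in> carrier G" "r d \<in> carrier G" using r(1) cd LG by auto
      have "inv (inv k \<otimes> r c) \<otimes> (inv k \<otimes> r d) \<in> H"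
        using \<kappa>_eq[OF kr[OF cd(1)] kr[OF cd(2)]] cd(3) by (simp add: \<sigma>_def)
      moreover have "inv (inv k \<otimes> r c) \<otimes> (inv k \<otimes> r d)
          = inv (r c) \<otimes> r d"
        using kG rG by (simp add: inv_mult_group m_assoc cancel)
      ultimately have "inv (r c) \<otimes> r d \<in> H" by simp
      then show "c = d" using \<kappa>_eq[OF r(1)[OF cd(1)] r(1)[OF cd(2)]] r(2) cd by simp
    qed
    have \<sigma>_im: "\<sigma> ` C = C"
      using \<sigma>C by (intro endo_inj_surj[OF finC _ inj]) auto
    have 1: "\<phi> (act M k z) (r c) = act M k (\<phi> z (r (\<sigma> c)))" if c: "c \<in> C" for c
    proof -
      let ?g = "inv k \<otimes> r c"
      have rG: "r c \<in> carrier G" using r(1)[OF c] LG by auto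
      have g: "?g \<in> carrier G" "inv ?g = inv (r c) \<otimes> k" "r c = k \<otimes> ?g"
        using rG kG by (simp_all add: inv_mult_group cancel)
      have e: "act M (inv ?g) z = act M (inv (r c)) (act M k z)"
        unfolding g(2) by (rule MD(4)) (use rG kG zM in auto)
      have u: "act M (inv ?g) z \<in> carrier M" using MD(5) g(1) zM by simp
      have "\<phi> (act M k z) (r c) = act M (k \<otimes> ?g) (p (act M (inv ?g) z))"
        unfolding \<phi>_def e g(3)[symmetric] ..
      also have "\<dots> = act M k (\<phi> z ?g)"
        unfolding \<phi>_def by (rule MD(4)[OF kG(1) g(1) pl(1)[OF u]])
      also have "\<phi> z ?g = \<phi> z (r (\<sigma> c))"
        by (rule \<phi>const[OF z kr[OF c] r(1)[OF \<sigma>C[OF c]]]) (use r(2)[OF \<sigma>C[OF c]] in \<open>simp add: \<sigma>_def\<close>)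
      finally show ?thesis .
    qed
    have \<phi>\<sigma>: "(\<lambda>c. \<phi> z (r (\<sigma> c))) \<in> C \<rightarrow> carrier M" using \<phi>r[OF zM] \<sigma>C by blast
    have "(\<Oplus>\<^bsub>M\<^esub>c\<in>C. \<phi> (act M k z) (r c)) = (\<Oplus>\<^bsub>M\<^esub>c\<in>C. act M k (\<phi> z (r (\<sigma> c))))"
      using 1 \<phi>\<sigma> MD(5)[OF kG(1)] by (intro M.M.finsum_cong') auto
    also have "\<dots> = act M k (\<Oplus>\<^bsub>M\<^esub>c\<in>C. \<phi> z (r (\<sigma> c)))"
      using \<phi>\<sigma> by (intro clinear_on_finsum[symmetric] M.cvector_space MD(2) kG finC) auto
    also have "(\<Oplus>\<^bsub>M\<^esub>c\<in>C. \<phi> z (r (\<sigma> c))) = (\<Oplus>\<^bsub>M\<^esub>c\<in>\<sigma> ` C. \<phi> z (r c))"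
      by (rule M.M.finsum_reindex[symmetric]) (use \<phi>r[OF zM] \<sigma>_im inj in auto)
    finally have "(\<Oplus>\<^bsub>M\<^esub>c\<in>C. \<phi> (act M k z) (r c)) = act M k (\<Oplus>\<^bsub>M\<^esub>c\<in>C. \<phi> z (r c))"
      unfolding \<sigma>_im .
    then show ?thesis
      unfolding q_def using clinear_onD(3)[OF MD(2)[OF kG(1)]] M.M.finsum_closed[OF \<phi>r[OF zM]] by simp
  qed
  show thesis
  proof (rule that[OF q_lin q_S q_id])
    show "q (gact M a x) = gact M a (q x)" if a: "gset a \<subseteq> L" for a
      using gact_commute[OF Zsub q_lin, where a = a and x = x] Zact q_act xZ a by blast
  qed
qed

section \<open>Irreducible quotients\<close>

lemma lc_groupD:
  assumes "lc_group G T"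
  shows "topological_group G T" "group G"
    "\<And>g. g \<in> carrier G \<Longrightarrow> \<exists>K. compact_open_subgroup G T K \<and> g \<in> K"
    "\<And>K L. compact_open_subgroup G T K \<Longrightarrow> compact_open_subgroup G T L \<Longrightarrow>
      \<exists>N. compact_open_subgroup G T N \<and> K \<subseteq> N \<and> L \<subseteq> N"
  using assms by (auto simp: lc_group_def l_group_def topological_group_def)

text \<open>Each element lies in some compact open subgroup, and filteredness merges these one after
  another with \<open>K\<close>.\<close>

lemma compact_open_subgroup_finite:
  assumes G: "lc_group G T" and "finite X" "X \<subseteq> carrier G" and K: "compact_open_subgroup G T K"
  shows "\<exists>L. compact_open_subgroup G T L \<and> X \<subseteq> L \<and> K \<subseteq> L"
  using assms(2,3)
proof (induction X)
  case empty
  then show ?case using K by blast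
next
  case (insert x X)
  then obtain L where L: "compact_open_subgroup G T L" "X \<subseteq> L" "K \<subseteq> L" by auto
  have "x \<in> carrier G" using insert.prems by simp
  from lc_groupD(3)[OF G this] obtain N where N: "compact_open_subgroup G T N" "x \<in> N" by auto
  from lc_groupD(4)[OF G L(1) N(1)] obtain N' where "compact_open_subgroup G T N'" "L \<subseteq> N'" "N \<subseteq> N'"
    by auto
  then show ?case using L N(2) by (intro exI[of _ N']) auto
qed

text \<open>The stabilizer of \<open>x\<close> inside any compact open subgroup serves as
  \<open>K\<close>; so the spaces of fixed vectors exhaust \<open>M\<close>.\<close>

lemma invariants_stabilizer:
  assumes G: "lc_group G T" and M: "smooth_rep G T M" and x: "x \<in> carrier M"
  obtains K where "compact_open_subgroup G T K" "x \<in> invariants M K"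
proof -
  interpret group G using G by (rule lc_groupD)
  from lc_groupD(3)[OF G one_closed] obtain K where "compact_open_subgroup G T K" by auto
  from compact_stabilizer[OF lc_groupD(1)[OF G] M x this]
  show thesis by (rule that) (use x in \<open>simp add: invariants_def\<close>)
qed

lemma invariants_subset: "invariants M K \<subseteq> carrier M"
  by (auto simp: invariants_def)

lemma irrepsD:
  assumes "\<sigma> \<in> irreps G T"
  shows "smooth_rep G T \<sigma>" "irreducible_rep G \<sigma>" "representation G \<sigma>"
  using assms by (auto simp: irreps_def smooth_rep_def)

lemma tame_invariants:
  fixes \<sigma> :: "('g, 'u) rep"
  assumes "tame TYPE('u) G T" "\<sigma> \<in> irreps G T" "compact_open_subgroup G T K"
  obtains bs where "set bs \<subseteq> invariants \<sigma> K" "invariants \<sigma> K \<subseteq> lspan \<sigma> bs"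
proof -
  have fd: "finite_dimensional \<sigma> (invariants \<sigma> K)"
    using assms by (auto simp: tame_def admissible_rep_def)
  show thesis
    by (rule finite_dimensional_lspan[OF representationD(1)[OF irrepsD(3)[OF assms(2)]] fd invariants_subset])
      (rule that)
qed

text \<open>A nonzero subrepresentation contains \<open>z\<close>, and \<open>z\<close> generates
  everything.\<close>

lemma irreducible_if_generates:
  assumes "group G" "representation G M" "z \<in> carrier M" "z \<noteq> \<zero>\<^bsub>M\<^esub>"
    and "\<And>x. x \<in> carrier M \<Longrightarrow> x \<noteq> \<zero>\<^bsub>M\<^esub> \<Longrightarrow> \<exists>a. gset a \<subseteq> carrier G \<and> gact M a x = z"
    and "\<And>x. x \<in> carrier M \<Longrightarrow> \<exists>a. gset a \<subseteq> carrier G \<and> gact M a z = x"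
  shows "irreducible_rep G M"
  unfolding irreducible_rep_iff
proof (intro conjI allI impI)
  fix N assume N: "subrep G M N"
  note N' = csubspaceD[OF subrepD(1)[OF N]]
  show "N = {\<zero>\<^bsub>M\<^esub>} \<or> N = carrier M"
  proof (cases "N = {\<zero>\<^bsub>M\<^esub>}")
    case False
    then obtain x where x: "x \<in> N" "x \<noteq> \<zero>\<^bsub>M\<^esub>" using N'(2) by blast
    then obtain a where "gset a \<subseteq> carrier G" "gact M a x = z" using assms(5) N'(5) by blast
    then have "z \<in> N" using gact_subrep[OF N _ x(1)] by blast
    have "carrier M \<subseteq> N"
    proof
      fix y assume "y \<in> carrier M"
      then obtain b where "gset b \<subseteq> carrier G" "gact M b z = y" using assms(6) by blast
      then show "y \<in> N" using gact_subrep[OF N _ \<open>z \<in> N\<close>] by blast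
    qed
    then show ?thesis using N'(1) by blast
  qed simp
qed (use assms in auto)

theorem monolithic_irreducible:
  fixes M :: "('g, 'u) rep"
  assumes G: "lc_group G T" and tame: "tame TYPE('u) G T" and M: "smooth_rep G T M"
    and z: "z \<in> carrier M" "z \<noteq> \<zero>\<^bsub>M\<^esub>"
    and min: "\<And>Q. subrep G M Q \<Longrightarrow> Q \<noteq> {\<zero>\<^bsub>M\<^esub>} \<Longrightarrow> z \<in> Q"
  shows "irreducible_rep G M"
proof -
  have T: "topological_group G T" and grp: "group G" using G by (auto dest: lc_groupD)
  have rM: "representation G M" using M by (rule smooth_representation)
  interpret M: cspace M using rM by (rule representationD)
  define S where "S = {gact M a z | a. gset a \<subseteq> carrier G}"
  have S: "subrep G M S" "z \<in> S" unfolding S_def by (rule subrep_cyclic[OF grp rM z(1)])+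
  note SD = csubspaceD[OF subrepD(1)[OF S(1)]]
  let ?\<sigma> = "M\<lparr>carrier := S\<rparr>"
  have r\<sigma>: "representation G ?\<sigma>" by (rule restrict_rep[OF rM S(1)])
  \<comment> \<open>A nonzero \<open>x\<close> generates a nonzero subrepresentation, which contains
    \<open>z\<close> by minimality.\<close>
  have gen: "\<exists>a. gset a \<subseteq> carrier G \<and> gact M a x = z" if "x \<in> carrier M" "x \<noteq> \<zero>\<^bsub>M\<^esub>" for x
  proof -
    have "z \<in> {gact M a x | a. gset a \<subseteq> carrier G}"
      by (rule min) (use subrep_cyclic[OF grp rM that(1)] that(2) in blast)+
    then show ?thesis by blast
  qed
  have irr: "irreducible_rep G ?\<sigma>"
  proof (rule irreducible_if_generates[OF grp r\<sigma>])
    show "z \<in> carrier ?\<sigma>" using S by simp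
    show "z \<noteq> \<zero>\<^bsub>?\<sigma>\<^esub>" using z by simp
    show "\<exists>a. gset a \<subseteq> carrier G \<and> gact ?\<sigma> a x = z" if "x \<in> carrier ?\<sigma>" "x \<noteq> \<zero>\<^bsub>?\<sigma>\<^esub>" for x
      using gen[of x] that SD(5) by simp
    show "\<exists>a. gset a \<subseteq> carrier G \<and> gact ?\<sigma> a z = x" if "x \<in> carrier ?\<sigma>" for x
      using that by (auto simp: S_def)
  qed
  have \<sigma>: "?\<sigma> \<in> irreps G T"
    using restrict_smooth[OF M S(1)] irr by (simp add: irreps_def)
  \<comment> \<open>A nonzero image contains \<open>z\<close>, say \<open>z = \<theta> s\<close>; by
    irreducibility \<open>y = a s\<close>, and \<open>\<theta> y = a z\<close> lies in
    \<open>S\<close>. So sums of homomorphic images of \<open>S\<close> never leave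
    \<open>S\<close>.\<close>
  have im: "\<theta> y \<in> S" if \<theta>: "\<theta> \<in> intertwiners G ?\<sigma> M" and y: "y \<in> S" for \<theta> y
  proof (cases "\<theta> ` S = {\<zero>\<^bsub>M\<^esub>}")
    case True
    then have "\<theta> y = \<zero>\<^bsub>M\<^esub>" using y by blast
    then show ?thesis using SD(2) by simp
  next
    case False
    then have "z \<in> \<theta> ` S" using min[OF subrep_image[OF r\<sigma> rM \<theta>]] by simp
    then obtain s where s: "s \<in> S" "\<theta> s = z" by blast
    have "\<zero>\<^bsub>M\<^esub> = \<theta> \<zero>\<^bsub>M\<^esub>" using intertwiners_zero[OF r\<sigma> rM \<theta>] by simp
    then have "s \<noteq> \<zero>\<^bsub>M\<^esub>" using s z(2) by metis
    then obtain a where a: "gset a \<subseteq> carrier G" "y = gact M a s"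
      using irreducible_cyclic[OF grp irr, of s y] s(1) y by auto
    have "\<theta> y = gact M a z"
      using gact_intertwiner[OF r\<sigma> a(1) _ \<theta>, of s] s a(2) by simp
    then show ?thesis using gact_subrep[OF S(1) a(1) S(2)] by simp
  qed
  have "x \<in> S" if x: "x \<in> carrier M" for x
  proof -
    obtain K where K: "compact_open_subgroup G T K" "x \<in> invariants M K"
      using invariants_stabilizer[OF G M x] .
    obtain bs where bs: "set bs \<subseteq> invariants ?\<sigma> K" "invariants ?\<sigma> K \<subseteq> lspan ?\<sigma> bs"
      using tame_invariants[OF tame \<sigma> K(1)] .
    have bsS: "set bs \<subseteq> carrier ?\<sigma>" by (rule order_trans[OF bs(1) invariants_subset])
    have "x \<in> hsum G ?\<sigma> M bs"
    proof (rule ann_imp_hsum[OF grp irr rM bsS x])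
      fix a assume a: "a \<in> ann G ?\<sigma> bs"
      note aG = annD(1)[OF a]
      show "gact M a x = \<zero>\<^bsub>M\<^esub>"
      proof (rule ccontr)
        assume "gact M a x \<noteq> \<zero>\<^bsub>M\<^esub>"
        from gen[OF gact_closed[OF rM aG x] this] obtain b
          where b: "gset b \<subseteq> carrier G" "gact M b (gact M a x) = z" by auto
        \<comment> \<open>The subgroup \<open>L\<close> is to contain both \<open>K\<close> and the
          group elements of \<open>b a\<close>: the projection \<open>q\<close> for \<open>L\<close>
          then commutes with \<open>b a\<close> at \<open>x\<close>, and \<open>q x\<close> is still
          fixed by \<open>K\<close>.\<close>
        have "gset (Mult b a) \<subseteq> carrier G" using aG b(1) by simp
        from compact_open_subgroup_finite[OF G finite_gset this K(1)] obtain L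
          where L: "compact_open_subgroup G T L" "gset (Mult b a) \<subseteq> L" "K \<subseteq> L" by auto
        obtain q where q: "clinear_on M M q" "\<And>z. z \<in> carrier M \<Longrightarrow> q z \<in> S"
          "\<And>z. z \<in> S \<Longrightarrow> q z = z" "\<And>a. gset a \<subseteq> L \<Longrightarrow> q (gact M a x) = gact M a (q x)"
          by (rule averaged_projection[OF T M S(1) L(1) x]) (rule that)
        have "act M k (q x) = q x" if k: "k \<in> K" for k
        proof -
          have "act M k (q x) = q (act M k x)" using q(4)[of "Single k"] k L(3) by auto
          also have "act M k x = x" using K(2) k by (simp add: invariants_def)
          finally show ?thesis .
        qed
        then have "q x \<in> invariants ?\<sigma> K" using q(2)[OF x] by (simp add: invariants_def)
        then have qx: "q x \<in> lspan ?\<sigma> bs" by (rule subsetD[OF bs(2)])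
        have "gact ?\<sigma> a (q x) = \<zero>\<^bsub>?\<sigma>\<^esub>"
          by (rule clinear_on_lspan_zero[OF representationD(1)[OF r\<sigma>] representationD(1)[OF r\<sigma>]
                clinear_on_gact[OF r\<sigma> aG] bsS annD(2)[OF a] qx])
        then have "gact M (Mult b a) (q x) = \<zero>\<^bsub>M\<^esub>" using gact_zero[OF rM b(1)] by simp
        then have "q z = \<zero>\<^bsub>M\<^esub>" using q(4)[OF L(2)] b(2) by simp
        then show False using q(3)[OF S(2)] z(2) by simp
      qed
    qed
    then show "x \<in> S" using bsS
    proof (induction bs arbitrary: x)
      case Nil
      then show ?case using SD(2) by simp
    next
      case (Cons y ys)
      then show ?case using im SD(3) by auto
    qed
  qed
  then have "S = carrier M" using SD(1) by blast
  then show ?thesis using irr by simp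
qed

text \<open>With \<open>g\<close> the stabilizer of \<open>x\<close> contains the open translate
  \<open>g (U x)\<close>; so a neighbourhood of the identity fixing \<open>x\<close> is
  enough.\<close>

lemma smooth_repI:
  assumes T: "topological_group G T" and M: "representation G M"
    and U: "\<And>x. x \<in> carrier M \<Longrightarrow> openin T (U x)" "\<And>x. x \<in> carrier M \<Longrightarrow> \<one>\<^bsub>G\<^esub> \<in> U x"
    "\<And>x g. x \<in> carrier M \<Longrightarrow> g \<in> U x \<Longrightarrow> act M g x = x"
  shows "smooth_rep G T M"
  unfolding smooth_rep_def
proof (intro conjI ballI M)
  fix x assume x: "x \<in> carrier M"
  interpret group G using T by (rule topological_groupD)
  let ?H = "{g \<in> carrier G. act M g x = x}"
  show "openin T ?H"
  proof (subst openin_subopen, intro ballI)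
    fix g assume g: "g \<in> ?H"
    then have gG: "g \<in> carrier G" by simp
    let ?V = "{y \<in> carrier G. inv\<^bsub>G\<^esub> g \<otimes>\<^bsub>G\<^esub> y \<in> U x}"
    have "openin T ?V" by (rule open_translate[OF T inv_closed[OF gG] U(1)[OF x]])
    moreover have "g \<in> ?V" using gG U(2)[OF x] by simp
    moreover have "?V \<subseteq> ?H"
    proof
      fix y assume y: "y \<in> ?V"
      have "g \<otimes>\<^bsub>G\<^esub> (inv\<^bsub>G\<^esub> g \<otimes>\<^bsub>G\<^esub> y) = y" using gG y by (simp flip: m_assoc)
      then have "act M y x = act M g (act M (inv\<^bsub>G\<^esub> g \<otimes>\<^bsub>G\<^esub> y) x)"
        using representationD(4)[OF M gG _ x, of "inv\<^bsub>G\<^esub> g \<otimes>\<^bsub>G\<^esub> y"] gG y by simp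
      also have "act M (inv\<^bsub>G\<^esub> g \<otimes>\<^bsub>G\<^esub> y) x = x" using y U(3)[OF x] by simp
      finally show "y \<in> ?H" using g y by simp
    qed
    ultimately show "\<exists>V. openin T V \<and> g \<in> V \<and> V \<subseteq> ?H" by blast
  qed
qed

text \<open>The quotient is realised on the kernel of a linear projection \<open>p\<close> onto
  \<open>Q\<close>, with \<open>f = 1 - p\<close> as quotient map and with \<open>g\<close> acting
  as \<open>f\<close> after \<open>act M g\<close>. Its carrier is therefore again a set of elements
  of \<open>'u\<close>.\<close>

lemma quotient_rep:
  fixes M :: "('g, 'u) rep"
  assumes M: "smooth_rep G T M" and T: "topological_group G T" and Q: "subrep G M Q"
  obtains N :: "('g, 'u) rep" and f where "smooth_rep G T N" "f \<in> intertwiners G M N"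
    "f ` carrier M = carrier N" "\<And>x. x \<in> carrier M \<Longrightarrow> f x = \<zero>\<^bsub>N\<^esub> \<longleftrightarrow> x \<in> Q"
proof -
  have rM: "representation G M" using M by (rule smooth_representation)
  note MD = representationD[OF rM] and QD = subrepD[OF Q]
  note QS = csubspaceD[OF QD(1)]
  interpret M: cspace M using rM by (rule representationD)
  obtain p where p: "clinear_on M M p" "\<And>x. x \<in> carrier M \<Longrightarrow> p x \<in> Q" "\<And>x. x \<in> Q \<Longrightarrow> p x = x"
    using M.linear_projection[OF QD(1)] by blast
  note pl = clinear_onD[OF p(1)]
  define f where "f x = x \<oplus>\<^bsub>M\<^esub> (- 1) \<odot>\<^bsub>M\<^esub> p x" for x
  define C where "C = {x \<in> carrier M. p x = \<zero>\<^bsub>M\<^esub>}"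
  define N where "N = M\<lparr>carrier := C, act := \<lambda>g x. f (act M g x)\<rparr>"
  have p0: "p \<zero>\<^bsub>M\<^esub> = \<zero>\<^bsub>M\<^esub>" by (rule clinear_on_zero[OF M.cvector_space M.cvector_space p(1)])
  have C: "csubspace M C"
    by (rule csubspaceI) (auto simp: C_def p0 pl)
  have fC: "f x \<in> C" if "x \<in> carrier M" for x
    using that pl p(2)[OF that] p(3) by (simp add: C_def f_def)
  have flin: "clinear_on M M f"
  proof (rule clinear_onI)
    show "f x \<in> carrier M" if "x \<in> carrier M" for x using fC[OF that] by (simp add: C_def)
    show "f (x \<oplus>\<^bsub>M\<^esub> y) = f x \<oplus>\<^bsub>M\<^esub> f y" if "x \<in> carrier M" "y \<in> carrier M" for x y
      using that pl by (simp add: f_def M.csmult_add_right M.M.a_ac)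
    show "f (c \<odot>\<^bsub>M\<^esub> x) = c \<odot>\<^bsub>M\<^esub> f x" if "x \<in> carrier M" for c x
      using that pl by (simp add: f_def M.csmult_add_right M.csmult_assoc mult.commute)
  qed
  note fl = clinear_onD[OF flin]
  have fQ: "f x = \<zero>\<^bsub>M\<^esub> \<longleftrightarrow> x \<in> Q" if "x \<in> carrier M" for x
  proof
    assume "f x = \<zero>\<^bsub>M\<^esub>"
    then have "x = p x" using M.add_minus_eq_zero[OF that pl(1)[OF that]] by (simp add: f_def)
    then show "x \<in> Q" using p(2)[OF that] by simp
  next
    assume "x \<in> Q"
    then show "f x = \<zero>\<^bsub>M\<^esub>" using p(3) that by (simp add: f_def)
  qed
  have fid: "f x = x" if "x \<in> C" for x using that by (simp add: f_def C_def)
  \<comment> \<open>\<open>x\<close> and \<open>f x\<close> differ by an element of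
    \<open>Q\<close>, which is stable under \<open>g\<close> and killed by \<open>f\<close>. This
    makes the new action multiplicative and \<open>f\<close> equivariant.\<close>
  have fact: "f (act M g (f x)) = f (act M g x)" if "g \<in> carrier G" "x \<in> carrier M" for g x
  proof -
    note lin = clinear_onD[OF MD(2)[OF that(1)]]
    have px: "p x \<in> carrier M" using pl that by simp
    have "act M g (f x) = act M g x \<oplus>\<^bsub>M\<^esub> (- 1) \<odot>\<^bsub>M\<^esub> act M g (p x)"
      unfolding f_def using lin px that by simp
    then have "f (act M g (f x)) = f (act M g x) \<oplus>\<^bsub>M\<^esub> (- 1) \<odot>\<^bsub>M\<^esub> f (act M g (p x))"
      using fl lin(1) px that by simp
    also have "f (act M g (p x)) = \<zero>\<^bsub>M\<^esub>"
      using fQ[OF lin(1)[OF px]] QD(2)[OF that(1) p(2)[OF that(2)]] by simp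
    finally show ?thesis using fl(1)[OF lin(1)[OF that(2)]] by simp
  qed
  have rN: "representation G N"
  proof (rule representationI)
    have "cvector_space (M\<lparr>carrier := C\<rparr>)" by (rule M.cvector_space_csubspace[OF C])
    then show "cvector_space N"
      unfolding N_def
      by (auto simp: Module.module_def abelian_group_def abelian_monoid_def abelian_group_axioms_def
          module_axioms_def)
    show "clinear_on N N (act N g)" if "g \<in> carrier G" for g
      by (rule clinear_onI)
        (use fC fl clinear_onD[OF MD(2)[OF that]] in \<open>auto simp: N_def C_def\<close>)
    show "act N \<one>\<^bsub>G\<^esub> x = x" if "x \<in> carrier N" for x
      using that MD(3) fid by (auto simp: N_def C_def)
    show "act N (g \<otimes>\<^bsub>G\<^esub> h) x = act N g (act N h x)"
      if "g \<in> carrier G" "h \<in> carrier G" "x \<in> carrier N" for g h x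
      using that MD(4)[of g h x] fact MD(5)[of h x] by (simp add: N_def C_def)
  qed
  have fi: "restrict f (carrier M) \<in> intertwiners G M N"
    by (rule intertwiners_restrictI[OF rM]) (use fC fl fact in \<open>auto simp: N_def\<close>)
  have im: "f ` carrier M = C" using fC fid C by (auto simp: C_def image_iff) metis
  show thesis
  proof (rule that)
    show "smooth_rep G T N"
    proof (rule smooth_repI[OF T rN])
      fix x assume "x \<in> carrier N"
      then have x: "x \<in> C" "x \<in> carrier M" by (simp_all add: N_def C_def)
      show "openin T {g \<in> carrier G. act M g x = x}" using M x(2) by (simp add: smooth_rep_def)
      show "\<one>\<^bsub>G\<^esub> \<in> {g \<in> carrier G. act M g x = x}"
        using MD(3)[OF x(2)] group.is_monoid[OF topological_groupD(1)[OF T]]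
        by (simp add: monoid.one_closed)
      show "act N g x = x" if "g \<in> {g \<in> carrier G. act M g x = x}" for g
        using that fid[OF x(1)] by (simp add: N_def)
    qed
    show "restrict f (carrier M) \<in> intertwiners G M N" by (rule fi)
    show "restrict f (carrier M) ` carrier M = carrier N" using im by (simp add: N_def)
    show "restrict f (carrier M) x = \<zero>\<^bsub>N\<^esub> \<longleftrightarrow> x \<in> Q" if "x \<in> carrier M" for x
      using that fQ by (simp add: N_def)
  qed
qed

text \<open>Divide by a subrepresentation that is maximal among those avoiding \<open>z\<close>: the
  preimage of a nonzero subrepresentation of the quotient is strictly larger and so contains
  \<open>z\<close>.\<close>

theorem irreducible_quotient:
  fixes M :: "('g, 'u) rep"
  assumes G: "lc_group G T" and tame: "tame TYPE('u) G T" and M: "smooth_rep G T M"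
    and z: "z \<in> carrier M" "z \<noteq> \<zero>\<^bsub>M\<^esub>"
  obtains \<sigma> :: "('g, 'u) rep" and f
  where "\<sigma> \<in> irreps G T" "f \<in> intertwiners G M \<sigma>" "f z \<noteq> \<zero>\<^bsub>\<sigma>\<^esub>"
proof -
  have T: "topological_group G T" and grp: "group G" using G by (auto dest: lc_groupD)
  have rM: "representation G M" using M by (rule smooth_representation)
  interpret M: cspace M using rM by (rule representationD)
  let ?A = "{Q. subrep G M Q \<and> z \<notin> Q}"
  have max: "\<exists>Q\<in>?A. \<forall>X\<in>?A. Q \<subseteq> X \<longrightarrow> X = Q"
  proof (rule subset_Zorn_nonempty)
    have "act M g \<zero>\<^bsub>M\<^esub> = \<zero>\<^bsub>M\<^esub>" if "g \<in> carrier G" for g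
      by (rule clinear_on_zero[OF M.cvector_space M.cvector_space representationD(2)[OF rM that]])
    then have "{\<zero>\<^bsub>M\<^esub>} \<in> ?A" using z by (auto simp: subrep_def intro!: csubspaceI)
    then show "?A \<noteq> {}" by blast
    fix \<C> assume \<C>: "\<C> \<noteq> {}" "subset.chain ?A \<C>"
    then have *: "subrep G M C" "z \<notin> C" if "C \<in> \<C>" for C
      using that by (auto simp: subset_chain_def)
    have "csubspace M (\<Union>\<C>)"
      by (rule M.csubspace_Union_chain) (use \<C> subrepD(1)[OF *(1)] in \<open>auto simp: subset_chain_def\<close>)
    moreover have "act M g x \<in> \<Union>\<C>" if "g \<in> carrier G" "x \<in> \<Union>\<C>" for g x
      using that subrepD(2)[OF *(1)] by auto
    ultimately show "\<Union>\<C> \<in> ?A" using *(2) by (auto simp: subrep_def)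
  qed
  obtain Q where "Q \<in> ?A" and max: "\<forall>X\<in>?A. Q \<subseteq> X \<longrightarrow> X = Q" using max by (rule bexE)
  then have Q: "subrep G M Q" "z \<notin> Q" by auto
  obtain N :: "('g, 'u) rep" and f where N: "smooth_rep G T N" "f \<in> intertwiners G M N"
    "f ` carrier M = carrier N" "\<And>x. x \<in> carrier M \<Longrightarrow> f x = \<zero>\<^bsub>N\<^esub> \<longleftrightarrow> x \<in> Q"
    by (rule quotient_rep[OF M T Q(1)]) (rule that)
  have rN: "representation G N" using N(1) by (rule smooth_representation)
  interpret N: cspace N using rN by (rule representationD)
  have fz: "f z \<noteq> \<zero>\<^bsub>N\<^esub>" using N(4)[OF z(1)] Q(2) by simp
  have "irreducible_rep G N"
  proof (rule monolithic_irreducible[OF G tame N(1) _ fz])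
    show "f z \<in> carrier N" using N(3) z(1) by blast
    fix R assume R: "subrep G N R" "R \<noteq> {\<zero>\<^bsub>N\<^esub>}"
    note RD = csubspaceD[OF subrepD(1)[OF R(1)]]
    let ?P = "{x \<in> carrier M. f x \<in> R}"
    have P: "subrep G M ?P" by (rule subrep_vimage[OF rM rN N(2) R(1)])
    have sub: "Q \<subseteq> ?P"
    proof
      fix x assume "x \<in> Q"
      then have "x \<in> carrier M" using csubspaceD(5)[OF subrepD(1)[OF Q(1)]] by simp
      moreover have "f x = \<zero>\<^bsub>N\<^esub>" using N(4)[OF calculation] \<open>x \<in> Q\<close> by simp
      ultimately show "x \<in> ?P" using RD(2) by simp
    qed
    have neq: "?P \<noteq> Q"
    proof
      assume eq: "?P = Q"
      obtain y where y: "y \<in> R" "y \<noteq> \<zero>\<^bsub>N\<^esub>" using R(2) RD(2) by blast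
      then have "y \<in> f ` carrier M" using RD(5) N(3) by simp
      then obtain x where x: "x \<in> carrier M" "y = f x" by blast
      then have "x \<in> Q" using y eq by blast
      then show False using N(4)[OF x(1)] x y by simp
    qed
    show "f z \<in> R"
    proof (rule ccontr)
      assume "f z \<notin> R"
      then have "?P \<in> ?A" using P by simp
      from bspec[OF max this] show False using sub neq by simp
    qed
  qed
  then have "N \<in> irreps G T" using N(1) by (simp add: irreps_def)
  then show thesis using that N(2) fz by blast
qed

section \<open>Schur's lemma\<close>

text \<open>Horner scheme: for coefficients \<open>a_0, a_1, ...\<close> of a polynomial
  \<open>p\<close> the value is \<open>a_0 v + f (a_1 v + f (...))\<close>, that is,
  \<open>p(f) v\<close>.\<close>

primrec krylov :: "(complex, 'u, 'm) module_scheme \<Rightarrow> ('u \<Rightarrow> 'u) \<Rightarrow> 'u \<Rightarrow> complex list \<Rightarrow> 'u" where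
  "krylov V f v [] = \<zero>\<^bsub>V\<^esub>"
| "krylov V f v (a # as) = a \<odot>\<^bsub>V\<^esub> v \<oplus>\<^bsub>V\<^esub> f (krylov V f v as)"

definition poly_at :: "(complex, 'u, 'm) module_scheme \<Rightarrow> ('u \<Rightarrow> 'u) \<Rightarrow> 'u \<Rightarrow> complex poly \<Rightarrow> 'u" where
  "poly_at V f v p = krylov V f v (coeffs p)"

context
  fixes V :: "(complex, 'u, 'm) module_scheme" (structure) and f v
  assumes V: "cvector_space V" and f: "clinear_on V V f" and v: "v \<in> carrier V"
begin

interpretation cspace V using V by (rule cspace.intro)

lemma poly_at_0: "poly_at V f v 0 = \<zero>"
  by (simp add: poly_at_def)

text \<open>The case \<open>a = 0\<close>, \<open>p = 0\<close> is separate because the zero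
  polynomial has the empty coefficient list; there the identity reduces to
  \<open>f 0 = 0\<close>.\<close>

lemma poly_at_pCons: "poly_at V f v (pCons a p) = a \<odot> v \<oplus> f (poly_at V f v p)"
  using v clinear_on_zero[OF V V f] by (cases "a = 0 \<and> p = 0") (auto simp: poly_at_def cCons_def)

lemma poly_at_closed: "poly_at V f v p \<in> carrier V"
  by (induction p) (use v clinear_onD(1)[OF f] in \<open>auto simp: poly_at_0 poly_at_pCons\<close>)

lemma poly_at_add: "poly_at V f v (p + q) = poly_at V f v p \<oplus> poly_at V f v q"
proof (induction p q rule: poly_induct2)
  case (pCons a p b q)
  have "poly_at V f v (pCons a p + pCons b q)
      = (a \<odot> v \<oplus> b \<odot> v) \<oplus> (f (poly_at V f v p) \<oplus> f (poly_at V f v q))"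
    using pCons clinear_onD(2)[OF f] poly_at_closed v by (simp add: poly_at_pCons csmult_add_left)
  also have "\<dots> = (a \<odot> v \<oplus> f (poly_at V f v p)) \<oplus> (b \<odot> v \<oplus> f (poly_at V f v q))"
    using clinear_onD(1)[OF f poly_at_closed] v by (simp add: M.a_ac)
  finally show ?case by (simp add: poly_at_pCons)
qed (simp add: poly_at_0)

lemma poly_at_smult: "poly_at V f v (Polynomial.smult c p) = c \<odot> poly_at V f v p"
  by (induction p)
    (use clinear_onD(1,3)[OF f] poly_at_closed v
      in \<open>auto simp: poly_at_0 poly_at_pCons csmult_add_right csmult_assoc\<close>)

text \<open>Write \<open>(X - r) q = - r q + X q\<close>, where \<open>X\<close> acts as
  \<open>f\<close>.\<close>

lemma poly_at_linear_factor:
  "poly_at V f v ([:- r, 1:] * q) = (- r) \<odot> poly_at V f v q \<oplus> f (poly_at V f v q)"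
proof -
  have "[:- r, 1:] * q = Polynomial.smult (- r) q + pCons 0 q" by simp
  then show ?thesis
    using clinear_onD(1)[OF f poly_at_closed, of q] v
    by (simp only: poly_at_add poly_at_smult poly_at_pCons) simp
qed

text \<open>An infinite-dimensional space of polynomials (here: one with unbounded degrees) cannot embed
  into a finitely generated space; each generator cuts the space down by at most one dimension.\<close>

lemma poly_at_dependent:
  assumes bs: "set bs \<subseteq> carrier V" and "U \<noteq> {}"
    and "\<And>p q c. p \<in> U \<Longrightarrow> q \<in> U \<Longrightarrow> p + Polynomial.smult c q \<in> U"
    and "\<And>n. \<exists>p\<in>U. degree p > n" and "\<And>p. p \<in> U \<Longrightarrow> poly_at V f v p \<in> lspan V bs"
  shows "\<exists>p\<in>U. p \<noteq> 0 \<and> poly_at V f v p = \<zero>"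
  using assms
proof (induction bs arbitrary: U)
  case Nil
  obtain p where "p \<in> U" "degree p > 0" using Nil(4) by blast
  then show ?case using Nil(5)[of p] by (intro bexI[of _ p]) auto
next
  case (Cons b bs)
  have bs: "set bs \<subseteq> carrier V" and b: "b \<in> carrier V" using Cons.prems(1) by auto
  note L = csubspaceD[OF csubspace_lspan[OF bs]]
  show ?case
  proof (cases "\<forall>p\<in>U. poly_at V f v p \<in> lspan V bs")
    case True
    then show ?thesis by (intro Cons.IH[OF bs Cons.prems(2,3,4)]) auto
  next
    case False
    \<comment> \<open>A pivot with a nonzero component along \<open>b\<close>: subtracting a
      multiple of it from a polynomial of larger degree moves the value into the span of
      \<open>bs\<close> and keeps the degree.\<close>
    then obtain p0 where p0: "p0 \<in> U" "poly_at V f v p0 \<notin> lspan V bs" by blast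
    obtain z0 c0 where z0: "z0 \<in> lspan V bs" "poly_at V f v p0 = z0 \<oplus> c0 \<odot> b"
      using Cons.prems(5)[OF p0(1)] by auto
    have c0: "c0 \<noteq> 0"
    proof
      assume "c0 = 0"
      then have "poly_at V f v p0 = z0" using z0(2) b L(5)[OF z0(1)] by simp
      then show False using p0(2) z0(1) by simp
    qed
    let ?U = "{p \<in> U. poly_at V f v p \<in> lspan V bs}"
    have deg: "\<exists>p\<in>?U. degree p > n" for n
    proof -
      obtain p where p: "p \<in> U" "degree p > max n (degree p0)" using Cons.prems(4) by blast
      obtain z c where z: "z \<in> lspan V bs" "poly_at V f v p = z \<oplus> c \<odot> b"
        using Cons.prems(5)[OF p(1)] by auto
      let ?p = "p + Polynomial.smult (- (c / c0)) p0"
      have zc: "z \<in> carrier V" "z0 \<in> carrier V" using L(5) z z0 by auto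
      have "poly_at V f v ?p = (z \<oplus> c \<odot> b) \<oplus> (- (c / c0)) \<odot> (z0 \<oplus> c0 \<odot> b)"
        unfolding poly_at_add poly_at_smult z z0 ..
      also have "\<dots> = (z \<oplus> c \<odot> b) \<oplus> ((- (c / c0)) \<odot> z0 \<oplus> (- c) \<odot> b)"
        using zc b c0 by (simp add: csmult_add_right csmult_assoc)
      also have "\<dots> = (z \<oplus> (- (c / c0)) \<odot> z0) \<oplus> (c + - c) \<odot> b"
        unfolding csmult_add_left[OF b] using zc b by (simp add: M.a_ac)
      also have "\<dots> = z \<oplus> (- (c / c0)) \<odot> z0" using zc b by simp
      finally have "poly_at V f v ?p \<in> lspan V bs" using L(3,4) z(1) z0(1) by simp
      moreover have "degree ?p = degree p"
        using p(2) by (intro degree_add_eq_left) (auto intro: le_less_trans[OF degree_smult_le])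
      ultimately show ?thesis using p Cons.prems(3)[OF p(1) p0(1), of "- (c / c0)"]
        by (intro bexI[of _ ?p]) (auto simp del: Polynomial.smult_minus_left)
    qed
    have "\<exists>p\<in>?U. p \<noteq> 0 \<and> poly_at V f v p = \<zero>"
    proof (rule Cons.IH[OF bs _ _ deg])
      show "?U \<noteq> {}" using deg[of 0] by blast
      show "p + Polynomial.smult c q \<in> ?U" if "p \<in> ?U" "q \<in> ?U" for p q c
        using that Cons.prems(3) L(3,4) by (simp add: poly_at_add poly_at_smult)
    qed auto
    then show ?thesis by blast
  qed
qed

text \<open>Take a nonzero \<open>p\<close> of least degree with \<open>p(f) v = 0\<close> and a
  root \<open>r\<close> of it. Then \<open>p = (X - r) q\<close>, and \<open>q(f) v\<close> is
  nonzero by minimality, hence an eigenvector. The finite bound concerns the vectors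
  \<open>p(f) v\<close> and not the whole space \<open>V\<close>.\<close>

lemma eigenvector_exists:
  assumes "v \<noteq> \<zero>" "set bs \<subseteq> carrier V" "\<And>p. poly_at V f v p \<in> lspan V bs"
  obtains w r where "w \<in> carrier V" "w \<noteq> \<zero>" "f w = r \<odot> w"
proof -
  let ?P = "\<lambda>p. p \<noteq> 0 \<and> poly_at V f v p = \<zero>"
  have "\<exists>p\<in>UNIV. ?P p"
  proof (rule poly_at_dependent[OF assms(2)])
    show "\<exists>p\<in>UNIV. n < degree (p :: complex poly)" for n
      by (rule bexI[of _ "monom 1 (Suc n)"]) (simp_all add: degree_monom_eq)
  qed (use assms in auto)
  then obtain p0 where "?P p0" by blast
  define p where "p = arg_min degree ?P"
  have p: "?P p" "\<And>q. ?P q \<Longrightarrow> degree p \<le> degree q"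
    using arg_min_nat_lemma[of ?P p0 degree] \<open>?P p0\<close> by (auto simp: p_def)
  have "\<not> constant (poly p)"
  proof
    assume "constant (poly p)"
    then have "degree p = 0" by (simp add: constant_degree)
    then obtain a where a: "p = [:a:]" by (rule degree_eq_zeroE)
    then have "a \<odot> v = \<zero>" using p(1) v clinear_on_zero[OF V V f] by (simp add: poly_at_pCons poly_at_0)
    then show False using csmult_eq_zero[OF v, of a] a p(1) assms(1) by auto
  qed
  then obtain r where "poly p r = 0" using fundamental_theorem_of_algebra by blast
  then obtain q where q: "p = [:- r, 1:] * q" using poly_eq_0_iff_dvd by (metis dvdE)
  have q0: "q \<noteq> 0" using q p(1) by auto
  have "degree p = Suc (degree q)" unfolding q using q0 by (subst degree_mult_eq) auto
  then have "\<not> ?P q" using p(2)[of q] by auto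
  then have w: "poly_at V f v q \<noteq> \<zero>" using q0 by simp
  have "(- r) \<odot> poly_at V f v q \<oplus> f (poly_at V f v q) = \<zero>"
    using p(1) poly_at_linear_factor[of r q] q by simp
  then have "f (poly_at V f v q) \<oplus> (- 1) \<odot> (r \<odot> poly_at V f v q) = \<zero>"
    using clinear_onD(1)[OF f poly_at_closed, of q] poly_at_closed[of q]
    by (simp add: csmult_assoc M.a_comm)
  then have "f (poly_at V f v q) = r \<odot> poly_at V f v q"
    by (rule add_minus_eq_zero[rotated 2])
      (use clinear_onD(1)[OF f poly_at_closed, of q] poly_at_closed[of q] in auto)
  then show thesis by (rule that[OF poly_at_closed w])
qed

end

section \<open>Fixed vectors and endomorphisms of irreducible representations\<close>

lemma invariants_csubspace:
  assumes "representation G M" "K \<subseteq> carrier G"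
  shows "csubspace M (invariants M K)"
proof -
  interpret cspace M using assms(1) by (rule representationD)
  have lin: "clinear_on M M (act M k)" if "k \<in> K" for k
    using representationD(2)[OF assms(1)] assms(2) that by blast
  show ?thesis
    by (rule csubspaceI)
      (use clinear_onD[OF lin] clinear_on_zero[OF cvector_space cvector_space lin]
        in \<open>auto simp: invariants_def\<close>)
qed

lemma intertwiner_invariants:
  assumes "f \<in> intertwiners G M N" "K \<subseteq> carrier G" "x \<in> invariants M K"
  shows "f x \<in> invariants N K"
proof -
  have "act N k (f x) = f x" if "k \<in> K" for k
    using intertwinersD(5)[OF assms(1), of k x] assms(2,3) that by (auto simp: invariants_def)
  then show ?thesis using intertwinersD(1)[OF assms(1)] assms(3) by (simp add: invariants_def)
qed

text \<open>For a nonzero \<open>v\<close> fixed by \<open>K\<close>, all vectors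
  \<open>p(f) v\<close> are fixed by \<open>K\<close> and so lie in a finite-dimensional space; thus
  \<open>f\<close> has an eigenvector. The eigenspace is a nonzero subrepresentation, hence
  everything.\<close>

theorem schur:
  fixes \<pi> :: "('g, 'u) rep"
  assumes G: "lc_group G T" and tame: "tame TYPE('u) G T" and \<pi>: "\<pi> \<in> irreps G T"
    and f: "f \<in> intertwiners G \<pi> \<pi>"
  obtains c where "\<And>x. x \<in> carrier \<pi> \<Longrightarrow> f x = c \<odot>\<^bsub>\<pi>\<^esub> x"
proof -
  note \<pi>D = irrepsD[OF \<pi>]
  note fD = intertwinersD[OF f] and rD = representationD[OF \<pi>D(3)]
  interpret cspace \<pi> using \<pi>D(3) by (rule representationD)
  obtain v where v: "v \<in> carrier \<pi>" "v \<noteq> \<zero>\<^bsub>\<pi>\<^esub>"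
    using \<pi>D(2) M.zero_closed unfolding irreducible_rep_iff by blast
  obtain K where K: "compact_open_subgroup G T K" "v \<in> invariants \<pi> K"
    by (rule invariants_stabilizer[OF G \<pi>D(1) v(1)]) (rule that)
  have KG: "K \<subseteq> carrier G" using K(1) subgroup.subset by (auto simp: compact_open_subgroup_def)
  obtain bs where bs: "set bs \<subseteq> invariants \<pi> K" "invariants \<pi> K \<subseteq> lspan \<pi> bs"
    by (rule tame_invariants[OF tame \<pi> K(1)]) (rule that)
  note inv = csubspaceD[OF invariants_csubspace[OF \<pi>D(3) KG]]
  have "poly_at \<pi> f v p \<in> invariants \<pi> K" for p
  proof (induction p)
    case 0
    then show ?case using inv(2) by (simp add: poly_at_0[OF cvector_space fD(6) v(1)])
  next
    case (pCons a p)
    then show ?case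
      using inv(3,4) K(2) intertwiner_invariants[OF f KG] by (simp add: poly_at_pCons[OF cvector_space fD(6) v(1)])
  qed
  then have "poly_at \<pi> f v p \<in> lspan \<pi> bs" for p using bs(2) by blast
  then obtain w r where w: "w \<in> carrier \<pi>" "w \<noteq> \<zero>\<^bsub>\<pi>\<^esub>" "f w = r \<odot>\<^bsub>\<pi>\<^esub> w"
    by (rule eigenvector_exists[OF cvector_space fD(6) v order_trans[OF bs(1) invariants_subset]])
      (rule that)
  let ?E = "{x \<in> carrier \<pi>. f x = r \<odot>\<^bsub>\<pi>\<^esub> x}"
  have "subrep G \<pi> ?E"
    unfolding subrep_def
  proof (intro conjI csubspaceI ballI)
    show "\<zero>\<^bsub>\<pi>\<^esub> \<in> ?E" using intertwiners_zero[OF \<pi>D(3) \<pi>D(3) f] by simp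
    show "x \<oplus>\<^bsub>\<pi>\<^esub> y \<in> ?E" if "x \<in> ?E" "y \<in> ?E" for x y
      using that fD(2) by (simp add: csmult_add_right)
    show "c \<odot>\<^bsub>\<pi>\<^esub> x \<in> ?E" if "x \<in> ?E" for c x
      using that fD(3) by (simp add: csmult_assoc mult.commute)
    show "act \<pi> g x \<in> ?E" if "g \<in> carrier G" "x \<in> ?E" for g x
      using that fD(5) rD(5) clinear_onD(3)[OF rD(2)[OF that(1)]] by simp
  qed auto
  then have "?E = carrier \<pi>" using w \<pi>D(2) unfolding irreducible_rep_iff by blast
  then show thesis using that[of r] by blast
qed

text \<open>By Schur's lemma the homomorphisms \<pi> \<rightarrow> \<pi> are scalars, so sums of
  homomorphic images of \<open>ys\<close> are linear combinations of \<open>ys\<close>, and the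
  contrapositive of \<open>ann_imp_hsum\<close> with \<open>M = \<pi>\<close> applies.\<close>

theorem density:
  fixes \<pi> :: "('g, 'u) rep"
  assumes G: "lc_group G T" and tame: "tame TYPE('u) G T" and \<pi>: "\<pi> \<in> irreps G T"
    and ys: "set ys \<subseteq> carrier \<pi>" and x: "x \<in> carrier \<pi>" "x \<notin> lspan \<pi> ys"
  obtains a where "a \<in> ann G \<pi> ys" "gact \<pi> a x \<noteq> \<zero>\<^bsub>\<pi>\<^esub>"
proof -
  have grp: "group G" using G by (rule lc_groupD)
  note \<pi>D = irrepsD[OF \<pi>]
  have "hsum G \<pi> \<pi> ys \<subseteq> lspan \<pi> ys"
    using ys
  proof (induction ys)
    case (Cons y ys)
    show ?case
    proof
      fix u assume "u \<in> hsum G \<pi> \<pi> (y # ys)"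
      then obtain z \<theta> where z: "z \<in> hsum G \<pi> \<pi> ys" "\<theta> \<in> intertwiners G \<pi> \<pi>" "u = z \<oplus>\<^bsub>\<pi>\<^esub> \<theta> y" by auto
      obtain c where "\<And>x. x \<in> carrier \<pi> \<Longrightarrow> \<theta> x = c \<odot>\<^bsub>\<pi>\<^esub> x"
        by (rule schur[OF G tame \<pi> z(2)]) (rule that)
      then have "u = z \<oplus>\<^bsub>\<pi>\<^esub> c \<odot>\<^bsub>\<pi>\<^esub> y" using z(3) Cons.prems by simp
      then show "u \<in> lspan \<pi> (y # ys)" using Cons z(1) by auto
    qed
  qed simp
  then have "x \<notin> hsum G \<pi> \<pi> ys" using x(2) by blast
  then have "\<exists>a\<in>ann G \<pi> ys. gact \<pi> a x \<noteq> \<zero>\<^bsub>\<pi>\<^esub>"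
    using ann_imp_hsum[OF grp \<pi>D(2,3) ys x(1)] by blast
  then show thesis using that by blast
qed

section \<open>Representations supported at one point\<close>

lemma rep_isomorphic_refl:
  assumes "representation G M" shows "rep_isomorphic G M M"
  unfolding rep_isomorphic_def
  by (rule bexI[OF _ intertwiners_id[OF assms]]) (auto simp: bij_betw_def inj_on_def)

lemma rep_isomorphic_sym:
  assumes "representation G M" "representation G N" "rep_isomorphic G M N"
  shows "rep_isomorphic G N M"
proof -
  obtain f where f: "f \<in> intertwiners G M N" "bij_betw f (carrier M) (carrier N)"
    by (rule bexE[OF assms(3)[unfolded rep_isomorphic_def]]) (rule that)
  have "bij_betw (restrict (inv_into (carrier M) f) (carrier N)) (carrier N) (carrier M)"
    using bij_betw_inv_into[OF f(2)] by simp
  then show ?thesis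
    unfolding rep_isomorphic_def by (rule bexI[OF _ intertwiners_inverse[OF assms(1,2) f]])
qed

lemma rep_isomorphic_trans:
  assumes "representation G L" "rep_isomorphic G L M" "rep_isomorphic G M N"
  shows "rep_isomorphic G L N"
proof -
  obtain f where f: "f \<in> intertwiners G L M" "bij_betw f (carrier L) (carrier M)"
    by (rule bexE[OF assms(2)[unfolded rep_isomorphic_def]]) (rule that)
  obtain h where h: "h \<in> intertwiners G M N" "bij_betw h (carrier M) (carrier N)"
    by (rule bexE[OF assms(3)[unfolded rep_isomorphic_def]]) (rule that)
  have "bij_betw (compose (carrier L) h f) (carrier L) (carrier N)"
    using bij_betw_trans[OF f(2) h(2)] bij_betw_cong[of "carrier L" "compose (carrier L) h f" "h \<circ> f"]
    by (simp add: compose_def)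
  then show ?thesis
    unfolding rep_isomorphic_def by (rule bexI[OF _ intertwiners_compose[OF assms(1) f(1) h(1)]])
qed

text \<open>Every member represents its class, because isomorphism is an equivalence relation. This
  allows an abstract class \<open>c\<close> to be replaced by
  \<open>rep_class G T \<pi>\<close>.\<close>

lemma dual_memberD:
  fixes \<pi> :: "('g, 'u) rep"
  assumes "c \<in> dual G T" "\<pi> \<in> c"
  shows "\<pi> \<in> irreps G T" "c = rep_class G T \<pi>"
proof -
  obtain \<tau> where \<tau>: "\<tau> \<in> irreps G T" "c = rep_class G T \<tau>" using assms(1) by (auto simp: dual_def)
  then have \<pi>: "\<pi> \<in> irreps G T" "rep_isomorphic G \<tau> \<pi>" using assms(2) by (auto simp: rep_class_def)
  note r = irrepsD(3)[OF \<tau>(1)] irrepsD(3)[OF \<pi>(1)]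
  show "\<pi> \<in> irreps G T" by fact
  have "rep_isomorphic G \<tau> \<sigma> \<longleftrightarrow> rep_isomorphic G \<pi> \<sigma>" for \<sigma> :: "('g, 'u) rep"
    using rep_isomorphic_trans[OF r(1) \<pi>(2)] rep_isomorphic_trans[OF r(2) rep_isomorphic_sym[OF r \<pi>(2)]]
    by blast
  then show "c = rep_class G T \<pi>" unfolding \<tau>(2) rep_class_def by blast
qed

lemma isotypic_hsum:
  fixes \<pi> M :: "('g, 'u) rep"
  assumes G: "lc_group G T" and tame: "tame TYPE('u) G T" and c: "c \<in> dual G T" "\<pi> \<in> c"
    and M: "smooth_rep G T M" and Supp: "Supp G T M \<subseteq> {c}" and x: "x \<in> carrier M"
  obtains bs where "set bs \<subseteq> carrier \<pi>" "x \<in> hsum G \<pi> M bs"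
proof -
  have grp: "group G" using G by (rule lc_groupD)
  have \<pi>: "\<pi> \<in> irreps G T" by (rule dual_memberD[OF c])
  note \<pi>D = irrepsD[OF \<pi>]
  have rM: "representation G M" using M by (rule smooth_representation)
  obtain K where K: "compact_open_subgroup G T K" "x \<in> invariants M K"
    by (rule invariants_stabilizer[OF G M x]) (rule that)
  have KG: "K \<subseteq> carrier G" using K(1) subgroup.subset by (auto simp: compact_open_subgroup_def)
  obtain bs where bs: "set bs \<subseteq> invariants \<pi> K" "invariants \<pi> K \<subseteq> lspan \<pi> bs"
    by (rule tame_invariants[OF tame \<pi> K(1)]) (rule that)
  have bsC: "set bs \<subseteq> carrier \<pi>" by (rule order_trans[OF bs(1) invariants_subset])
  have "x \<in> hsum G \<pi> M bs"
  proof (rule ann_imp_hsum[OF grp \<pi>D(2) rM bsC x], rule ccontr)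
    fix a assume a: "a \<in> ann G \<pi> bs" and ax: "gact M a x \<noteq> \<zero>\<^bsub>M\<^esub>"
    note aG = annD(1)[OF a]
    have axM: "gact M a x \<in> carrier M" by (rule gact_closed[OF rM aG x])
    obtain \<sigma> :: "('g, 'u) rep" and f
      where \<sigma>: "\<sigma> \<in> irreps G T" "f \<in> intertwiners G M \<sigma>" "f (gact M a x) \<noteq> \<zero>\<^bsub>\<sigma>\<^esub>"
      by (rule irreducible_quotient[OF G tame M axM ax]) (rule that)
    note r\<sigma> = irrepsD(3)[OF \<sigma>(1)]
    have "\<sigma> \<in> rep_class G T \<sigma>" using \<sigma>(1) rep_isomorphic_refl[OF r\<sigma>] by (simp add: rep_class_def)
    moreover have "rep_class G T \<sigma> \<in> dual G T" using \<sigma>(1) by (simp add: dual_def)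
    \<comment> \<open>The quotient that detects \<open>a x\<close> contributes its class to the
      support, so it is isomorphic to \<pi>. Transported to \<pi>, the vector \<open>x\<close>
      becomes a \<open>K\<close>-fixed vector, which \<open>a\<close> kills: a
      contradiction.\<close>
    ultimately have "rep_class G T \<sigma> \<in> Supp G T M" unfolding Supp_def using \<sigma>(2,3) axM by blast
    then have "\<pi> \<in> rep_class G T \<sigma>" using Supp c(2) by blast
    then obtain \<theta> where \<theta>: "\<theta> \<in> intertwiners G \<sigma> \<pi>" "bij_betw \<theta> (carrier \<sigma>) (carrier \<pi>)"
      by (auto simp: rep_class_def rep_isomorphic_def)
    interpret \<sigma>: cspace \<sigma> using r\<sigma> by (rule representationD)
    have fx: "f x \<in> carrier \<sigma>" "f (gact M a x) \<in> carrier \<sigma>" using intertwinersD(1)[OF \<sigma>(2)] x axM by auto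
    have "\<theta> (f (gact M a x)) = gact \<pi> a (\<theta> (f x))"
      using gact_intertwiner[OF rM aG x \<sigma>(2)] gact_intertwiner[OF r\<sigma> aG fx(1) \<theta>(1)] by simp
    also have "\<dots> = \<zero>\<^bsub>\<pi>\<^esub>"
    proof (rule clinear_on_lspan_zero[OF representationD(1)[OF \<pi>D(3)] representationD(1)[OF \<pi>D(3)]
          clinear_on_gact[OF \<pi>D(3) aG] bsC annD(2)[OF a]])
      show "\<theta> (f x) \<in> lspan \<pi> bs"
        using intertwiner_invariants[OF \<theta>(1) KG intertwiner_invariants[OF \<sigma>(2) KG K(2)]] bs(2) by blast
    qed
    also have "\<dots> = \<theta> \<zero>\<^bsub>\<sigma>\<^esub>" using intertwiners_zero[OF r\<sigma> \<pi>D(3) \<theta>(1)] by simp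
    finally have "f (gact M a x) = \<zero>\<^bsub>\<sigma>\<^esub>"
      using \<theta>(2) fx(2) \<sigma>.M.zero_closed by (auto simp: bij_betw_def dest: inj_onD)
    then show False using \<sigma>(3) by simp
  qed
  then show thesis using that bsC by blast
qed

section \<open>Tensor products\<close>

lemma bilinear_onD:
  assumes "bilinear_on V W X b"
  shows "\<And>v w. v \<in> carrier V \<Longrightarrow> w \<in> carrier W \<Longrightarrow> b v w \<in> carrier X"
    "\<And>v v' w. v \<in> carrier V \<Longrightarrow> v' \<in> carrier V \<Longrightarrow> w \<in> carrier W \<Longrightarrow>
      b (v \<oplus>\<^bsub>V\<^esub> v') w = b v w \<oplus>\<^bsub>X\<^esub> b v' w"
    "\<And>v w w'. v \<in> carrier V \<Longrightarrow> w \<in> carrier W \<Longrightarrow> w' \<in> carrier W \<Longrightarrow>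
      b v (w \<oplus>\<^bsub>W\<^esub> w') = b v w \<oplus>\<^bsub>X\<^esub> b v w'"
    "\<And>c v w. v \<in> carrier V \<Longrightarrow> w \<in> carrier W \<Longrightarrow> b (c \<odot>\<^bsub>V\<^esub> v) w = c \<odot>\<^bsub>X\<^esub> b v w"
    "\<And>c v w. v \<in> carrier V \<Longrightarrow> w \<in> carrier W \<Longrightarrow> b v (c \<odot>\<^bsub>W\<^esub> w) = c \<odot>\<^bsub>X\<^esub> b v w"
  using assms by (auto simp: bilinear_on_def clinear_on_def)

lemma bilinear_onI:
  assumes "\<And>v w. v \<in> carrier V \<Longrightarrow> w \<in> carrier W \<Longrightarrow> b v w \<in> carrier X"
    "\<And>v v' w. v \<in> carrier V \<Longrightarrow> v' \<in> carrier V \<Longrightarrow> w \<in> carrier W \<Longrightarrow>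
      b (v \<oplus>\<^bsub>V\<^esub> v') w = b v w \<oplus>\<^bsub>X\<^esub> b v' w"
    "\<And>v w w'. v \<in> carrier V \<Longrightarrow> w \<in> carrier W \<Longrightarrow> w' \<in> carrier W \<Longrightarrow>
      b v (w \<oplus>\<^bsub>W\<^esub> w') = b v w \<oplus>\<^bsub>X\<^esub> b v w'"
    "\<And>c v w. v \<in> carrier V \<Longrightarrow> w \<in> carrier W \<Longrightarrow> b (c \<odot>\<^bsub>V\<^esub> v) w = c \<odot>\<^bsub>X\<^esub> b v w"
    "\<And>c v w. v \<in> carrier V \<Longrightarrow> w \<in> carrier W \<Longrightarrow> b v (c \<odot>\<^bsub>W\<^esub> w) = c \<odot>\<^bsub>X\<^esub> b v w"
  shows "bilinear_on V W X b"
  using assms by (auto simp: bilinear_on_def clinear_on_def)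

text \<open>A list of pairs stands for a formal sum of pure tensors, and \<open>bsum X b\<close> is
  its value under the bilinear map \<open>b\<close>.\<close>

primrec bsum :: "(complex, 'u, 'm) module_scheme \<Rightarrow> ('u \<Rightarrow> 'u \<Rightarrow> 'u) \<Rightarrow> ('u \<times> 'u) list \<Rightarrow> 'u" where
  "bsum X b [] = \<zero>\<^bsub>X\<^esub>"
| "bsum X b (p # l) = b (fst p) (snd p) \<oplus>\<^bsub>X\<^esub> bsum X b l"

context
  fixes V :: "(complex, 'u, 'm) module_scheme" and W :: "(complex, 'u, 'n) module_scheme"
    and X :: "(complex, 'u, 'k) module_scheme" and b
  assumes V: "cvector_space V" and X: "cvector_space X" and b: "bilinear_on V W X b"
begin

interpretation V: cspace V using V by (rule cspace.intro)
interpretation X: cspace X using X by (rule cspace.intro)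

lemma bsum_closed: "set l \<subseteq> carrier V \<times> carrier W \<Longrightarrow> bsum X b l \<in> carrier X"
  by (induction l) (use bilinear_onD(1)[OF b] in auto)

lemma bsum_append:
  "set l \<subseteq> carrier V \<times> carrier W \<Longrightarrow> set l' \<subseteq> carrier V \<times> carrier W \<Longrightarrow>
    bsum X b (l @ l') = bsum X b l \<oplus>\<^bsub>X\<^esub> bsum X b l'"
  by (induction l) (use bilinear_onD(1)[OF b] bsum_closed in \<open>auto simp: X.M.a_assoc\<close>)

lemma bsum_scale:
  "set l \<subseteq> carrier V \<times> carrier W \<Longrightarrow>
    bsum X b (map (\<lambda>p. (c \<odot>\<^bsub>V\<^esub> fst p, snd p)) l) = c \<odot>\<^bsub>X\<^esub> bsum X b l"
  by (induction l) (use bilinear_onD(1,4)[OF b] bsum_closed in \<open>auto simp: X.csmult_add_right\<close>)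

end

lemmas (in cspace) group_simps = M.a_assoc M.a_comm M.l_zero M.l_neg

text \<open>The tensor product is the set of lists of pairs modulo "every bilinear map takes the same
  value", so its universal property is immediate. Only the encoding of lists has to stay in \<open>'u\<close>.\<close>

lemma tensor_product_exists:
  fixes V :: "(complex, 'u, 'm) module_scheme" and W :: "(complex, 'u, 'n) module_scheme"
    and code :: "('u \<times> 'u) list \<Rightarrow> 'u"
  assumes V: "cvector_space V" and W: "cvector_space W" and code: "inj code"
  shows "\<exists>P t. is_tensor_product V W P t"
proof -
  interpret V: cspace V using V by (rule cspace.intro)
  interpret W: cspace W using W by (rule cspace.intro)
  define L where "L = {l. set l \<subseteq> carrier V \<times> carrier W}"
  \<comment> \<open>The targets are plain modules with carrier in \<open>'u\<close>, exactly the
    test objects of \<open>is_tensor_product\<close>.\<close>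
  define bil where "bil X b \<longleftrightarrow> cvector_space X \<and> bilinear_on V W X b"
    for X :: "(complex, 'u) module" and b
  define eqv where "eqv l l' \<longleftrightarrow> (\<forall>X b. bil X b \<longrightarrow> bsum X b l = bsum X b l')" for l l'
  \<comment> \<open>The chosen representative depends only on the class, because equivalent lists
    satisfy the same predicate under the choice operator; \<open>code\<close> then turns it into an
    element of \<open>'u\<close>.\<close>
  define canon where "canon l = (SOME l'. l' \<in> L \<and> eqv l l')" for l
  define cl where "cl l = code (canon l)" for l
  have canon: "canon l \<in> L \<and> eqv l (canon l)" if "l \<in> L" for l
    unfolding canon_def by (rule someI[of _ l]) (use that in \<open>simp add: eqv_def\<close>)
  have canon_eq: "canon l = canon l'" if "eqv l l'" for l l'
  proof -
    have "eqv l m \<longleftrightarrow> eqv l' m" for m using that by (auto simp: eqv_def)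
    then show ?thesis by (simp add: canon_def)
  qed
  define dc where "dc = inv_into UNIV code"
  have dc: "dc (cl l) = canon l" for l using code by (simp add: dc_def cl_def inv_f_f)
  define P where "P = \<lparr>carrier = cl ` L, mult = (\<lambda>_ _. cl []), one = cl [], zero = cl [],
    add = (\<lambda>u u'. cl (dc u @ dc u')),
    smult = (\<lambda>c u. cl (map (\<lambda>p. (c \<odot>\<^bsub>V\<^esub> fst p, snd p)) (dc u)))\<rparr>"
  define ev where "ev X b u = bsum X b (dc u)" for X :: "(complex, 'u) module" and b u
  have dcL: "dc u \<in> L" if "u \<in> carrier P" for u using that canon by (auto simp: P_def dc)
  have ev_cl: "ev X b (cl l) = bsum X b l" if "bil X b" "l \<in> L" for X b l
    using canon[OF that(2)] that(1) by (simp add: ev_def dc eqv_def)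
  \<comment> \<open>Elements of \<open>P\<close> are separated by evaluation at bilinear maps, so
    each vector space axiom is inherited from the targets.\<close>
  have ext: "u = u'"
    if "u \<in> carrier P" "u' \<in> carrier P" "\<And>X b. bil X b \<Longrightarrow> ev X b u = ev X b u'" for u u'
  proof -
    have "u \<in> cl ` L" "u' \<in> cl ` L" using that by (simp_all add: P_def)
    then obtain l l' where l: "l \<in> L" "u = cl l" "l' \<in> L" "u' = cl l'" by blast
    have "eqv l l'" using that(3) ev_cl l by (simp add: eqv_def)
    then show ?thesis using canon_eq l by (simp add: cl_def)
  qed
  have clP: "cl l \<in> carrier P" if "l \<in> L" for l using that by (simp add: P_def)
  have Lapp: "l @ l' \<in> L" if "l \<in> L" "l' \<in> L" for l l' using that by (auto simp: L_def)
  have Lsc: "map (\<lambda>p. (c \<odot>\<^bsub>V\<^esub> fst p, snd p)) l \<in> L" if "l \<in> L" for c l using that by (auto simp: L_def)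
  have Lnil: "[] \<in> L" by (simp add: L_def)
  have Lone: "[(v, w)] \<in> L" if "v \<in> carrier V" "w \<in> carrier W" for v w using that by (simp add: L_def)
  have ops: "zero P = cl []" "add P u u' = cl (dc u @ dc u')"
    "smult P c u = cl (map (\<lambda>p. (c \<odot>\<^bsub>V\<^esub> fst p, snd p)) (dc u))" for u u' c
    by (simp_all add: P_def)
  have closed [simp]: "\<zero>\<^bsub>P\<^esub> \<in> carrier P"
    "u \<in> carrier P \<Longrightarrow> u' \<in> carrier P \<Longrightarrow> u \<oplus>\<^bsub>P\<^esub> u' \<in> carrier P"
    "u \<in> carrier P \<Longrightarrow> c \<odot>\<^bsub>P\<^esub> u \<in> carrier P" for u u' c
    unfolding ops by (intro clP Lapp Lsc Lnil dcL; assumption)+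
  have ev: "ev X b u \<in> carrier X" "ev X b \<zero>\<^bsub>P\<^esub> = \<zero>\<^bsub>X\<^esub>" "ev X b (u \<oplus>\<^bsub>P\<^esub> u') = ev X b u \<oplus>\<^bsub>X\<^esub> ev X b u'"
    "ev X b (c \<odot>\<^bsub>P\<^esub> u) = c \<odot>\<^bsub>X\<^esub> ev X b u"
    if "bil X b" "u \<in> carrier P" "u' \<in> carrier P" for X b u u' c
  proof -
    have X: "cvector_space X" "bilinear_on V W X b" using that(1) by (auto simp: bil_def)
    have d: "set (dc u) \<subseteq> carrier V \<times> carrier W" "set (dc u') \<subseteq> carrier V \<times> carrier W"
      using dcL that by (auto simp: L_def)
    show "ev X b u \<in> carrier X" unfolding ev_def by (rule bsum_closed[OF V X d(1)])
    show "ev X b \<zero>\<^bsub>P\<^esub> = \<zero>\<^bsub>X\<^esub>" unfolding ops using ev_cl[OF that(1) Lnil] by simp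
    show "ev X b (u \<oplus>\<^bsub>P\<^esub> u') = ev X b u \<oplus>\<^bsub>X\<^esub> ev X b u'"
      unfolding ops ev_cl[OF that(1) Lapp[OF dcL[OF that(2)] dcL[OF that(3)]]]
      using bsum_append[OF V X d] by (simp add: ev_def)
    show "ev X b (c \<odot>\<^bsub>P\<^esub> u) = c \<odot>\<^bsub>X\<^esub> ev X b u"
      unfolding ops ev_cl[OF that(1) Lsc[OF dcL[OF that(2)]]]
      using bsum_scale[OF V X d(1)] by (simp add: ev_def)
  qed
  have bilX: "cspace X" if "bil X b" for X b using that by (simp add: bil_def cspace_def)
  note ev1 = ev(1)[OF _ _ closed(1)] and ev2 = ev(2)[OF _ closed(1) closed(1)]
    and ev4 = ev(4)[OF _ _ closed(1)]
  note ev_simps = ev1 ev2 ev(3) ev4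
  have space_ext: "u = u'"
    if "u \<in> carrier P" "u' \<in> carrier P" "\<And>X b. bil X b \<Longrightarrow> cspace X \<Longrightarrow> ev X b u = ev X b u'" for u u'
    using ext[OF that(1,2)] that(3) bilX by blast
  have P: "cvector_space P"
  proof (rule cvector_spaceI)
    show "abelian_group P"
    proof (rule abelian_groupI)
      fix u v w assume u: "u \<in> carrier P" "v \<in> carrier P" "w \<in> carrier P"
      show "(u \<oplus>\<^bsub>P\<^esub> v) \<oplus>\<^bsub>P\<^esub> w = u \<oplus>\<^bsub>P\<^esub> (v \<oplus>\<^bsub>P\<^esub> w)"
        by (rule space_ext) (use u in \<open>simp_all add: ev_simps cspace.group_simps\<close>)
    next
      fix u v assume u: "u \<in> carrier P" "v \<in> carrier P"
      show "u \<oplus>\<^bsub>P\<^esub> v = v \<oplus>\<^bsub>P\<^esub> u"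
        by (rule space_ext) (use u in \<open>simp_all add: ev_simps cspace.group_simps\<close>)
    next
      fix u assume u: "u \<in> carrier P"
      show "\<zero>\<^bsub>P\<^esub> \<oplus>\<^bsub>P\<^esub> u = u"
        by (rule space_ext) (use u in \<open>simp_all add: ev_simps cspace.group_simps\<close>)
      have "((- 1) \<odot>\<^bsub>P\<^esub> u) \<oplus>\<^bsub>P\<^esub> u = \<zero>\<^bsub>P\<^esub>"
        by (rule space_ext) (use u in \<open>simp_all add: ev_simps cspace.csmult_minus_one cspace.group_simps\<close>)
      then show "\<exists>y\<in>carrier P. y \<oplus>\<^bsub>P\<^esub> u = \<zero>\<^bsub>P\<^esub>" using u by (intro bexI[of _ "(- 1) \<odot>\<^bsub>P\<^esub> u"]) auto
    qed auto
  next
    fix a c u assume u: "u \<in> carrier P"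
    show "(a + c) \<odot>\<^bsub>P\<^esub> u = a \<odot>\<^bsub>P\<^esub> u \<oplus>\<^bsub>P\<^esub> c \<odot>\<^bsub>P\<^esub> u"
      by (rule space_ext) (use u in \<open>simp_all add: ev_simps cspace.csmult_add_left\<close>)
    show "(a * c) \<odot>\<^bsub>P\<^esub> u = a \<odot>\<^bsub>P\<^esub> (c \<odot>\<^bsub>P\<^esub> u)"
      by (rule space_ext) (use u in \<open>simp_all add: ev_simps cspace.csmult_assoc\<close>)
    show "1 \<odot>\<^bsub>P\<^esub> u = u"
      by (rule space_ext) (use u in \<open>simp_all add: ev_simps cspace.csmult_simps\<close>)
  next
    fix a u v assume u: "u \<in> carrier P" "v \<in> carrier P"
    show "a \<odot>\<^bsub>P\<^esub> (u \<oplus>\<^bsub>P\<^esub> v) = a \<odot>\<^bsub>P\<^esub> u \<oplus>\<^bsub>P\<^esub> a \<odot>\<^bsub>P\<^esub> v"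
      by (rule space_ext) (use u in \<open>simp_all add: ev_simps cspace.csmult_add_right\<close>)
  qed simp_all
  define t where "t v w = cl [(v, w)]" for v w
  have tP: "t v w \<in> carrier P" if "v \<in> carrier V" "w \<in> carrier W" for v w
    unfolding t_def by (rule clP[OF Lone[OF that]])
  have ev_t: "ev X b (t v w) = b v w" if "bil X b" "v \<in> carrier V" "w \<in> carrier W" for X b v w
  proof -
    interpret X: cspace X using that(1) by (rule bilX)
    have "b v w \<in> carrier X" using that bilinear_onD(1) by (auto simp: bil_def)
    then show ?thesis unfolding t_def ev_cl[OF that(1) Lone[OF that(2,3)]] by simp
  qed
  have bD: "bilinear_on V W X b" if "bil X b" for X b using that by (simp add: bil_def)
  have t: "bilinear_on V W P t"
  proof (rule bilinear_onI)
    fix v v' w assume c: "v \<in> carrier V" "v' \<in> carrier V" "w \<in> carrier W"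
    show "t (v \<oplus>\<^bsub>V\<^esub> v') w = t v w \<oplus>\<^bsub>P\<^esub> t v' w"
      by (rule ext) (use c tP in \<open>simp_all add: ev(3) ev_t bilinear_onD(2)[OF bD]\<close>)
  next
    fix v w w' assume c: "v \<in> carrier V" "w \<in> carrier W" "w' \<in> carrier W"
    show "t v (w \<oplus>\<^bsub>W\<^esub> w') = t v w \<oplus>\<^bsub>P\<^esub> t v w'"
      by (rule ext) (use c tP in \<open>simp_all add: ev(3) ev_t bilinear_onD(3)[OF bD]\<close>)
  next
    fix c v w assume c: "v \<in> carrier V" "w \<in> carrier W"
    show "t (c \<odot>\<^bsub>V\<^esub> v) w = c \<odot>\<^bsub>P\<^esub> t v w"
      by (rule ext) (use c tP in \<open>simp_all add: ev4 ev_t bilinear_onD(4)[OF bD]\<close>)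
    show "t v (c \<odot>\<^bsub>W\<^esub> w) = c \<odot>\<^bsub>P\<^esub> t v w"
      by (rule ext) (use c tP in \<open>simp_all add: ev4 ev_t bilinear_onD(5)[OF bD]\<close>)
  qed (rule tP)
  have "\<exists>!h. h \<in> linear_maps P X \<and> (\<forall>v\<in>carrier V. \<forall>w\<in>carrier W. h (t v w) = b v w)"
    if B: "bil X b" for X b
  proof (rule ex1I[of _ "restrict (ev X b) (carrier P)"])
    show "restrict (ev X b) (carrier P) \<in> linear_maps P X \<and>
        (\<forall>v\<in>carrier V. \<forall>w\<in>carrier W. restrict (ev X b) (carrier P) (t v w) = b v w)"
      using tP ev_t[OF B]
      by (auto simp: linear_maps_def ev1[OF B] ev(3)[OF B] ev4[OF B] intro!: clinear_onI)
    fix h assume h: "h \<in> linear_maps P X \<and> (\<forall>v\<in>carrier V. \<forall>w\<in>carrier W. h (t v w) = b v w)"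
    then have hl: "clinear_on P X h" and he: "h \<in> extensional (carrier P)" by (auto simp: linear_maps_def)
    have X: "cvector_space X" using B by (simp add: bil_def)
    \<comment> \<open>The class of a list is the sum of the pure tensors of its entries, so a linear
      map is determined by its values on these.\<close>
    have "h (cl l) = bsum X b l" if "l \<in> L" for l
      using that
    proof (induction l)
      case Nil
      have "h \<zero>\<^bsub>P\<^esub> = \<zero>\<^bsub>X\<^esub>" by (rule clinear_on_zero[OF P X hl])
      then show ?case unfolding ops by simp
    next
      case (Cons p l)
      obtain v w where p: "p = (v, w)" by (cases p)
      have c: "v \<in> carrier V" "w \<in> carrier W" "l \<in> L" using Cons.prems p by (auto simp: L_def)
      have "cl (p # l) = t v w \<oplus>\<^bsub>P\<^esub> cl l"
      proof (rule ext)
        fix Y d assume D: "bil Y d"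
        show "ev Y d (cl (p # l)) = ev Y d (t v w \<oplus>\<^bsub>P\<^esub> cl l)"
          using ev_cl[OF D Cons.prems] ev_cl[OF D c(3)] ev_t[OF D c(1,2)] ev(3)[OF D tP[OF c(1,2)] clP[OF c(3)]]
          by (simp add: p)
      qed (use clP[OF Cons.prems] tP c clP in simp_all)
      then show ?case
        using clinear_onD(2)[OF hl tP[OF c(1,2)] clP[OF c(3)]] Cons.IH[OF c(3)] h c by (simp add: p)
    qed
    then have "h u = ev X b u" if "u \<in> carrier P" for u
      using that ev_cl[OF B] by (auto simp: P_def)
    then show "h = restrict (ev X b) (carrier P)" using he by (auto simp: extensional_def)
  qed
  then have "is_tensor_product V W P t"
    unfolding is_tensor_product_def using P t by (auto simp: bil_def)
  then show ?thesis by blast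
qed

text \<open>For infinite \<open>'u\<close> pairs inject into \<open>'u\<close>; the distinct tags
  \<open>a\<close> and \<open>b\<close> in the first component tell the empty list from a nonempty
  one.\<close>

lemma list_code_exists:
  assumes "infinite (UNIV :: 'u set)"
  obtains code :: "('u \<times> 'u) list \<Rightarrow> 'u" where "inj code"
proof -
  have "\<exists>p. bij_betw p (UNIV \<times> UNIV :: ('u \<times> 'u) set) (UNIV :: 'u set)"
    using card_of_Times_same_infinite[OF assms] by (simp only: card_of_ordIso)
  then obtain p :: "'u \<times> 'u \<Rightarrow> 'u" where "bij_betw p (UNIV \<times> UNIV) UNIV" by blast
  then have p: "inj p" by (simp add: bij_betw_def)
  obtain a b :: 'u where ab: "a \<noteq> b" using ex_new_if_finite[OF assms, of "{undefined}"] by auto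
  define code where "code = rec_list (p (a, a)) (\<lambda>x _ r. p (b, p (p x, r)))"
  have code: "code [] = p (a, a)" "code (x # l) = p (b, p (p x, code l))" for x l
    by (simp_all add: code_def)
  have "code l = code l' \<Longrightarrow> l = l'" for l l'
  proof (induction l arbitrary: l')
    case Nil
    then show ?case using ab by (cases l') (auto simp: code inj_eq[OF p])
  next
    case (Cons x l)
    then show ?case using ab by (cases l') (auto simp: code inj_eq[OF p])
  qed
  then show thesis using that by (auto simp: inj_def)
qed

text \<open>The complex multiples of a nonzero vector are pairwise distinct. Applied to \<pi>, this
  permits the coding of lists of pairs in \<open>'u\<close>.\<close>

lemma infinite_UNIV_cspace:
  fixes V :: "(complex, 'u, 'm) module_scheme"
  assumes "cvector_space V" "w \<in> carrier V" "w \<noteq> \<zero>\<^bsub>V\<^esub>"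
  shows "infinite (UNIV :: 'u set)"
proof
  interpret cspace V using assms(1) by (rule cspace.intro)
  assume fin: "finite (UNIV :: 'u set)"
  obtain \<phi> where \<phi>: "\<phi> w = 1" "\<And>c x. x \<in> carrier V \<Longrightarrow> \<phi> (c \<odot>\<^bsub>V\<^esub> x) = c * \<phi> x"
    by (rule exists_functional[OF assms(2,3)]) (rule that)
  have "inj (\<lambda>c. c \<odot>\<^bsub>V\<^esub> w)"
  proof (rule injI)
    fix c d assume "c \<odot>\<^bsub>V\<^esub> w = d \<odot>\<^bsub>V\<^esub> w"
    then have "\<phi> (c \<odot>\<^bsub>V\<^esub> w) = \<phi> (d \<odot>\<^bsub>V\<^esub> w)" by simp
    then show "c = d" using \<phi> assms(2) by simp
  qed
  then have "finite (UNIV :: complex set)" using finite_imageD[OF finite_subset[OF subset_UNIV fin]] by blast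
  then show False using infinite_UNIV_char_0 by blast
qed

section \<open>Independence of additional record fields\<close>

lemma cvector_space_cong:
  fixes V :: "(complex, 'u, 'm) module_scheme" and X :: "(complex, 'u, 'n) module_scheme"
  assumes "cvector_space V" "carrier X = carrier V" "zero X = zero V" "add X = add V"
    "module.smult X = module.smult V"
  shows "cvector_space X"
proof -
  interpret V: cspace V using assms(1) by (rule cspace.intro)
  note eq = assms(2-)
  show ?thesis
  proof (rule cvector_spaceI)
    show "abelian_group X"
    proof (rule abelian_groupI)
      fix x assume "x \<in> carrier X"
      then show "\<exists>y\<in>carrier X. y \<oplus>\<^bsub>X\<^esub> x = \<zero>\<^bsub>X\<^esub>"
        unfolding eq by (intro bexI[of _ "\<ominus>\<^bsub>V\<^esub> x"]) (simp_all add: V.M.l_neg)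
    qed (simp_all add: eq V.M.a_ac)
  qed (simp_all add: eq V.csmult_add_left V.csmult_add_right V.csmult_assoc)
qed

lemma truncate_simps [simp]:
  "carrier (module.truncate X) = carrier X" "zero (module.truncate X) = zero X"
  "add (module.truncate X) = add X" "module.smult (module.truncate X) = module.smult X"
  by (simp_all add: module.truncate_def)

lemma cvector_space_truncate:
  "cvector_space X \<Longrightarrow> cvector_space (module.truncate X)"
  by (erule cvector_space_cong) simp_all

lemma linear_maps_truncate [simp]: "linear_maps P (module.truncate X) = linear_maps P X"
  by (simp add: linear_maps_def clinear_on_def)

context
  fixes V :: "(complex, 'u, 'm) module_scheme" and W :: "(complex, 'u, 'n) module_scheme"
    and P :: "(complex, 'u) module" and t
  assumes V: "cvector_space V" and W: "cvector_space W" and P: "is_tensor_product V W P t"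
begin

interpretation V: cspace V using V by (rule cspace.intro)
interpretation W: cspace W using W by (rule cspace.intro)

lemma tensor_cvector_space: "cvector_space P"
  using P by (simp add: is_tensor_product_def)

lemma tensor_bilinear: "bilinear_on V W P t"
  using P by (simp add: is_tensor_product_def)

text \<open>The universal property is stated for plain modules as targets; truncating the record
  extends it to targets such as representations.\<close>

lemma tensor_lift:
  fixes X :: "(complex, 'u, 'k) module_scheme"
  assumes "cvector_space X" "bilinear_on V W X b"
  shows "\<exists>!h. h \<in> linear_maps P X \<and> (\<forall>v\<in>carrier V. \<forall>w\<in>carrier W. h (t v w) = b v w)"
proof -
  have "bilinear_on V W (module.truncate X) b"
    using assms(2) by (simp add: bilinear_on_def clinear_on_def)
  moreover have "cvector_space (module.truncate X)" using assms(1) by (rule cvector_space_truncate)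
  ultimately have "\<exists>!h. h \<in> linear_maps P (module.truncate X) \<and>
      (\<forall>v\<in>carrier V. \<forall>w\<in>carrier W. h (t v w) = b v w)"
    using P unfolding is_tensor_product_def by blast
  then show ?thesis by simp
qed

text \<open>A projection onto the span of the pure tensors agrees with the identity on them, so the
  uniqueness part of the universal property makes the two equal.\<close>

lemma tensor_generated:
  assumes u: "u \<in> carrier P"
  obtains l where "set l \<subseteq> carrier V \<times> carrier W" "u = bsum P t l"
proof -
  interpret P: cspace P using tensor_cvector_space by (rule cspace.intro)
  note b = tensor_bilinear
  note bD = bilinear_onD[OF b]
  define Q where "Q = {bsum P t l | l. set l \<subseteq> carrier V \<times> carrier W}"
  have Q: "csubspace P Q"
  proof (rule csubspaceI)
    show "Q \<subseteq> carrier P" using bsum_closed[OF V P.cvector_space b] by (auto simp: Q_def)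
    show "\<zero>\<^bsub>P\<^esub> \<in> Q" unfolding Q_def by (intro CollectI exI[of _ "[]"]) simp
  next
    fix x y assume "x \<in> Q" "y \<in> Q"
    then obtain l l' where l: "x = bsum P t l" "set l \<subseteq> carrier V \<times> carrier W"
      "y = bsum P t l'" "set l' \<subseteq> carrier V \<times> carrier W" by (auto simp: Q_def)
    then have "x \<oplus>\<^bsub>P\<^esub> y = bsum P t (l @ l')" using bsum_append[OF V P.cvector_space b] by simp
    then show "x \<oplus>\<^bsub>P\<^esub> y \<in> Q" unfolding Q_def using l by (intro CollectI exI[of _ "l @ l'"]) auto
  next
    fix c x assume "x \<in> Q"
    then obtain l where l: "x = bsum P t l" "set l \<subseteq> carrier V \<times> carrier W" by (auto simp: Q_def)
    then have "c \<odot>\<^bsub>P\<^esub> x = bsum P t (map (\<lambda>p. (c \<odot>\<^bsub>V\<^esub> fst p, snd p)) l)"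
      using bsum_scale[OF V P.cvector_space b] by simp
    moreover have "set (map (\<lambda>p. (c \<odot>\<^bsub>V\<^esub> fst p, snd p)) l) \<subseteq> carrier V \<times> carrier W"
      using l(2) by auto
    ultimately show "c \<odot>\<^bsub>P\<^esub> x \<in> Q" unfolding Q_def by blast
  qed
  obtain p where p: "clinear_on P P p" "\<And>x. x \<in> carrier P \<Longrightarrow> p x \<in> Q" "\<And>x. x \<in> Q \<Longrightarrow> p x = x"
    by (rule P.linear_projection[OF Q]) (rule that)
  have tQ: "t v w \<in> Q" if "v \<in> carrier V" "w \<in> carrier W" for v w
  proof -
    have "t v w = bsum P t [(v, w)]" using bD(1)[OF that] by simp
    then show ?thesis unfolding Q_def using that by (intro CollectI exI[of _ "[(v, w)]"]) auto
  qed
  let ?id = "restrict (\<lambda>x. x) (carrier P)" and ?p = "restrict p (carrier P)"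
  have "?id \<in> linear_maps P P \<and> (\<forall>v\<in>carrier V. \<forall>w\<in>carrier W. ?id (t v w) = t v w)"
    using bD(1) by (auto simp: linear_maps_def intro!: clinear_onI)
  moreover have "?p \<in> linear_maps P P \<and> (\<forall>v\<in>carrier V. \<forall>w\<in>carrier W. ?p (t v w) = t v w)"
    using bD(1) clinear_onD[OF p(1)] p(3)[OF tQ] by (auto simp: linear_maps_def intro!: clinear_onI)
  ultimately have "?id = ?p" using tensor_lift[OF P.cvector_space b] by blast
  then have "?id u = ?p u" by (rule fun_cong)
  then have "u = p u" using u by simp
  then have "u \<in> Q" using p(2)[OF u] by simp
  then show thesis using that by (auto simp: Q_def)
qed

text \<open>A form of uniqueness for maps that need not be extensional, so that composites of group
  actions can be compared as they are.\<close>

lemma tensor_ext: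
  assumes X: "cvector_space X" and f: "clinear_on P X f" and h: "clinear_on P X h"
    and "\<And>v w. v \<in> carrier V \<Longrightarrow> w \<in> carrier W \<Longrightarrow> f (t v w) = h (t v w)" and u: "u \<in> carrier P"
  shows "f u = h u"
proof -
  obtain l where l: "set l \<subseteq> carrier V \<times> carrier W" "u = bsum P t l" by (rule tensor_generated[OF u])
  have "f (bsum P t l) = h (bsum P t l)" using l(1)
  proof (induction l)
    case Nil
    then show ?case
      using clinear_on_zero[OF tensor_cvector_space X f] clinear_on_zero[OF tensor_cvector_space X h] by simp
  next
    case (Cons p l)
    have c: "t (fst p) (snd p) \<in> carrier P" "bsum P t l \<in> carrier P"
      using Cons.prems bilinear_onD(1)[OF tensor_bilinear] bsum_closed[OF V tensor_cvector_space tensor_bilinear]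
      by auto
    show ?case using clinear_onD(2)[OF f c] clinear_onD(2)[OF h c] Cons assms(4) by auto
  qed
  then show ?thesis using l(2) by simp
qed

text \<open>A functional \<open>\<phi>\<close> with \<open>\<phi> v = 1\<close> induces a map from
  the tensor product to \<open>W\<close> that sends \<open>t v w\<close> to
  \<open>w\<close>.\<close>

lemma pure_tensor_eq_zero:
  assumes "v \<in> carrier V" "w \<in> carrier W" "t v w = \<zero>\<^bsub>P\<^esub>" "v \<noteq> \<zero>\<^bsub>V\<^esub>"
  shows "w = \<zero>\<^bsub>W\<^esub>"
proof -
  obtain \<phi> where \<phi>: "\<phi> v = 1" "\<And>x y. x \<in> carrier V \<Longrightarrow> y \<in> carrier V \<Longrightarrow> \<phi> (x \<oplus>\<^bsub>V\<^esub> y) = \<phi> x + \<phi> y"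
    "\<And>c x. x \<in> carrier V \<Longrightarrow> \<phi> (c \<odot>\<^bsub>V\<^esub> x) = c * \<phi> x"
    by (rule V.exists_functional[OF assms(1,4)]) (rule that)
  have "bilinear_on V W W (\<lambda>x y. \<phi> x \<odot>\<^bsub>W\<^esub> y)"
    by (rule bilinear_onI)
      (use \<phi> in \<open>auto simp: W.csmult_add_left W.csmult_add_right W.csmult_assoc mult.commute\<close>)
  then obtain h where h: "h \<in> linear_maps P W"
    "\<And>x y. x \<in> carrier V \<Longrightarrow> y \<in> carrier W \<Longrightarrow> h (t x y) = \<phi> x \<odot>\<^bsub>W\<^esub> y"
    using tensor_lift[OF W] by blast
  have "w = h (t v w)" using h(2)[OF assms(1,2)] \<phi>(1) assms(2) by simp
  also have "\<dots> = \<zero>\<^bsub>W\<^esub>"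
    unfolding assms(3) by (rule clinear_on_zero[OF tensor_cvector_space W]) (use h(1) in \<open>simp add: linear_maps_def\<close>)
  finally show ?thesis .
qed

end

section \<open>The functor \<open>V \<mapsto> V \<otimes> \<pi>\<close>\<close>

lemma with_action_simps [simp]:
  "carrier (with_action V \<rho>) = carrier V" "zero (with_action V \<rho>) = zero V"
  "add (with_action V \<rho>) = add V" "module.smult (with_action V \<rho>) = module.smult V"
  "act (with_action V \<rho>) = \<rho>"
  by (simp_all add: with_action_def module.extend_def rep.fields_def)

lemma trivial_rep_simps [simp]:
  "carrier (trivial_rep V) = carrier V" "zero (trivial_rep V) = zero V"
  "add (trivial_rep V) = add V" "module.smult (trivial_rep V) = module.smult V"
  "act (trivial_rep V) g = (\<lambda>x. x)"
  by (simp_all add: trivial_rep_def)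

lemma is_tensor_product_trivial_rep:
  "is_tensor_product (trivial_rep V :: ('g, 'u) rep) W P t \<longleftrightarrow> is_tensor_product V W P t"
  by (simp add: is_tensor_product_def bilinear_on_def clinear_on_def)

locale isotypic =
  fixes G :: "('g, 'b) monoid_scheme" and T :: "'g topology" and \<pi> :: "('g, 'u) rep"
  assumes lc: "lc_group G T" and tame: "tame TYPE('u) G T" and \<pi>: "\<pi> \<in> irreps G T"
begin

lemma group: "group G" and topological_group: "topological_group G T"
  using lc by (auto dest: lc_groupD)

lemmas \<pi>_smooth = irrepsD(1)[OF \<pi>] and \<pi>_irreducible = irrepsD(2)[OF \<pi>] and \<pi>_rep = irrepsD(3)[OF \<pi>]
lemmas \<pi>_space = representationD(1)[OF \<pi>_rep]

sublocale \<pi>: cspace \<pi> using \<pi>_space by (rule cspace.intro)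

text \<open>Since \<open>v0\<close> generates \<pi>, a homomorphism out of \<pi> is determined by
  its value at \<open>v0\<close>, and a homomorphism out of \<open>F V\<close> by its values on the
  tensors \<open>t V v v0\<close>.\<close>

definition v0 :: 'u where "v0 = (SOME v. v \<in> carrier \<pi> \<and> v \<noteq> \<zero>\<^bsub>\<pi>\<^esub>)"

lemma v0: "v0 \<in> carrier \<pi>" "v0 \<noteq> \<zero>\<^bsub>\<pi>\<^esub>"
proof -
  have "\<exists>v. v \<in> carrier \<pi> \<and> v \<noteq> \<zero>\<^bsub>\<pi>\<^esub>"
    using \<pi>_irreducible \<pi>.M.zero_closed unfolding irreducible_rep_iff by blast
  from someI_ex[OF this] show "v0 \<in> carrier \<pi>" "v0 \<noteq> \<zero>\<^bsub>\<pi>\<^esub>" by (simp_all add: v0_def)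
qed

lemma v0_cyclic:
  assumes "x \<in> carrier \<pi>"
  obtains a where "gset a \<subseteq> carrier G" "x = gact \<pi> a v0"
  by (rule irreducible_cyclic[OF group \<pi>_irreducible v0 assms]) (rule that)

definition P :: "(complex, 'u) module \<Rightarrow> (complex, 'u) module" where
  "P V = tensor_space (trivial_rep V :: ('g, 'u) rep) \<pi>"

definition t :: "(complex, 'u) module \<Rightarrow> 'u \<Rightarrow> 'u \<Rightarrow> 'u" where
  "t V = pure_tensor (trivial_rep V :: ('g, 'u) rep) \<pi>"

abbreviation F :: "(complex, 'u) module \<Rightarrow> ('g, 'u) rep" where
  "F \<equiv> isotypic_obj \<pi>"

text \<open>The choice in \<open>tensor_choice\<close> is a genuine tensor product: \<pi> is
  nonzero, so \<open>'u\<close> is infinite and the construction by coded lists applies, also when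
  \<open>V\<close> is zero.\<close>

lemma tensor:
  assumes V: "cvector_space V" shows "is_tensor_product V \<pi> (P V) (t V)"
proof -
  obtain code :: "('u \<times> 'u) list \<Rightarrow> 'u" where "inj code"
    by (rule list_code_exists[OF infinite_UNIV_cspace[OF \<pi>_space v0]]) (rule that)
  then obtain P' t' where "is_tensor_product V \<pi> P' t'"
    using tensor_product_exists[OF V \<pi>_space] by blast
  then have "\<exists>Pt. is_tensor_product (trivial_rep V :: ('g, 'u) rep) \<pi> (fst Pt) (snd Pt)"
    by (intro exI[of _ "(P', t')"]) (simp add: is_tensor_product_trivial_rep)
  from someI_ex[OF this] show ?thesis
    by (simp add: P_def t_def tensor_space_def pure_tensor_def tensor_choice_def
        is_tensor_product_trivial_rep)
qed

lemma carrier_F [simp]: "carrier (F V) = carrier (P V)" "zero (F V) = zero (P V)"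
  "add (F V) = add (P V)" "module.smult (F V) = module.smult (P V)"
  by (simp_all add: isotypic_obj_def tensor_rep_def P_def)

lemma tensor_map_props:
  fixes f g :: "'u \<Rightarrow> 'u"
  assumes V: "cvector_space V" and W: "cvector_space W" and f: "clinear_on V W f" and g: "clinear_on \<pi> \<pi> g"
  defines "h \<equiv> tensor_map (trivial_rep V :: ('g, 'u) rep) \<pi> (trivial_rep W :: ('g, 'u) rep) \<pi> f g"
  shows "h \<in> linear_maps (P V) (P W)"
    and "\<And>v x. v \<in> carrier V \<Longrightarrow> x \<in> carrier \<pi> \<Longrightarrow> h (t V v x) = t W (f v) (g x)"
proof -
  note tW = bilinear_onD[OF tensor_bilinear[OF W \<pi>_space tensor[OF W]]]
  have "bilinear_on V \<pi> (P W) (\<lambda>v x. t W (f v) (g x))"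
    by (rule bilinear_onI) (use tW clinear_onD[OF f] clinear_onD[OF g] in simp_all)
  from tensor_lift[OF V \<pi>_space tensor[OF V] tensor_cvector_space[OF W \<pi>_space tensor[OF W]] this]
  have ex: "\<exists>!h. h \<in> linear_maps (P V) (P W) \<and>
      (\<forall>v\<in>carrier V. \<forall>x\<in>carrier \<pi>. h (t V v x) = t W (f v) (g x))" .
  have "h = (THE h. h \<in> linear_maps (P V) (P W) \<and>
      (\<forall>v\<in>carrier V. \<forall>x\<in>carrier \<pi>. h (t V v x) = t W (f v) (g x)))"
    by (simp add: h_def tensor_map_def P_def t_def)
  with theI'[OF ex] show "h \<in> linear_maps (P V) (P W)"
    "\<And>v x. v \<in> carrier V \<Longrightarrow> x \<in> carrier \<pi> \<Longrightarrow> h (t V v x) = t W (f v) (g x)" by auto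
qed

lemma clinear_on_id: "clinear_on V V (\<lambda>x. x)"
  by (rule clinear_onI) auto

section \<open>The representation on the tensor product of a vector space with \<pi>\<close>

context
  fixes V :: "(complex, 'u) module"
  assumes V: "cvector_space V"
begin

interpretation V: cspace V using V by (rule cspace.intro)

lemma P_space: "cvector_space (P V)"
  by (rule tensor_cvector_space[OF V \<pi>_space tensor[OF V]])

interpretation P: cspace "P V" using P_space by (rule cspace.intro)

lemmas t_bilinear = tensor_bilinear[OF V \<pi>_space tensor[OF V]]
lemmas tD = bilinear_onD[OF t_bilinear]
lemmas t_ext = tensor_ext[OF V \<pi>_space tensor[OF V]]

lemma t_zero: "v \<in> carrier V \<Longrightarrow> t V v \<zero>\<^bsub>\<pi>\<^esub> = \<zero>\<^bsub>P V\<^esub>" "x \<in> carrier \<pi> \<Longrightarrow> t V \<zero>\<^bsub>V\<^esub> x = \<zero>\<^bsub>P V\<^esub>"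
  using tD(5)[of v "\<zero>\<^bsub>\<pi>\<^esub>" 0] tD(4)[of "\<zero>\<^bsub>V\<^esub>" x 0] tD(1)[of v "\<zero>\<^bsub>\<pi>\<^esub>"] tD(1)[of "\<zero>\<^bsub>V\<^esub>" x] by auto

lemma t_eq_zero:
  assumes "v \<in> carrier V" "x \<in> carrier \<pi>" "t V v x = \<zero>\<^bsub>P V\<^esub>" "x \<noteq> \<zero>\<^bsub>\<pi>\<^esub>" shows "v = \<zero>\<^bsub>V\<^esub>"
  using pure_tensor_eq_zero[OF V \<pi>_space tensor[OF V] assms(1-3)] assms(4) by blast

lemma t_inj:
  assumes "v \<in> carrier V" "w \<in> carrier V" "t V v v0 = t V w v0" shows "v = w"
proof (rule V.add_minus_eq_zero[OF assms(1,2)])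
  have "t V (v \<oplus>\<^bsub>V\<^esub> (- 1) \<odot>\<^bsub>V\<^esub> w) v0 = \<zero>\<^bsub>P V\<^esub>"
    using assms tD v0 by simp
  from t_eq_zero[OF _ v0(1) this v0(2)] show "v \<oplus>\<^bsub>V\<^esub> (- 1) \<odot>\<^bsub>V\<^esub> w = \<zero>\<^bsub>V\<^esub>" using assms by simp
qed

lemma act_F:
  assumes "g \<in> carrier G"
  shows "clinear_on (P V) (P V) (act (F V) g)"
    and "\<And>v x. v \<in> carrier V \<Longrightarrow> x \<in> carrier \<pi> \<Longrightarrow> act (F V) g (t V v x) = t V v (act \<pi> g x)"
proof -
  have "act (F V) g = tensor_map (trivial_rep V :: ('g, 'u) rep) \<pi> (trivial_rep V :: ('g, 'u) rep) \<pi>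
      (\<lambda>x. x) (act \<pi> g)" by (simp add: isotypic_obj_def tensor_rep_def)
  with tensor_map_props[OF V V clinear_on_id representationD(2)[OF \<pi>_rep assms]]
  show "clinear_on (P V) (P V) (act (F V) g)"
    "\<And>v x. v \<in> carrier V \<Longrightarrow> x \<in> carrier \<pi> \<Longrightarrow> act (F V) g (t V v x) = t V v (act \<pi> g x)"
    by (auto simp: linear_maps_def)
qed

lemma rep_F: "representation G (F V)"
proof (rule representationI)
  interpret group G by (rule group)
  note \<pi>D = representationD[OF \<pi>_rep]
  show "cvector_space (F V)" by (rule cvector_space_cong[OF P_space]) simp_all
  show "clinear_on (F V) (F V) (act (F V) g)" if "g \<in> carrier G" for g
    using act_F(1)[OF that] by (simp add: clinear_on_def)
  show "act (F V) \<one>\<^bsub>G\<^esub> u = u" if "u \<in> carrier (F V)" for u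
    by (rule t_ext[OF P_space act_F(1)[OF one_closed] clinear_on_id])
      (use that act_F(2)[OF one_closed] \<pi>D(3) in simp_all)
  show "act (F V) (g \<otimes>\<^bsub>G\<^esub> h) u = act (F V) g (act (F V) h u)"
    if gh: "g \<in> carrier G" "h \<in> carrier G" and u: "u \<in> carrier (F V)" for g h u
  proof (rule t_ext[OF P_space act_F(1)[OF m_closed[OF gh]]])
    show "clinear_on (P V) (P V) (\<lambda>u. act (F V) g (act (F V) h u))"
      using clinear_onD[OF act_F(1)[OF gh(1)]] clinear_onD[OF act_F(1)[OF gh(2)]]
      by (intro clinear_onI) simp_all
    show "act (F V) (g \<otimes>\<^bsub>G\<^esub> h) (t V v x) = act (F V) g (act (F V) h (t V v x))"
      if "v \<in> carrier V" "x \<in> carrier \<pi>" for v x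
      using that gh act_F(2) \<pi>D(4,5) by simp
  qed (use u in simp)
qed

lemma pure_intertwiner:
  assumes "v \<in> carrier V" shows "(\<lambda>x\<in>carrier \<pi>. t V v x) \<in> intertwiners G \<pi> (F V)"
  by (rule intertwiners_restrictI[OF \<pi>_rep]) (use tD act_F(2) assms in simp_all)

lemma gact_t:
  assumes "gset a \<subseteq> carrier G" "v \<in> carrier V" "x \<in> carrier \<pi>"
  shows "gact (F V) a (t V v x) = t V v (gact \<pi> a x)"
  using gact_intertwiner[OF \<pi>_rep assms(1,3) pure_intertwiner[OF assms(2)]] assms(3)
    gact_closed[OF \<pi>_rep assms(1,3)] by simp

text \<open>A finite sum of pure tensors is fixed as soon as all its second factors are, and their
  common stabilizer is open. An expression \<open>l u\<close> is chosen for each \<open>u\<close>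
  because \<open>smooth_repI\<close> takes the neighbourhood as a function of the vector.\<close>

lemma smooth_F: "smooth_rep G T (F V)"
proof -
  define l where "l u = (SOME l. set l \<subseteq> carrier V \<times> carrier \<pi> \<and> u = bsum (P V) (t V) l)" for u
  have l: "set (l u) \<subseteq> carrier V \<times> carrier \<pi> \<and> u = bsum (P V) (t V) (l u)" if u: "u \<in> carrier (P V)" for u
  proof -
    obtain k where "set k \<subseteq> carrier V \<times> carrier \<pi>" "u = bsum (P V) (t V) k"
      by (rule tensor_generated[OF V \<pi>_space tensor[OF V] u]) (rule that)
    then have "\<exists>l. set l \<subseteq> carrier V \<times> carrier \<pi> \<and> u = bsum (P V) (t V) l" by blast
    from someI_ex[OF this] show ?thesis unfolding l_def .
  qed
  define U where "U u = {g \<in> carrier G. \<forall>x\<in>snd ` set (l u). act \<pi> g x = x}" for u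
  have stab: "act (F V) g (bsum (P V) (t V) k) = bsum (P V) (t V) k"
    if "g \<in> carrier G" "\<forall>x\<in>snd ` set k. act \<pi> g x = x" "set k \<subseteq> carrier V \<times> carrier \<pi>" for g k
    using that(2,3)
  proof (induction k)
    case Nil
    show ?case using clinear_on_zero[OF P_space P_space act_F(1)[OF that(1)]] by simp
  next
    case (Cons p k)
    have c: "fst p \<in> carrier V" "snd p \<in> carrier \<pi>" "set k \<subseteq> carrier V \<times> carrier \<pi>"
      using Cons.prems by auto
    show ?case
      using clinear_onD(2)[OF act_F(1)[OF that(1)] tD(1)[OF c(1,2)] bsum_closed[OF V P_space t_bilinear c(3)]]
        act_F(2)[OF that(1) c(1,2)] Cons by simp
  qed
  have opG: "openin T (carrier G)"
    using openin_topspace[of T] topological_groupD(2)[OF topological_group] by simp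
  show ?thesis
  proof (rule smooth_repI[OF topological_group rep_F])
    fix u assume "u \<in> carrier (F V)"
    then have u: "set (l u) \<subseteq> carrier V \<times> carrier \<pi>" "u = bsum (P V) (t V) (l u)" using l by auto
    show "openin T (U u)"
      unfolding U_def by (rule stabilizer_open[OF topological_group \<pi>_smooth _ _ opG]) (use u(1) in auto)
    show "\<one>\<^bsub>G\<^esub> \<in> U u"
      unfolding U_def using u(1) representationD(3)[OF \<pi>_rep] monoid.one_closed[OF group.is_monoid[OF group]]
      by auto
    show "act (F V) g u = u" if "g \<in> U u" for g
      using stab[of g "l u"] that u by (simp add: U_def)
  qed
qed

text \<open>If \<open>x\<close> is a combination of the second factors in \<open>l\<close>, the
  tensor of \<open>v\<close> and \<open>x\<close> can be distributed over the terms of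
  \<open>l\<close> by changing their first factors, so no new term arises.\<close>

lemma bsum_absorb:
  assumes "set l \<subseteq> carrier V \<times> carrier \<pi>" "v \<in> carrier V" "x \<in> lspan \<pi> (map snd l)"
  obtains l' where "length l' = length l" "set l' \<subseteq> carrier V \<times> carrier \<pi>"
    "t V v x \<oplus>\<^bsub>P V\<^esub> bsum (P V) (t V) l = bsum (P V) (t V) l'"
  using assms(1,3)
proof (induction l arbitrary: x thesis)
  case Nil
  then show ?case using t_zero(1)[OF assms(2)] by (intro Nil(1)[of "[]"]) simp_all
next
  case (Cons p l)
  have c: "fst p \<in> carrier V" "snd p \<in> carrier \<pi>" "set l \<subseteq> carrier V \<times> carrier \<pi>"
    using Cons.prems by auto
  obtain z d where z: "z \<in> lspan \<pi> (map snd l)" "x = z \<oplus>\<^bsub>\<pi>\<^esub> d \<odot>\<^bsub>\<pi>\<^esub> snd p" using Cons.prems(3) by auto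
  have "set (map snd l) \<subseteq> carrier \<pi>" using c(3) by auto
  then have zc: "z \<in> carrier \<pi>" using csubspaceD(5)[OF \<pi>.csubspace_lspan z(1)] by simp
  obtain l' where l': "length l' = length l" "set l' \<subseteq> carrier V \<times> carrier \<pi>"
    "t V v z \<oplus>\<^bsub>P V\<^esub> bsum (P V) (t V) l = bsum (P V) (t V) l'"
    by (rule Cons.IH[OF _ c(3) z(1)]) (rule that)
  let ?p = "(d \<odot>\<^bsub>V\<^esub> v \<oplus>\<^bsub>V\<^esub> fst p, snd p)"
  note b = bsum_closed[OF V P_space t_bilinear c(3)]
  have "t V v x \<oplus>\<^bsub>P V\<^esub> bsum (P V) (t V) (p # l)
      = (t V v z \<oplus>\<^bsub>P V\<^esub> d \<odot>\<^bsub>P V\<^esub> t V v (snd p)) \<oplus>\<^bsub>P V\<^esub> (t V (fst p) (snd p) \<oplus>\<^bsub>P V\<^esub> bsum (P V) (t V) l)"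
    using z(2) zc c assms(2) by (simp add: tD)
  also have "\<dots> = (d \<odot>\<^bsub>P V\<^esub> t V v (snd p) \<oplus>\<^bsub>P V\<^esub> t V (fst p) (snd p)) \<oplus>\<^bsub>P V\<^esub> (t V v z \<oplus>\<^bsub>P V\<^esub> bsum (P V) (t V) l)"
    using b zc c assms(2) by (simp add: tD(1) P.M.a_ac)
  also have "\<dots> = bsum (P V) (t V) (?p # l')" using l'(3) c assms(2) by (simp add: tD)
  finally show ?case
    by (rule Cons.prems(1)[rotated 2]) (use l' c assms(2) in auto)
qed

text \<open>Shorten a representation of \<open>u\<close> as a sum of pure tensors as long as some second factor lies
  in the span of \<open>x0\<close> and the other ones; when this stops, the density theorem isolates one term.\<close>

lemma pure_or_separated:
  assumes x0: "x0 \<in> carrier \<pi>" and u: "u \<in> carrier (P V)"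
  shows "(\<exists>v\<in>carrier V. u = t V v x0) \<or>
    (\<exists>a v x. a \<in> ann G \<pi> [x0] \<and> gact (F V) a u = t V v x \<and>
      v \<in> carrier V \<and> v \<noteq> \<zero>\<^bsub>V\<^esub> \<and> x \<in> carrier \<pi> \<and> x \<noteq> \<zero>\<^bsub>\<pi>\<^esub>)"
    (is "?A u \<or> ?B u")
proof -
  have "?A (bsum (P V) (t V) l) \<or> ?B (bsum (P V) (t V) l)"
    if "length l = n" "set l \<subseteq> carrier V \<times> carrier \<pi>" for n l
    using that
  proof (induction n arbitrary: l)
    case 0
    then show ?case using t_zero(2)[OF x0] by (intro disjI1 bexI[of _ "\<zero>\<^bsub>V\<^esub>"]) simp_all
  next
    case (Suc n)
    obtain v x l' where l: "l = (v, x) # l'" using Suc.prems(1) by (cases l) auto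
    have n: "length l' = n" using Suc.prems(1) l by simp
    have c: "v \<in> carrier V" "x \<in> carrier \<pi>" "set l' \<subseteq> carrier V \<times> carrier \<pi>" using Suc.prems(2) l by auto
    let ?b = "bsum (P V) (t V)"
    note bc = bsum_closed[OF V P_space t_bilinear]
    have sl: "set (map snd l') \<subseteq> carrier \<pi>" using c(3) by auto
    consider "v = \<zero>\<^bsub>V\<^esub>" | "v \<noteq> \<zero>\<^bsub>V\<^esub>" "x \<in> lspan \<pi> (x0 # map snd l')"
      | "v \<noteq> \<zero>\<^bsub>V\<^esub>" "x \<notin> lspan \<pi> (x0 # map snd l')" by blast
    then show ?case
    proof cases
      case 1
      then have "?b l = ?b l'" using l t_zero(2)[OF c(2)] bc[OF c(3)] by simp
      then show ?thesis using Suc.IH[OF n c(3)] by simp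
    next
      case 2
      \<comment> \<open>In \<open>x = z + d x0\<close> the part with \<open>z\<close> is absorbed by
        the remaining terms, and the tensor of \<open>d v\<close> and \<open>x0\<close> is split
        off. In the induction hypothesis for the shorter sum, the split-off term either joins a pure
        tensor with \<open>x0\<close> or is killed by \<open>a\<close>.\<close>
      obtain z d where z: "z \<in> lspan \<pi> (map snd l')" "x = z \<oplus>\<^bsub>\<pi>\<^esub> d \<odot>\<^bsub>\<pi>\<^esub> x0" using 2(2) by auto
      have zc: "z \<in> carrier \<pi>" using csubspaceD(5)[OF \<pi>.csubspace_lspan[OF sl] z(1)] .
      obtain l'' where l'': "length l'' = length l'" "set l'' \<subseteq> carrier V \<times> carrier \<pi>"
        "t V v z \<oplus>\<^bsub>P V\<^esub> ?b l' = ?b l''"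
        by (rule bsum_absorb[OF c(3,1) z(1)]) (rule that)
      have dv: "d \<odot>\<^bsub>V\<^esub> v \<in> carrier V" using c(1) by simp
      note bl = bc[OF l''(2)] and td = tD(1)[OF dv x0]
      have "?b l = (t V v z \<oplus>\<^bsub>P V\<^esub> t V (d \<odot>\<^bsub>V\<^esub> v) x0) \<oplus>\<^bsub>P V\<^esub> ?b l'"
        using l z(2) zc c x0 by (simp add: tD)
      also have "\<dots> = t V (d \<odot>\<^bsub>V\<^esub> v) x0 \<oplus>\<^bsub>P V\<^esub> ?b l''"
        unfolding l''(3)[symmetric] using td tD(1)[OF c(1) zc] bc[OF c(3)] by (simp add: P.M.a_ac)
      finally have eq: "?b l = t V (d \<odot>\<^bsub>V\<^esub> v) x0 \<oplus>\<^bsub>P V\<^esub> ?b l''" .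
      from Suc.IH[OF _ l''(2)] n l''(1) have "?A (?b l'') \<or> ?B (?b l'')" by simp
      then show ?thesis
      proof
        assume "?A (?b l'')"
        then obtain w where w: "w \<in> carrier V" "?b l'' = t V w x0" by blast
        then have "?b l = t V (d \<odot>\<^bsub>V\<^esub> v \<oplus>\<^bsub>V\<^esub> w) x0" using eq dv x0 by (simp add: tD(2))
        then show ?thesis using dv w(1) by (intro disjI1 bexI[of _ "d \<odot>\<^bsub>V\<^esub> v \<oplus>\<^bsub>V\<^esub> w"]) auto
      next
        assume "?B (?b l'')"
        then obtain a w y where a: "a \<in> ann G \<pi> [x0]" "gact (F V) a (?b l'') = t V w y"
          "w \<in> carrier V" "w \<noteq> \<zero>\<^bsub>V\<^esub>" "y \<in> carrier \<pi>" "y \<noteq> \<zero>\<^bsub>\<pi>\<^esub>" by blast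
        have "gact \<pi> a x0 = \<zero>\<^bsub>\<pi>\<^esub>" using annD(2)[OF a(1)] by simp
        then have "gact (F V) a (?b l) = t V w y"
          unfolding eq
          using clinear_onD(2)[OF clinear_on_gact[OF rep_F annD(1)[OF a(1)]], of "t V (d \<odot>\<^bsub>V\<^esub> v) x0" "?b l''"]
            td bl gact_t[OF annD(1)[OF a(1)] dv x0] a(2) t_zero(1)[OF dv] tD(1)[OF a(3,5)] by simp
        then show ?thesis using a by blast
      qed
    next
      case 3
      \<comment> \<open>Listing \<open>x0\<close> among the vectors to be killed is what puts
        \<open>a\<close> into \<open>ann G \<pi> [x0]\<close>.\<close>
      obtain a where a: "a \<in> ann G \<pi> (x0 # map snd l')" "gact \<pi> a x \<noteq> \<zero>\<^bsub>\<pi>\<^esub>"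
        by (rule density[OF lc tame \<pi> _ c(2) 3(2)]) (use sl x0 in simp, rule that)
      note aG = annD(1)[OF a(1)]
      note lin = clinear_onD(2)[OF clinear_on_gact[OF rep_F aG], simplified]
      have ax: "gact \<pi> a x \<in> carrier \<pi>" by (rule gact_closed[OF \<pi>_rep aG c(2)])
      have "gact (F V) a (?b k) = \<zero>\<^bsub>P V\<^esub>" if "set k \<subseteq> set l'" for k
        using that
      proof (induction k)
        case Nil
        show ?case using gact_zero[OF rep_F aG] by simp
      next
        case (Cons p k)
        have p: "fst p \<in> carrier V" "snd p \<in> carrier \<pi>" "set k \<subseteq> carrier V \<times> carrier \<pi>"
          using Cons.prems c(3) by auto
        have "gact \<pi> a (snd p) = \<zero>\<^bsub>\<pi>\<^esub>" using annD(2)[OF a(1), of "snd p"] Cons.prems by auto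
        then show ?case
          using lin[OF tD(1)[OF p(1,2)] bc[OF p(3)]] gact_t[OF aG p(1,2)] t_zero(1)[OF p(1)] Cons by simp
      qed
      then have "gact (F V) a (?b l) = t V v (gact \<pi> a x)"
        using lin[OF tD(1)[OF c(1,2)] bc[OF c(3)]] gact_t[OF aG c(1,2)] tD(1)[OF c(1) ax] by (simp add: l)
      moreover have "a \<in> ann G \<pi> [x0]" using a(1) by (simp add: ann_def)
      ultimately show ?thesis using a(2) ax c(1) 3(1) by blast
    qed
  qed
  moreover obtain l where "set l \<subseteq> carrier V \<times> carrier \<pi>" "u = bsum (P V) (t V) l"
    by (rule tensor_generated[OF V \<pi>_space tensor[OF V] u]) (rule that)
  ultimately show ?thesis by blast
qed

text \<open>Apply \<open>pure_or_separated\<close> to \<open>u\<close> in the kernel, with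
  \<open>x0 = 0\<close>: either \<open>u\<close> is a tensor with second factor zero, so
  \<open>u = 0\<close>, or some \<open>a u\<close> is a pure tensor with nonzero factors, which
  \<open>f\<close> would have to kill.\<close>

lemma intertwiner_F_inj:
  assumes M: "representation G M" and f: "f \<in> intertwiners G (F V) M"
    and nz: "\<And>v x. v \<in> carrier V \<Longrightarrow> v \<noteq> \<zero>\<^bsub>V\<^esub> \<Longrightarrow> x \<in> carrier \<pi> \<Longrightarrow> x \<noteq> \<zero>\<^bsub>\<pi>\<^esub> \<Longrightarrow> f (t V v x) \<noteq> \<zero>\<^bsub>M\<^esub>"
  shows "inj_on f (carrier (F V))"
proof (rule clinear_on_inj[OF representationD(1)[OF rep_F] representationD(1)[OF M] intertwinersD(6)[OF f]])
  fix u assume u: "u \<in> carrier (F V)" "f u = \<zero>\<^bsub>M\<^esub>"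
  then have uP: "u \<in> carrier (P V)" by simp
  have "\<not> (gact (F V) a u = t V v x \<and> v \<in> carrier V \<and> v \<noteq> \<zero>\<^bsub>V\<^esub> \<and> x \<in> carrier \<pi> \<and> x \<noteq> \<zero>\<^bsub>\<pi>\<^esub>)"
    if "a \<in> ann G \<pi> [\<zero>\<^bsub>\<pi>\<^esub>]" for a v x
  proof
    assume *: "gact (F V) a u = t V v x \<and> v \<in> carrier V \<and> v \<noteq> \<zero>\<^bsub>V\<^esub> \<and> x \<in> carrier \<pi> \<and> x \<noteq> \<zero>\<^bsub>\<pi>\<^esub>"
    then have "f (t V v x) = \<zero>\<^bsub>M\<^esub>"
      using gact_intertwiner[OF rep_F annD(1)[OF that] u(1) f] u(2) gact_zero[OF M annD(1)[OF that]] by simp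
    with nz[of v x] * show False by blast
  qed
  then obtain v where "v \<in> carrier V" "u = t V v \<zero>\<^bsub>\<pi>\<^esub>"
    using pure_or_separated[OF \<pi>.M.zero_closed uP] by blast
  then show "u = \<zero>\<^bsub>F V\<^esub>" using t_zero(1) by simp
qed

text \<open>A nonzero map from \<open>F V\<close> to an irreducible \<sigma> is nonzero on some pure
  tensor; fixing its first factor gives a nonzero homomorphism \<pi> \<rightarrow> \<sigma>, which
  is an isomorphism.\<close>

lemma Supp_F: "Supp G T (F V) \<subseteq> {rep_class G T \<pi>}"
proof
  fix c assume "c \<in> Supp G T (F V)"
  then obtain \<sigma> f u where c: "c \<in> dual G T" "\<sigma> \<in> c" and f: "f \<in> intertwiners G (F V) \<sigma>"
    and u: "u \<in> carrier (F V)" "f u \<noteq> \<zero>\<^bsub>\<sigma>\<^esub>" unfolding Supp_def by blast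
  have \<sigma>: "\<sigma> \<in> irreps G T" "c = rep_class G T \<sigma>" using dual_memberD[OF c] by auto
  note r\<sigma> = irrepsD(3)[OF \<sigma>(1)]
  interpret \<sigma>: cspace \<sigma> using r\<sigma> by (rule representationD)
  have "\<exists>v\<in>carrier V. \<exists>x\<in>carrier \<pi>. f (t V v x) \<noteq> \<zero>\<^bsub>\<sigma>\<^esub>"
  proof (rule ccontr)
    assume "\<not> ?thesis"
    then have z: "f (t V v x) = \<zero>\<^bsub>\<sigma>\<^esub>" if "v \<in> carrier V" "x \<in> carrier \<pi>" for v x using that by blast
    have "f u = \<zero>\<^bsub>\<sigma>\<^esub>"
    proof (rule t_ext[OF representationD(1)[OF r\<sigma>], of f "\<lambda>u. \<zero>\<^bsub>\<sigma>\<^esub>"])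
      show "clinear_on (P V) \<sigma> f" using intertwinersD(6)[OF f] by (simp add: clinear_on_def)
      show "clinear_on (P V) \<sigma> (\<lambda>u. \<zero>\<^bsub>\<sigma>\<^esub>)" by (rule clinear_onI) simp_all
    qed (use z u in simp_all)
    then show False using u(2) by simp
  qed
  then obtain v x where v: "v \<in> carrier V" "x \<in> carrier \<pi>" "f (t V v x) \<noteq> \<zero>\<^bsub>\<sigma>\<^esub>" by blast
  let ?h = "compose (carrier \<pi>) f (\<lambda>x\<in>carrier \<pi>. t V v x)"
  have h: "?h \<in> intertwiners G \<pi> \<sigma>" by (rule intertwiners_compose[OF \<pi>_rep pure_intertwiner[OF v(1)] f])
  have "?h x \<noteq> \<zero>\<^bsub>\<sigma>\<^esub>" using v by (simp add: compose_def)
  then have "bij_betw ?h (carrier \<pi>) (carrier \<sigma>)"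
    by (rule irreducible_bij[OF \<pi>_irreducible irrepsD(2)[OF \<sigma>(1)] h v(2)])
  then have "rep_isomorphic G \<pi> \<sigma>" unfolding rep_isomorphic_def by (rule bexI[OF _ h])
  then have "\<sigma> \<in> rep_class G T \<pi>" using \<sigma>(1) by (simp add: rep_class_def)
  moreover have "rep_class G T \<pi> \<in> dual G T" using \<pi> by (simp add: dual_def)
  ultimately have "rep_class G T \<pi> = rep_class G T \<sigma>" by (intro dual_memberD(2))
  then show "c \<in> {rep_class G T \<pi>}" using \<sigma>(2) by simp
qed

end

end

section \<open>Equivalences of categories\<close>

text \<open>The criterion by full faithfulness and essential surjectivity. The inverse functor sends
  a morphism \<open>g\<close> to the preimage of \<open>g\<close> conjugated by chosen isomorphisms
  \<open>e\<close> and \<open>i\<close>, and identities in \<open>C\<close> are proved after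
  applying the functor, by faithfulness.\<close>

lemma is_equivalenceI:
  assumes F: "is_functor C D Fo Fm"
    and ff: "\<And>X Y g. X \<in> Ob C \<Longrightarrow> Y \<in> Ob C \<Longrightarrow> g \<in> Mor D (Fo X) (Fo Y) \<Longrightarrow>
      \<exists>f\<in>Mor C X Y. Fm X Y f = g"
    and faithful: "\<And>X Y f f'. X \<in> Ob C \<Longrightarrow> Y \<in> Ob C \<Longrightarrow> f \<in> Mor C X Y \<Longrightarrow> f' \<in> Mor C X Y \<Longrightarrow>
      Fm X Y f = Fm X Y f' \<Longrightarrow> f = f'"
    and es: "\<And>Y. Y \<in> Ob D \<Longrightarrow> \<exists>X\<in>Ob C. \<exists>f. is_iso D (Fo X) Y f"
  shows "is_equivalence C D Fo Fm"
proof -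
  have C: "is_category C" and D: "is_category D" using F by (auto simp: is_functor_def)
  have Cid: "Idn C X \<in> Mor C X X" if "X \<in> Ob C" for X
    using C that unfolding is_category_def by blast
  have Ccl: "Cmp C X Y Z g f \<in> Mor C X Z"
    if "X \<in> Ob C" "Y \<in> Ob C" "Z \<in> Ob C" "f \<in> Mor C X Y" "g \<in> Mor C Y Z" for X Y Z f g
    using C that unfolding is_category_def by blast
  have Dcl: "Cmp D X Y Z g f \<in> Mor D X Z"
    if "X \<in> Ob D" "Y \<in> Ob D" "Z \<in> Ob D" "f \<in> Mor D X Y" "g \<in> Mor D Y Z" for X Y Z f g
    using D that unfolding is_category_def by blast
  have Did: "Idn D X \<in> Mor D X X" if "X \<in> Ob D" for X
    using D that unfolding is_category_def by blast
  have Dr: "Cmp D X X Y f (Idn D X) = f" and Dl: "Cmp D X Y Y (Idn D Y) f = f"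
    if "X \<in> Ob D" "Y \<in> Ob D" "f \<in> Mor D X Y" for X Y f
    using D that unfolding is_category_def by blast+
  have Das: "Cmp D W Y Z h (Cmp D W X Y g f) = Cmp D W X Z (Cmp D X Y Z h g) f"
    if "W \<in> Ob D" "X \<in> Ob D" "Y \<in> Ob D" "Z \<in> Ob D" "f \<in> Mor D W X" "g \<in> Mor D X Y" "h \<in> Mor D Y Z"
    for W X Y Z f g h
    using D that unfolding is_category_def by blast
  have Fob: "Fo X \<in> Ob D" if "X \<in> Ob C" for X using F that by (auto simp: is_functor_def)
  have Fmor: "Fm X Y f \<in> Mor D (Fo X) (Fo Y)" if "X \<in> Ob C" "Y \<in> Ob C" "f \<in> Mor C X Y" for X Y f
    using F that by (auto simp: is_functor_def)
  have Fid: "Fm X X (Idn C X) = Idn D (Fo X)" if "X \<in> Ob C" for X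
    using F that by (auto simp: is_functor_def)
  have Fcmp: "Fm X Z (Cmp C X Y Z g f) = Cmp D (Fo X) (Fo Y) (Fo Z) (Fm Y Z g) (Fm X Y f)"
    if "X \<in> Ob C" "Y \<in> Ob C" "Z \<in> Ob C" "f \<in> Mor C X Y" "g \<in> Mor C Y Z" for X Y Z f g
    using F that unfolding is_functor_def by blast
  have "\<forall>Y\<in>Ob D. \<exists>X e i. X \<in> Ob C \<and> e \<in> Mor D (Fo X) Y \<and> i \<in> Mor D Y (Fo X) \<and>
      Cmp D (Fo X) Y (Fo X) i e = Idn D (Fo X) \<and> Cmp D Y (Fo X) Y e i = Idn D Y"
    using es unfolding is_iso_def by blast
  then obtain Ho e i where Ho: "\<And>Y. Y \<in> Ob D \<Longrightarrow> Ho Y \<in> Ob C"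
    and e: "\<And>Y. Y \<in> Ob D \<Longrightarrow> e Y \<in> Mor D (Fo (Ho Y)) Y"
    and i: "\<And>Y. Y \<in> Ob D \<Longrightarrow> i Y \<in> Mor D Y (Fo (Ho Y))"
    and ie: "\<And>Y. Y \<in> Ob D \<Longrightarrow> Cmp D (Fo (Ho Y)) Y (Fo (Ho Y)) (i Y) (e Y) = Idn D (Fo (Ho Y))"
    and ei: "\<And>Y. Y \<in> Ob D \<Longrightarrow> Cmp D Y (Fo (Ho Y)) Y (e Y) (i Y) = Idn D Y"
    by metis
  define un where "un X Y g = (SOME f. f \<in> Mor C X Y \<and> Fm X Y f = g)" for X Y g
  have un: "un X Y g \<in> Mor C X Y" "Fm X Y (un X Y g) = g"
    if "X \<in> Ob C" "Y \<in> Ob C" "g \<in> Mor D (Fo X) (Fo Y)" for X Y g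
  proof -
    have "\<exists>f. f \<in> Mor C X Y \<and> Fm X Y f = g" using ff[OF that] by blast
    from someI_ex[OF this] show "un X Y g \<in> Mor C X Y" "Fm X Y (un X Y g) = g"
      by (simp_all add: un_def)
  qed
  let ?K = "\<lambda>Y. Fo (Ho Y)"
  define cj where "cj Y Z g = Cmp D (?K Y) Z (?K Z) (i Z) (Cmp D (?K Y) Y Z g (e Y))" for Y Z g
  have cj: "cj Y Z g \<in> Mor D (?K Y) (?K Z)" if "Y \<in> Ob D" "Z \<in> Ob D" "g \<in> Mor D Y Z" for Y Z g
    unfolding cj_def using that Fob Ho by (intro Dcl e i) auto
  \<comment> \<open>This is naturality of \<open>e\<close>, and it also carries the proof that
    \<open>Hm\<close> preserves composition.\<close>
  have e_cj: "Cmp D (?K Y) (?K Z) Z (e Z) (cj Y Z g) = Cmp D (?K Y) Y Z g (e Y)"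
    if "Y \<in> Ob D" "Z \<in> Ob D" "g \<in> Mor D Y Z" for Y Z g
  proof -
    have o: "?K Y \<in> Ob D" "?K Z \<in> Ob D" using that Fob Ho by auto
    have m: "Cmp D (?K Y) Y Z g (e Y) \<in> Mor D (?K Y) Z" using that o e by (intro Dcl) auto
    show ?thesis
      unfolding cj_def Das[OF o(1) that(2) o(2) that(2) m i[OF that(2)] e[OF that(2)]] ei[OF that(2)]
      by (rule Dl[OF o(1) that(2) m])
  qed
  define Hm where "Hm Y Z g = un (Ho Y) (Ho Z) (cj Y Z g)" for Y Z g
  have Hm: "Hm Y Z g \<in> Mor C (Ho Y) (Ho Z)" "Fm (Ho Y) (Ho Z) (Hm Y Z g) = cj Y Z g"
    if "Y \<in> Ob D" "Z \<in> Ob D" "g \<in> Mor D Y Z" for Y Z g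
    unfolding Hm_def by (rule un[OF Ho[OF that(1)] Ho[OF that(2)] cj[OF that]])+
  have H: "is_functor D C Ho Hm"
    unfolding is_functor_def
  proof (intro conjI ballI C D)
    fix Y assume Y: "Y \<in> Ob D"
    show "Ho Y \<in> Ob C" by (rule Ho[OF Y])
    show "Hm Y Y (Idn D Y) = Idn C (Ho Y)"
    proof (rule faithful[OF Ho[OF Y] Ho[OF Y] Hm(1)[OF Y Y Did[OF Y]] Cid[OF Ho[OF Y]]])
      show "Fm (Ho Y) (Ho Y) (Hm Y Y (Idn D Y)) = Fm (Ho Y) (Ho Y) (Idn C (Ho Y))"
        unfolding Hm(2)[OF Y Y Did[OF Y]] Fid[OF Ho[OF Y]] cj_def
          Dl[OF Fob[OF Ho[OF Y]] Y e[OF Y]] by (rule ie[OF Y])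
    qed
  next
    fix Y Z g assume "Y \<in> Ob D" "Z \<in> Ob D" "g \<in> Mor D Y Z"
    then show "Hm Y Z g \<in> Mor C (Ho Y) (Ho Z)" by (rule Hm)
  next
    fix X Y Z f g assume o: "X \<in> Ob D" "Y \<in> Ob D" "Z \<in> Ob D" and f: "f \<in> Mor D X Y" and g: "g \<in> Mor D Y Z"
    note oC = Ho[OF o(1)] Ho[OF o(2)] Ho[OF o(3)]
    note oF = Fob[OF oC(1)] Fob[OF oC(2)] Fob[OF oC(3)]
    have gf: "Cmp D X Y Z g f \<in> Mor D X Z" using o f g by (intro Dcl)
    have fe: "Cmp D (?K X) X Y f (e X) \<in> Mor D (?K X) Y" using o oF f e by (intro Dcl) auto
    have ge: "Cmp D (?K Y) Y Z g (e Y) \<in> Mor D (?K Y) Z" using o oF g e by (intro Dcl) auto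
    show "Hm X Z (Cmp D X Y Z g f) = Cmp C (Ho X) (Ho Y) (Ho Z) (Hm Y Z g) (Hm X Y f)"
    proof (rule faithful[OF oC(1,3) Hm(1)[OF o(1,3) gf] Ccl[OF oC Hm(1)[OF o(1,2) f] Hm(1)[OF o(2,3) g]]])
      have "Cmp D (?K X) (?K Y) (?K Z) (cj Y Z g) (cj X Y f)
          = Cmp D (?K X) Z (?K Z) (i Z)
              (Cmp D (?K X) (?K Y) Z (Cmp D (?K Y) Y Z g (e Y)) (cj X Y f))"
        unfolding cj_def[of Y Z g]
        by (rule Das[OF oF(1,2) o(3) oF(3) cj[OF o(1,2) f] ge i[OF o(3)], symmetric])
      also have "Cmp D (?K X) (?K Y) Z (Cmp D (?K Y) Y Z g (e Y)) (cj X Y f)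
          = Cmp D (?K X) Y Z g (Cmp D (?K X) (?K Y) Y (e Y) (cj X Y f))"
        by (rule Das[OF oF(1,2) o(2,3) cj[OF o(1,2) f] e[OF o(2)] g, symmetric])
      also have "\<dots> = Cmp D (?K X) X Z (Cmp D X Y Z g f) (e X)"
        unfolding e_cj[OF o(1,2) f] by (rule Das[OF oF(1) o e[OF o(1)] f g])
      finally have "Cmp D (?K X) (?K Y) (?K Z) (cj Y Z g) (cj X Y f) = cj X Z (Cmp D X Y Z g f)"
        unfolding cj_def[of X Z] .
      then show "Fm (Ho X) (Ho Z) (Hm X Z (Cmp D X Y Z g f))
          = Fm (Ho X) (Ho Z) (Cmp C (Ho X) (Ho Y) (Ho Z) (Hm Y Z g) (Hm X Y f))"
        unfolding Fcmp[OF oC Hm(1)[OF o(1,2) f] Hm(1)[OF o(2,3) g]] Hm(2)[OF o(1,3) gf]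
          Hm(2)[OF o(1,2) f] Hm(2)[OF o(2,3) g] by simp
    qed
  qed
  have DD: "naturally_isomorphic D D (\<lambda>X. ?K X) (\<lambda>X Y f. Fm (Ho X) (Ho Y) (Hm X Y f)) (\<lambda>X. X) (\<lambda>X Y f. f)"
    unfolding naturally_isomorphic_def
  proof (intro exI[of _ e] conjI ballI)
    fix Y assume Y: "Y \<in> Ob D"
    show "is_iso D (?K Y) Y (e Y)"
      unfolding is_iso_def using e[OF Y] i[OF Y] ie[OF Y] ei[OF Y] by blast
  next
    fix X Y f assume "X \<in> Ob D" "Y \<in> Ob D" "f \<in> Mor D X Y"
    then show "Cmp D (?K X) (?K Y) Y (e Y) (Fm (Ho X) (Ho Y) (Hm X Y f)) = Cmp D (?K X) X Y f (e X)"
      by (simp add: Hm(2) e_cj)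
  qed
  \<comment> \<open>The unit at \<open>X\<close> is the preimage of \<open>i (Fo X)\<close>, which
    is a morphism from \<open>Fo X\<close> to \<open>Fo (Ho (Fo X))\<close>.\<close>
  have CC: "naturally_isomorphic C C (\<lambda>X. X) (\<lambda>X Y f. f) (\<lambda>X. Ho (Fo X)) (\<lambda>X Y f. Hm (Fo X) (Fo Y) (Fm X Y f))"
    unfolding naturally_isomorphic_def
  proof (intro exI[of _ "\<lambda>X. un X (Ho (Fo X)) (i (Fo X))"] conjI ballI)
    fix X assume X: "X \<in> Ob C"
    note FX = Fob[OF X] and HX = Ho[OF Fob[OF X]]
    note u = un[OF X HX i[OF FX]] and w = un[OF HX X e[OF FX]]
    show "is_iso C X (Ho (Fo X)) (un X (Ho (Fo X)) (i (Fo X)))"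
      unfolding is_iso_def
    proof (intro conjI bexI[of _ "un (Ho (Fo X)) X (e (Fo X))"])
      show "Cmp C X (Ho (Fo X)) X (un (Ho (Fo X)) X (e (Fo X))) (un X (Ho (Fo X)) (i (Fo X))) = Idn C X"
        by (rule faithful[OF X X Ccl[OF X HX X u(1) w(1)] Cid[OF X]])
          (simp only: Fcmp[OF X HX X u(1) w(1)] u(2) w(2) ei[OF FX] Fid[OF X])
      show "Cmp C (Ho (Fo X)) X (Ho (Fo X)) (un X (Ho (Fo X)) (i (Fo X))) (un (Ho (Fo X)) X (e (Fo X)))
          = Idn C (Ho (Fo X))"
        by (rule faithful[OF HX HX Ccl[OF HX X HX w(1) u(1)] Cid[OF HX]])
          (simp only: Fcmp[OF HX X HX w(1) u(1)] u(2) w(2) ie[OF FX] Fid[OF HX])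
    qed (rule u w)+
  next
    fix X Y f assume X: "X \<in> Ob C" and Y: "Y \<in> Ob C" and f: "f \<in> Mor C X Y"
    note FX = Fob[OF X] and HX = Ho[OF Fob[OF X]] and FY = Fob[OF Y] and HY = Ho[OF Fob[OF Y]]
    note FHX = Fob[OF HX] and FHY = Fob[OF HY]
    note uX = un[OF X HX i[OF FX]] and uY = un[OF Y HY i[OF FY]] and Ff = Fmor[OF X Y f]
    note h = Hm[OF FX FY Ff]
    have fe: "Cmp D (?K (Fo X)) (Fo X) (Fo Y) (Fm X Y f) (e (Fo X)) \<in> Mor D (?K (Fo X)) (Fo Y)"
      by (rule Dcl[OF FHX FX FY e[OF FX] Ff])
    show "Cmp C X Y (Ho (Fo Y)) (un Y (Ho (Fo Y)) (i (Fo Y))) f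
        = Cmp C X (Ho (Fo X)) (Ho (Fo Y)) (Hm (Fo X) (Fo Y) (Fm X Y f)) (un X (Ho (Fo X)) (i (Fo X)))"
    proof (rule faithful[OF X HY Ccl[OF X Y HY f uY(1)] Ccl[OF X HX HY uX(1) h(1)]])
      have "Cmp D (Fo X) (?K (Fo X)) (?K (Fo Y)) (cj (Fo X) (Fo Y) (Fm X Y f)) (i (Fo X))
          = Cmp D (Fo X) (Fo Y) (?K (Fo Y)) (i (Fo Y))
             (Cmp D (Fo X) (?K (Fo X)) (Fo Y) (Cmp D (?K (Fo X)) (Fo X) (Fo Y) (Fm X Y f) (e (Fo X))) (i (Fo X)))"
        unfolding cj_def by (rule Das[OF FX FHX FY FHY i[OF FX] fe i[OF FY], symmetric])
      also have "Cmp D (Fo X) (?K (Fo X)) (Fo Y) (Cmp D (?K (Fo X)) (Fo X) (Fo Y) (Fm X Y f) (e (Fo X))) (i (Fo X))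
          = Fm X Y f"
        unfolding Das[OF FX FHX FX FY i[OF FX] e[OF FX] Ff, symmetric] ei[OF FX] by (rule Dr[OF FX FY Ff])
      finally show "Fm X (Ho (Fo Y)) (Cmp C X Y (Ho (Fo Y)) (un Y (Ho (Fo Y)) (i (Fo Y))) f)
        = Fm X (Ho (Fo Y)) (Cmp C X (Ho (Fo X)) (Ho (Fo Y)) (Hm (Fo X) (Fo Y) (Fm X Y f)) (un X (Ho (Fo X)) (i (Fo X))))"
        unfolding Fcmp[OF X Y HY f uY(1)] Fcmp[OF X HX HY uX(1) h(1)] uX(2) uY(2) h(2) by simp
    qed
  qed
  show ?thesis unfolding is_equivalence_def using F H CC DD by blast
qed

section \<open>The categories of vector spaces and of smooth representations\<close>

lemma linear_maps_id: "(\<lambda>x\<in>carrier V. x) \<in> linear_maps V V" if "cvector_space V"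
proof -
  interpret cspace V using that by (rule cspace.intro)
  show ?thesis by (auto simp: linear_maps_def intro!: clinear_onI)
qed

lemma linear_maps_compose:
  assumes "cvector_space U" "f \<in> linear_maps U V" "g \<in> linear_maps V W"
  shows "compose (carrier U) g f \<in> linear_maps U W"
proof -
  interpret cspace U using assms(1) by (rule cspace.intro)
  have f: "clinear_on U V f" and g: "clinear_on V W g" using assms by (auto simp: linear_maps_def)
  show ?thesis
    unfolding linear_maps_def
    by (auto intro!: clinear_onI simp: compose_def clinear_onD[OF f] clinear_onD[OF g])
qed

lemma extensional_compose_id:
  assumes "f \<in> extensional A" "f \<in> A \<rightarrow> B"
  shows "compose A f (\<lambda>x\<in>A. x) = f" "compose A (\<lambda>x\<in>B. x) f = f"
  using assms by (auto simp: compose_def extensional_def fun_eq_iff Pi_def)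

lemma is_category_Vec: "is_category (Vec :: ((complex, 'u) module, 'u \<Rightarrow> 'u) cat)"
proof -
  have e: "f \<in> extensional (carrier V)" "f \<in> carrier V \<rightarrow> carrier W"
    if "f \<in> linear_maps V W" for f and V W :: "(complex, 'u) module"
    using that by (auto simp: linear_maps_def clinear_on_def)
  show ?thesis
    unfolding is_category_def Vec_def
    using linear_maps_id linear_maps_compose extensional_compose_id[OF e] e(2)
    by (auto simp: compose_assoc)
qed

lemma is_category_Rep: "is_category (Rep G T :: (('g, 'u) rep, 'u \<Rightarrow> 'u) cat)"
proof -
  have e: "f \<in> extensional (carrier V)" "f \<in> carrier V \<rightarrow> carrier W"
    if "f \<in> intertwiners G V W" for f and V W :: "('g, 'u) rep"
    using that by (auto simp: intertwiners_def linear_maps_def clinear_on_def)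
  show ?thesis
    unfolding is_category_def Rep_def
    using extensional_compose_id[OF e] e(2)
    by (auto intro: intertwiners_id[OF smooth_representation]
        intertwiners_compose[OF smooth_representation] simp: compose_assoc)
qed

lemma is_category_full_subcategory:
  assumes "is_category C" shows "is_category (full_subcategory C Q)"
  using assms by (simp add: is_category_def full_subcategory_def)

section \<open>Full faithfulness and essential surjectivity\<close>

context isotypic
begin

text \<open>Equivariance has to be checked on pure tensors only, where the group acts on the second
  factor and \<open>f\<close> on the first.\<close>

lemma isotypic_mor_props:
  assumes V: "cvector_space V" and W: "cvector_space W" and f: "f \<in> linear_maps V W"
  shows "isotypic_mor \<pi> V W f \<in> intertwiners G (F V) (F W)"
    and "\<And>v x. v \<in> carrier V \<Longrightarrow> x \<in> carrier \<pi> \<Longrightarrow> isotypic_mor \<pi> V W f (t V v x) = t W (f v) x"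
proof -
  let ?h = "isotypic_mor \<pi> V W f"
  have fl: "clinear_on V W f" using f by (simp add: linear_maps_def)
  have h: "?h \<in> linear_maps (P V) (P W)"
    "\<And>v x. v \<in> carrier V \<Longrightarrow> x \<in> carrier \<pi> \<Longrightarrow> ?h (t V v x) = t W (f v) x"
    using tensor_map_props[OF V W fl clinear_on_id] by (simp_all add: isotypic_mor_def)
  then show "\<And>v x. v \<in> carrier V \<Longrightarrow> x \<in> carrier \<pi> \<Longrightarrow> ?h (t V v x) = t W (f v) x" by blast
  have hl: "clinear_on (P V) (P W) ?h" using h(1) by (simp add: linear_maps_def)
  have eq: "?h (act (F V) g u) = act (F W) g (?h u)" if g: "g \<in> carrier G" and u: "u \<in> carrier (P V)" for g u
  proof (rule t_ext[OF V P_space[OF W], where f = "\<lambda>u. ?h (act (F V) g u)" and h = "\<lambda>u. act (F W) g (?h u)"])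
    note aV = act_F[OF V g] and aW = act_F[OF W g]
    show "clinear_on (P V) (P W) (\<lambda>u. ?h (act (F V) g u))"
      by (rule clinear_onI) (simp_all add: clinear_onD[OF hl] clinear_onD[OF aV(1)])
    show "clinear_on (P V) (P W) (\<lambda>u. act (F W) g (?h u))"
      by (rule clinear_onI) (simp_all add: clinear_onD[OF hl] clinear_onD[OF aW(1)])
    show "?h (act (F V) g (t V v x)) = act (F W) g (?h (t V v x))"
      if "v \<in> carrier V" "x \<in> carrier \<pi>" for v x
      using that h(2) aV(2) aW(2) clinear_onD(1)[OF fl] representationD(5)[OF \<pi>_rep g] by simp
  qed (rule u)
  show "?h \<in> intertwiners G (F V) (F W)"
    by (rule intertwinersI) (use h(1) clinear_onD[OF hl] eq in \<open>simp_all add: linear_maps_def\<close>)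
qed

lemma intertwiners_F_eqI:
  assumes V: "cvector_space V" and M: "representation G M"
    and "f \<in> intertwiners G (F V) M" "h \<in> intertwiners G (F V) M"
    and "\<And>v x. v \<in> carrier V \<Longrightarrow> x \<in> carrier \<pi> \<Longrightarrow> f (t V v x) = h (t V v x)"
  shows "f = h"
proof (rule extensionalityI[of _ "carrier (F V)"])
  have l: "clinear_on (P V) M f" "clinear_on (P V) M h"
    using intertwinersD(6)[OF assms(3)] intertwinersD(6)[OF assms(4)] by (simp_all add: clinear_on_def)
  show "f u = h u" if "u \<in> carrier (F V)" for u
    by (rule t_ext[OF V representationD(1)[OF M] l assms(5)]) (use that in simp_all)
qed (rule intertwinersD(4)[OF assms(3)] intertwinersD(4)[OF assms(4)])+

text \<open>The vector \<open>h (t V v v0)\<close> is killed by the annihilator of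
  \<open>v0\<close>, so the second alternative of \<open>pure_or_separated\<close> is excluded and
  the vector has the form \<open>t W w v0\<close>. This \<open>w\<close> is unique and becomes
  \<open>f v\<close>; as \<open>v0\<close> is cyclic, agreement at \<open>v0\<close> spreads to all
  second factors.\<close>

lemma full_F:
  assumes V: "cvector_space V" and W: "cvector_space W" and h: "h \<in> intertwiners G (F V) (F W)"
  shows "\<exists>f\<in>linear_maps V W. isotypic_mor \<pi> V W f = h"
proof -
  interpret V: cspace V using V by (rule cspace.intro)
  interpret W: cspace W using W by (rule cspace.intro)
  note hD = intertwinersD[OF h] and tV = tD[OF V] and tW = tD[OF W]
  have hgact: "h (t V v (gact \<pi> a x)) = gact (F W) a (h (t V v x))"
    if "gset a \<subseteq> carrier G" "v \<in> carrier V" "x \<in> carrier \<pi>" for a v x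
    using gact_intertwiner[OF rep_F[OF V] that(1) _ h, of "t V v x"] tV(1)[OF that(2,3)]
      gact_t[OF V that] by simp
  have ex: "\<exists>w\<in>carrier W. h (t V v v0) = t W w v0" if v: "v \<in> carrier V" for v
  proof -
    have hP: "h (t V v v0) \<in> carrier (P W)" using hD(1) tV(1)[OF v v0(1)] by simp
    have "\<not> (gact (F W) a (h (t V v v0)) = t W w x \<and> w \<in> carrier W \<and> w \<noteq> \<zero>\<^bsub>W\<^esub> \<and> x \<in> carrier \<pi> \<and> x \<noteq> \<zero>\<^bsub>\<pi>\<^esub>)"
      if a: "a \<in> ann G \<pi> [v0]" for a w x
    proof
      assume *: "gact (F W) a (h (t V v v0)) = t W w x \<and> w \<in> carrier W \<and> w \<noteq> \<zero>\<^bsub>W\<^esub> \<and> x \<in> carrier \<pi> \<and> x \<noteq> \<zero>\<^bsub>\<pi>\<^esub>"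
      have "gact \<pi> a v0 = \<zero>\<^bsub>\<pi>\<^esub>" using annD(2)[OF a] by simp
      then have "t W w x = h (t V v \<zero>\<^bsub>\<pi>\<^esub>)" using hgact[OF annD(1)[OF a] v v0(1)] * by simp
      also have "\<dots> = \<zero>\<^bsub>P W\<^esub>"
        using t_zero(1)[OF V v] intertwiners_zero[OF rep_F[OF V] rep_F[OF W] h] by simp
      finally show False using t_eq_zero[OF W, of w x] * by blast
    qed
    then show ?thesis using pure_or_separated[OF W v0(1) hP] by blast
  qed
  define f where "f v = (SOME w. w \<in> carrier W \<and> h (t V v v0) = t W w v0)" for v
  have f: "f v \<in> carrier W" "h (t V v v0) = t W (f v) v0" if "v \<in> carrier V" for v
  proof -
    have "\<exists>w. w \<in> carrier W \<and> h (t V v v0) = t W w v0" using ex[OF that] by blast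
    from someI_ex[OF this] show "f v \<in> carrier W" "h (t V v v0) = t W (f v) v0" by (simp_all add: f_def)
  qed
  have fl: "clinear_on V W f"
  proof (rule clinear_onI)
    fix v w assume vw: "v \<in> carrier V" "w \<in> carrier V"
    show "f (v \<oplus>\<^bsub>V\<^esub> w) = f v \<oplus>\<^bsub>W\<^esub> f w"
    proof (rule t_inj[OF W])
      have "t W (f (v \<oplus>\<^bsub>V\<^esub> w)) v0 = h (t V v v0 \<oplus>\<^bsub>P V\<^esub> t V w v0)"
        using f(2)[of "v \<oplus>\<^bsub>V\<^esub> w"] vw tV(2)[OF vw v0(1)] by simp
      also have "\<dots> = t W (f v) v0 \<oplus>\<^bsub>P W\<^esub> t W (f w) v0"
        using hD(2)[of "t V v v0" "t V w v0"] tV(1) vw v0(1) f(2) by simp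
      also have "\<dots> = t W (f v \<oplus>\<^bsub>W\<^esub> f w) v0" using tW(2) f(1) vw v0(1) by simp
      finally show "t W (f (v \<oplus>\<^bsub>V\<^esub> w)) v0 = t W (f v \<oplus>\<^bsub>W\<^esub> f w) v0" .
    qed (use f(1) vw in simp_all)
  next
    fix c v assume v: "v \<in> carrier V"
    show "f (c \<odot>\<^bsub>V\<^esub> v) = c \<odot>\<^bsub>W\<^esub> f v"
    proof (rule t_inj[OF W])
      have "t W (f (c \<odot>\<^bsub>V\<^esub> v)) v0 = h (c \<odot>\<^bsub>P V\<^esub> t V v v0)"
        using f(2)[of "c \<odot>\<^bsub>V\<^esub> v"] v tV(4)[OF v v0(1)] by simp
      also have "\<dots> = c \<odot>\<^bsub>P W\<^esub> t W (f v) v0"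
        using hD(3)[of "t V v v0" c] tV(1) v v0(1) f(2) by simp
      also have "\<dots> = t W (c \<odot>\<^bsub>W\<^esub> f v) v0" using tW(4) f(1) v v0(1) by simp
      finally show "t W (f (c \<odot>\<^bsub>V\<^esub> v)) v0 = t W (c \<odot>\<^bsub>W\<^esub> f v) v0" .
    qed (use f(1) v in simp_all)
  qed (rule f(1))
  have fm: "restrict f (carrier V) \<in> linear_maps V W"
    using clinear_onD[OF fl] by (auto simp: linear_maps_def intro!: clinear_onI)
  note i = isotypic_mor_props[OF V W fm]
  have "isotypic_mor \<pi> V W (restrict f (carrier V)) = h"
  proof (rule intertwiners_F_eqI[OF V rep_F[OF W] i(1) h])
    fix v x assume v: "v \<in> carrier V" and x: "x \<in> carrier \<pi>"
    obtain a where a: "gset a \<subseteq> carrier G" "x = gact \<pi> a v0" by (rule v0_cyclic[OF x]) (rule that)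
    have "h (t V v x) = gact (F W) a (t W (f v) v0)"
      unfolding a(2) hgact[OF a(1) v v0(1)] f(2)[OF v] ..
    also have "\<dots> = t W (f v) x" using gact_t[OF W a(1) f(1)[OF v] v0(1)] a(2) by simp
    finally show "isotypic_mor \<pi> V W (restrict f (carrier V)) (t V v x) = h (t V v x)"
      using i(2)[OF v x] v by simp
  qed
  then show ?thesis using fm by blast
qed

lemma faithful_F:
  assumes V: "cvector_space V" and W: "cvector_space W" and f: "f \<in> linear_maps V W" "f' \<in> linear_maps V W"
    and eq: "isotypic_mor \<pi> V W f = isotypic_mor \<pi> V W f'"
  shows "f = f'"
proof (rule extensionalityI[of _ "carrier V"])
  show "f v = f' v" if v: "v \<in> carrier V" for v
  proof (rule t_inj[OF W])
    show "f v \<in> carrier W" "f' v \<in> carrier W"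
      using f v by (auto simp: linear_maps_def clinear_on_def)
    show "t W (f v) v0 = t W (f' v) v0"
      using isotypic_mor_props(2)[OF V W f(1) v v0(1)] isotypic_mor_props(2)[OF V W f(2) v v0(1)] eq by simp
  qed
qed (use f in \<open>simp_all add: linear_maps_def\<close>)

text \<open>Evaluation is injective by \<open>intertwiner_F_inj\<close>, because a nonzero
  homomorphism out of the irreducible \<pi> is injective; it is surjective by
  \<open>isotypic_hsum\<close>.\<close>

lemma essentially_surjective_F:
  fixes M :: "('g, 'u) rep"
  assumes M: "smooth_rep G T M" and Supp: "Supp G T M \<subseteq> {rep_class G T \<pi>}"
  obtains V and h where "cvector_space V" "h \<in> intertwiners G (F V) M" "bij_betw h (carrier (F V)) (carrier M)"
proof -
  have rM: "representation G M" using M by (rule smooth_representation)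
  interpret M: cspace M using rM by (rule representationD)
  let ?I = "intertwiners G \<pi> M"
  define E where "E = (\<lambda>\<theta>. \<theta> v0) ` ?I"
  have add_I: "(\<lambda>x\<in>carrier \<pi>. \<theta> x \<oplus>\<^bsub>M\<^esub> \<theta>' x) \<in> ?I" if "\<theta> \<in> ?I" "\<theta>' \<in> ?I" for \<theta> \<theta>'
  proof (rule intertwiners_restrictI[OF \<pi>_rep])
    note a = intertwinersD[OF that(1)] and b = intertwinersD[OF that(2)]
    show "\<theta> (x \<oplus>\<^bsub>\<pi>\<^esub> y) \<oplus>\<^bsub>M\<^esub> \<theta>' (x \<oplus>\<^bsub>\<pi>\<^esub> y) = (\<theta> x \<oplus>\<^bsub>M\<^esub> \<theta>' x) \<oplus>\<^bsub>M\<^esub> (\<theta> y \<oplus>\<^bsub>M\<^esub> \<theta>' y)"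
      if "x \<in> carrier \<pi>" "y \<in> carrier \<pi>" for x y
      using that a(1,2) b(1,2) by (simp add: M.M.a_ac)
    show "\<theta> (act \<pi> g x) \<oplus>\<^bsub>M\<^esub> \<theta>' (act \<pi> g x) = act M g (\<theta> x \<oplus>\<^bsub>M\<^esub> \<theta>' x)"
      if "g \<in> carrier G" "x \<in> carrier \<pi>" for g x
      using that a(1,5) b(1,5) clinear_onD(2)[OF representationD(2)[OF rM]] by simp
  qed (use intertwinersD(1,3)[OF that(1)] intertwinersD(1,3)[OF that(2)] in \<open>simp_all add: M.csmult_add_right\<close>)
  have scale_I: "(\<lambda>x\<in>carrier \<pi>. c \<odot>\<^bsub>M\<^esub> \<theta> x) \<in> ?I" if "\<theta> \<in> ?I" for c \<theta>
    by (rule intertwiners_restrictI[OF \<pi>_rep])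
      (use intertwinersD(1-3,5)[OF that] clinear_onD(3)[OF representationD(2)[OF rM]]
        in \<open>simp_all add: M.csmult_add_right M.csmult_assoc mult.commute\<close>)
  have E: "csubspace M E"
  proof (rule csubspaceI)
    show "E \<subseteq> carrier M" using intertwinersD(1)[of _ G \<pi> M v0] v0(1) by (auto simp: E_def)
    show "\<zero>\<^bsub>M\<^esub> \<in> E" unfolding E_def
      by (rule image_eqI[OF _ intertwiners_const_zero[OF \<pi>_rep rM]]) (use v0(1) in simp)
  next
    fix x y assume "x \<in> E" "y \<in> E"
    then obtain \<theta> \<theta>' where "\<theta> \<in> ?I" "x = \<theta> v0" "\<theta>' \<in> ?I" "y = \<theta>' v0" by (auto simp: E_def)
    then show "x \<oplus>\<^bsub>M\<^esub> y \<in> E" unfolding E_def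
      by (intro image_eqI[OF _ add_I[of \<theta> \<theta>']]) (use v0(1) in simp_all)
  next
    fix c x assume "x \<in> E"
    then obtain \<theta> where "\<theta> \<in> ?I" "x = \<theta> v0" by (auto simp: E_def)
    then show "c \<odot>\<^bsub>M\<^esub> x \<in> E" unfolding E_def
      by (intro image_eqI[OF _ scale_I[of \<theta> c]]) (use v0(1) in simp_all)
  qed
  \<comment> \<open>Objects of \<open>Vec\<close> are modules without an action, so the field
    \<open>act\<close> is cut off.\<close>
  define V where "V = module.truncate (M\<lparr>carrier := E\<rparr>)"
  have V: "cvector_space V"
    unfolding V_def by (rule cvector_space_truncate[OF M.cvector_space_csubspace[OF E]])
  have Vs [simp]: "carrier V = E" "zero V = zero M" "add V = add M" "module.smult V = module.smult M"
    by (simp_all add: V_def)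
  have uniq: "\<theta> x = \<theta>' x" if \<theta>: "\<theta> \<in> ?I" "\<theta>' \<in> ?I" "\<theta> v0 = \<theta>' v0" and x: "x \<in> carrier \<pi>" for \<theta> \<theta>' x
  proof -
    obtain a where a: "gset a \<subseteq> carrier G" "x = gact \<pi> a v0" by (rule v0_cyclic[OF x]) (rule that)
    show ?thesis
      unfolding a(2) gact_intertwiner[OF \<pi>_rep a(1) v0(1) \<theta>(1)] gact_intertwiner[OF \<pi>_rep a(1) v0(1) \<theta>(2)] \<theta>(3) ..
  qed
  \<comment> \<open>Recovers a homomorphism from its value \<open>m\<close> at \<open>v0\<close>;
    its values on \<pi> are determined by \<open>uniq\<close>, and this makes
    \<open>\<Theta>\<close> linear in \<open>m\<close>.\<close>
  define \<Theta> where "\<Theta> m = (SOME \<theta>. \<theta> \<in> ?I \<and> \<theta> v0 = m)" for m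
  have \<Theta>: "\<Theta> m \<in> ?I" "\<Theta> m v0 = m" if "m \<in> E" for m
  proof -
    have "\<exists>\<theta>. \<theta> \<in> ?I \<and> \<theta> v0 = m" using that by (auto simp: E_def)
    from someI_ex[OF this] show "\<Theta> m \<in> ?I" "\<Theta> m v0 = m" by (simp_all add: \<Theta>_def)
  qed
  note ED = csubspaceD[OF E]
  have bil: "bilinear_on V \<pi> M \<Theta>"
  proof (rule bilinear_onI)
    fix m m' x assume m: "m \<in> carrier V" "m' \<in> carrier V" and x: "x \<in> carrier \<pi>"
    have mE: "m \<in> E" "m' \<in> E" using m by simp_all
    have "\<Theta> (m \<oplus>\<^bsub>M\<^esub> m') x = (\<lambda>x\<in>carrier \<pi>. \<Theta> m x \<oplus>\<^bsub>M\<^esub> \<Theta> m' x) x"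
      by (rule uniq[OF \<Theta>(1)[OF ED(3)[OF mE]] add_I[OF \<Theta>(1)[OF mE(1)] \<Theta>(1)[OF mE(2)]] _ x])
        (use \<Theta>(2) ED(3) mE v0(1) in simp)
    then show "\<Theta> (m \<oplus>\<^bsub>V\<^esub> m') x = \<Theta> m x \<oplus>\<^bsub>M\<^esub> \<Theta> m' x" using x by simp
  next
    fix c m x assume m: "m \<in> carrier V" and x: "x \<in> carrier \<pi>"
    have mE: "m \<in> E" using m by simp
    have "\<Theta> (c \<odot>\<^bsub>M\<^esub> m) x = (\<lambda>x\<in>carrier \<pi>. c \<odot>\<^bsub>M\<^esub> \<Theta> m x) x"
      by (rule uniq[OF \<Theta>(1)[OF ED(4)[OF mE]] scale_I[OF \<Theta>(1)[OF mE]] _ x])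
        (use \<Theta>(2) ED(4) mE v0(1) in simp)
    then show "\<Theta> (c \<odot>\<^bsub>V\<^esub> m) x = c \<odot>\<^bsub>M\<^esub> \<Theta> m x" using x by simp
  qed (use intertwinersD(1-3)[OF \<Theta>(1)] in simp_all)
  have "\<exists>h. h \<in> linear_maps (P V) M \<and> (\<forall>m\<in>E. \<forall>x\<in>carrier \<pi>. h (t V m x) = \<Theta> m x)"
    using ex1_implies_ex[OF tensor_lift[OF V \<pi>_space tensor[OF V] M.cvector_space bil]] by simp
  then obtain h where h: "h \<in> linear_maps (P V) M"
    "\<And>m x. m \<in> E \<Longrightarrow> x \<in> carrier \<pi> \<Longrightarrow> h (t V m x) = \<Theta> m x"
    by blast
  have hl: "clinear_on (P V) M h" using h(1) by (simp add: linear_maps_def)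
  have eq: "h (act (F V) g u) = act M g (h u)" if g: "g \<in> carrier G" and u: "u \<in> carrier (P V)" for g u
  proof (rule t_ext[OF V M.cvector_space, where f = "\<lambda>u. h (act (F V) g u)" and h = "\<lambda>u. act M g (h u)"])
    note aV = act_F[OF V g] and aM = representationD(2)[OF rM g]
    show "clinear_on (P V) M (\<lambda>u. h (act (F V) g u))"
      by (rule clinear_onI) (simp_all add: clinear_onD[OF hl] clinear_onD[OF aV(1)])
    show "clinear_on (P V) M (\<lambda>u. act M g (h u))"
      by (rule clinear_onI) (simp_all add: clinear_onD[OF hl] clinear_onD[OF aM])
    show "h (act (F V) g (t V m x)) = act M g (h (t V m x))"
      if "m \<in> carrier V" "x \<in> carrier \<pi>" for m x
      using that h(2) aV(2) intertwinersD(5)[OF \<Theta>(1) g] representationD(5)[OF \<pi>_rep g] by simp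
  qed (rule u)
  have hi: "h \<in> intertwiners G (F V) M"
    by (rule intertwinersI) (use h(1) clinear_onD[OF hl] eq in \<open>simp_all add: linear_maps_def\<close>)
  have "inj_on h (carrier (F V))"
  proof (rule intertwiner_F_inj[OF V rM hi])
    fix m x assume "m \<in> carrier V" "m \<noteq> \<zero>\<^bsub>V\<^esub>" and x: "x \<in> carrier \<pi>" "x \<noteq> \<zero>\<^bsub>\<pi>\<^esub>"
    then have m: "m \<in> E" "\<Theta> m v0 \<noteq> \<zero>\<^bsub>M\<^esub>" using \<Theta>(2) by simp_all
    show "h (t V m x) \<noteq> \<zero>\<^bsub>M\<^esub>"
      using irreducible_inj(1)[OF \<pi>_irreducible rM \<Theta>(1)[OF m(1)] v0(1) m(2) x(1)] x(2) h(2)[OF m(1) x(1)]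
      by auto
  qed
  moreover have "h ` carrier (F V) = carrier M"
  proof
    note im = csubspaceD[OF subrepD(1)[OF subrep_image[OF rep_F[OF V] rM hi]]]
    show "h ` carrier (F V) \<subseteq> carrier M" by (rule im(1))
    \<comment> \<open>Any \<open>\<theta>\<close> coincides on \<pi> with
      \<open>\<Theta> (\<theta> v0)\<close>, so its values are images of pure tensors.\<close>
    have pure: "\<theta> y \<in> h ` carrier (F V)" if \<theta>: "\<theta> \<in> ?I" and y: "y \<in> carrier \<pi>" for \<theta> y
    proof -
      have m: "\<theta> v0 \<in> E" using \<theta> by (auto simp: E_def)
      have "\<theta> y = h (t V (\<theta> v0) y)"
        using uniq[OF \<theta> \<Theta>(1)[OF m] \<Theta>(2)[OF m, symmetric] y] h(2)[OF m y] by simp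
      moreover have "t V (\<theta> v0) y \<in> carrier (F V)" using tD(1)[OF V, of "\<theta> v0" y] m y by simp
      ultimately show ?thesis by blast
    qed
    show "carrier M \<subseteq> h ` carrier (F V)"
    proof
      fix x assume x: "x \<in> carrier M"
      have "rep_class G T \<pi> \<in> dual G T" using \<pi> by (simp add: dual_def)
      moreover have "\<pi> \<in> rep_class G T \<pi>"
        using \<pi> rep_isomorphic_refl[OF \<pi>_rep] by (simp add: rep_class_def)
      ultimately obtain bs where bs: "set bs \<subseteq> carrier \<pi>" "x \<in> hsum G \<pi> M bs"
        by (rule isotypic_hsum[OF lc tame _ _ M Supp x]) (rule that)
      then show "x \<in> h ` carrier (F V)"
      proof (induction bs arbitrary: x)
        case Nil
        then show ?case using im(2) by simp
      next
        case (Cons y ys)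
        obtain z \<theta> where z: "z \<in> hsum G \<pi> M ys" "\<theta> \<in> ?I" "x = z \<oplus>\<^bsub>M\<^esub> \<theta> y" using Cons.prems(2) by auto
        have "z \<in> h ` carrier (F V)" by (rule Cons.IH[OF _ z(1)]) (use Cons.prems(1) in simp)
        then show ?case unfolding z(3) by (rule im(3)) (rule pure[OF z(2)], use Cons.prems(1) in simp)
      qed
    qed
  qed
  ultimately have "bij_betw h (carrier (F V)) (carrier M)" by (simp add: bij_betw_def)
  then show thesis using that V hi by blast
qed

text \<open>Each functor law equates two homomorphisms out of some \<open>F V\<close>, so it is
  enough to compare them on pure tensors.\<close>

lemma functor_F: "is_functor Vec (Rep_supp G T (rep_class G T \<pi>)) F (isotypic_mor \<pi>)"
  unfolding is_functor_def
proof (intro conjI ballI)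
  let ?D = "Rep_supp G T (rep_class G T \<pi>)"
  show "is_category (Vec :: ((complex, 'u) module, 'u \<Rightarrow> 'u) cat)" by (rule is_category_Vec)
  show "is_category ?D" unfolding Rep_supp_def by (rule is_category_full_subcategory[OF is_category_Rep])
  fix V :: "(complex, 'u) module" assume "V \<in> Ob Vec"
  then have V: "cvector_space V" by (simp add: Vec_def)
  show "F V \<in> Ob ?D"
    using smooth_F[OF V] Supp_F[OF V] by (simp add: Rep_supp_def full_subcategory_def Rep_def)
  note i = isotypic_mor_props[OF V V linear_maps_id[OF V]]
  have "isotypic_mor \<pi> V V (\<lambda>x\<in>carrier V. x) = (\<lambda>u\<in>carrier (F V). u)"
    by (rule intertwiners_F_eqI[OF V rep_F[OF V] i(1) intertwiners_id[OF rep_F[OF V]]])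
      (use i(2) tD(1)[OF V] in simp)
  then show "isotypic_mor \<pi> V V (Idn Vec V) = Idn ?D (F V)"
    by (simp add: Rep_supp_def full_subcategory_def Rep_def Vec_def)
  fix W :: "(complex, 'u) module" assume "W \<in> Ob Vec"
  then have W: "cvector_space W" by (simp add: Vec_def)
  show "isotypic_mor \<pi> V W f \<in> Mor ?D (F V) (F W)" if "f \<in> Mor Vec V W" for f
    using that isotypic_mor_props(1)[OF V W] by (simp add: Rep_supp_def full_subcategory_def Rep_def Vec_def)
  fix X :: "(complex, 'u) module" and f g
  assume "X \<in> Ob Vec" and "f \<in> Mor Vec V W" and "g \<in> Mor Vec W X"
  then have X: "cvector_space X" and f: "f \<in> linear_maps V W" and g: "g \<in> linear_maps W X"
    by (simp_all add: Vec_def)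
  have fW: "f v \<in> carrier W" if "v \<in> carrier V" for v using f that by (auto simp: linear_maps_def clinear_on_def)
  note mf = isotypic_mor_props[OF V W f] and mg = isotypic_mor_props[OF W X g]
    and mgf = isotypic_mor_props[OF V X linear_maps_compose[OF V f g]]
  have "isotypic_mor \<pi> V X (compose (carrier V) g f)
      = compose (carrier (F V)) (isotypic_mor \<pi> W X g) (isotypic_mor \<pi> V W f)"
    by (rule intertwiners_F_eqI[OF V rep_F[OF X] mgf(1) intertwiners_compose[OF rep_F[OF V] mf(1) mg(1)]])
      (use mf(2) mg(2) mgf(2) fW tD(1)[OF V] in \<open>simp add: compose_def\<close>)
  then show "isotypic_mor \<pi> V X (Cmp Vec V W X g f)
      = Cmp ?D (F V) (F W) (F X) (isotypic_mor \<pi> W X g) (isotypic_mor \<pi> V W f)"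
    by (simp add: Rep_supp_def full_subcategory_def Rep_def Vec_def)
qed

lemma equivalence_F: "is_equivalence Vec (Rep_supp G T (rep_class G T \<pi>)) F (isotypic_mor \<pi>)"
proof (rule is_equivalenceI[OF functor_F])
  let ?D = "Rep_supp G T (rep_class G T \<pi>)"
  have D: "Ob ?D = {M. smooth_rep G T M \<and> Supp G T M \<subseteq> {rep_class G T \<pi>}}" "Mor ?D = intertwiners G"
    "Idn ?D = (\<lambda>M. \<lambda>x\<in>carrier M. x)" "Cmp ?D = (\<lambda>L M N g f. compose (carrier L) g f)"
    by (auto simp: Rep_supp_def full_subcategory_def Rep_def)
  have C: "Ob Vec = {V :: (complex, 'u) module. cvector_space V}"
    "Mor Vec = (linear_maps :: (complex, 'u) module \<Rightarrow> (complex, 'u) module \<Rightarrow> ('u \<Rightarrow> 'u) set)"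
    by (simp_all add: Vec_def)
  show "\<exists>f\<in>Mor Vec V W. isotypic_mor \<pi> V W f = g"
    if "V \<in> Ob Vec" "W \<in> Ob Vec" "g \<in> Mor ?D (F V) (F W)" for V W g
    using that full_F unfolding C D by blast
  show "f = f'" if "V \<in> Ob Vec" "W \<in> Ob Vec" "f \<in> Mor Vec V W" "f' \<in> Mor Vec V W"
    "isotypic_mor \<pi> V W f = isotypic_mor \<pi> V W f'" for V W f f'
    using that faithful_F unfolding C by blast
  fix M assume "M \<in> Ob ?D"
  then have M: "smooth_rep G T M" "Supp G T M \<subseteq> {rep_class G T \<pi>}" unfolding D by auto
  have rM: "representation G M" using M(1) by (rule smooth_representation)
  obtain V h where V: "cvector_space V" and h: "h \<in> intertwiners G (F V) M"
    and bij: "bij_betw h (carrier (F V)) (carrier M)"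
    by (rule essentially_surjective_F[OF M]) (rule that)
  \<comment> \<open>The inverse function is restricted to the carrier because morphisms are
    extensional.\<close>
  let ?k = "restrict (inv_into (carrier (F V)) h) (carrier M)"
  have k: "?k \<in> intertwiners G M (F V)" by (rule intertwiners_inverse[OF rep_F[OF V] rM h bij])
  have "compose (carrier (F V)) ?k h = (\<lambda>x\<in>carrier (F V). x)" by (rule compose_inv_into_id[OF bij])
  moreover have "compose (carrier M) h ?k = (\<lambda>x\<in>carrier M. x)"
    by (rule compose_id_inv_into) (use bij in \<open>simp add: bij_betw_def\<close>)
  ultimately have "is_iso ?D (F V) M h" unfolding is_iso_def D using h k by blast
  then show "\<exists>V\<in>Ob Vec. \<exists>f. is_iso ?D (F V) M f" unfolding C using V by blast
qed

end

theorem theorem1p5: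
  fixes G :: "('g, 'b) monoid_scheme" and T :: "'g topology"
    and c :: "('g, 'u) rep set" and \<pi> :: "('g, 'u) rep"
  assumes "lc_group G T"
    and "tame TYPE('u) G T"
    and "c \<in> dual G T"
    and "\<pi> \<in> c"
  shows "is_equivalence Vec (Rep_supp G T c) (isotypic_obj \<pi>) (isotypic_mor \<pi>)"
proof -
  note c = dual_memberD[OF assms(3,4)]
  interpret isotypic G T \<pi> by (rule isotypic.intro[OF assms(1,2) c(1)])
  show ?thesis unfolding c(2) by (rule equivalence_F)
qed

end
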